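(* Let $n\ge 2$, let $p_{4n}=\frac{4n+2}{4n-2}$ and, for $q>1$ and $k\ge 1$ an integer, let $\alpha_k^q=\frac{4k(4k+4n+2)}{q-1}$. If $q\in(1,p_{4n})$ then for any positive integer $k$ and any $\lambda\in(\alpha_k^q,\alpha_{k+1}^q]$ the equation $$-\Delta_{h_{FS}}u+\lambda u=\lambda u^q$$ on $(\mathbf{HP}^n,h_{FS})$ has at least $(2[(n+1)/2]+1)\,k$ different positive solutions.
   Context: $\mathbf{HP}^n$ is the quaternionic projective space (real dimension $4n$) and $h_{FS}$ is its canonical metric, normalized so that the Hopf fibration $\mathbb S^3\to\mathbb S^{4n+3}\to\mathbf{HP}^n$ from the round sphere of curvature one is a Riemannian submersion (with totally geodesic fibers); the positive eigenvalues of $-\Delta_{h_{FS}}$ are then $2i(2i+4n+2)$, $i\ge 1$. $\Delta_{h_{FS}}$ is the Laplace–Beltrami operator, with the sign convention that $-\Delta_{h_{FS}}$ is nonnegative. $[\,\cdot\,]$ denotes the integer part. Solutions are counted as distinct functions. *)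

theory Defs
  imports "HOL-Analysis.Analysis"
begin

text \<open>
  The pair \<open>(a, b)\<close> stands for the quaternion \<open>a + b j\<close>, where \<open>j c = cnj c j\<close> for complex \<open>c\<close>.
  The product type carries the Euclidean inner product of \<open>\<real>\<^sup>4\<close>.
\<close>

type_synonym quat = "complex \<times> complex"

definition qmult :: "quat \<Rightarrow> quat \<Rightarrow> quat" where
  "qmult p q = (fst p * fst q - snd p * cnj (snd q), fst p * snd q + snd p * cnj (fst q))"

definition qone :: quat where
  "qone = (1, 0)"

definition qimag_units :: "quat set" where
  "qimag_units = {(\<i>, 0), (0, 1), (0, \<i>)}"

text \<open>
  \<open>\<bbbH>\<^sup>n\<^sup>+\<^sup>1\<close> is a right module over the quaternions; its \<open>n + 1\<close> coordinates are indexed by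
  \<open>'n option\<close>, where \<open>n = CARD('n)\<close>.
\<close>

definition qscale :: "quat ^ 'm \<Rightarrow> quat \<Rightarrow> quat ^ 'm" where
  "qscale x q = (\<chi> i. qmult (x $ i) q)"

typedef 'n hproj =
  "{L :: (quat ^ ('n::finite option)) set. \<exists>x. x \<noteq> 0 \<and> L = range (qscale x)}"
proof -
  have "axis None qone \<noteq> (0 :: quat ^ ('n option))"
    by (simp add: qone_def zero_prod_def axis_eq_0_iff)
  then show ?thesis by blast
qed

definition hline :: "quat ^ ('n::finite option) \<Rightarrow> 'n hproj" where
  "hline x = Abs_hproj (range (qscale x))"

text \<open>
  The affine chart \<open>{x\<^sub>a \<noteq> 0}\<close>, parametrized by \<open>\<real>\<^sup>4\<^sup>n\<close>, whose coordinates are indexed by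
  \<open>'n \<times> 4\<close>. The homogeneous coordinate \<open>x\<^sub>a\<close> is set to 1 and the remaining ones are the affine
  coordinates; for \<open>a = Some b\<close> the affine coordinate with index \<open>b\<close> is put at position \<open>None\<close>.
\<close>

definition qcoord :: "real ^ ('n::finite \<times> 4) \<Rightarrow> 'n \<Rightarrow> quat" where
  "qcoord y j = (Complex (y $ (j, 1)) (y $ (j, 2)), Complex (y $ (j, 3)) (y $ (j, 4)))"

definition affine_lift ::
  "'n option \<Rightarrow> real ^ ('n::finite \<times> 4) \<Rightarrow> quat ^ ('n option)" where
  "affine_lift a y =
     (\<chi> i. if i = a then qone
           else (case i of None \<Rightarrow> qcoord y (the a) | Some j \<Rightarrow> qcoord y j))"

definition hchart :: "'n option \<Rightarrow> real ^ ('n::finite \<times> 4) \<Rightarrow> 'n hproj" where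
  "hchart a y = hline (affine_lift a y)"

definition sphere_section ::
  "'n option \<Rightarrow> real ^ ('n::finite \<times> 4) \<Rightarrow> quat ^ ('n option)" where
  "sphere_section a y = affine_lift a y /\<^sub>R norm (affine_lift a y)"

text \<open>
  The Hopf map is the restriction of \<^const>\<open>hline\<close> to the unit sphere. At a unit vector \<open>x\<close> the
  tangent space of its fibre \<open>{x q. norm q = 1}\<close> has the orthonormal basis \<open>x i, x j, x k\<close>.
\<close>

definition horizontal_part ::
  "quat ^ ('n::finite option) \<Rightarrow> quat ^ ('n option) \<Rightarrow> quat ^ ('n option)" where
  "horizontal_part x v = v - (\<Sum>e\<in>qimag_units. (v \<bullet> qscale x e) *\<^sub>R qscale x e)"

text \<open>
  \<open>sphere_section a\<close> is a local section of the Hopf map, so the Hopf map is a Riemannian submersion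
  exactly when the inner product of two coordinate vectors is the inner product of the
  horizontal parts of their images under the derivative of this section.
\<close>

definition fs_metric ::
  "'n option \<Rightarrow> real ^ ('n::finite \<times> 4) \<Rightarrow> real ^ ('n \<times> 4) ^ ('n \<times> 4)" where
  "fs_metric a y =
     (let hor = (\<lambda>i. horizontal_part (sphere_section a y)
                       (frechet_derivative (sphere_section a) (at y) (axis i 1)))
      in \<chi> i j. hor i \<bullet> hor j)"

definition partial :: "'k \<Rightarrow> (real ^ 'k::finite \<Rightarrow> real) \<Rightarrow> real ^ 'k \<Rightarrow> real" where
  "partial i f x = frechet_derivative f (at x) (axis i 1)"

definition C1 :: "(real ^ 'k::finite \<Rightarrow> real) \<Rightarrow> bool" where
  "C1 f \<longleftrightarrow> (\<forall>x. f differentiable (at x)) \<and> (\<forall>i. continuous_on UNIV (partial i f))"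

definition C2 :: "(real ^ 'k::finite \<Rightarrow> real) \<Rightarrow> bool" where
  "C2 f \<longleftrightarrow> C1 f \<and> (\<forall>i. C1 (partial i f))"

definition laplace_beltrami ::
  "(real ^ 'k \<Rightarrow> real ^ 'k ^ 'k) \<Rightarrow> (real ^ 'k::finite \<Rightarrow> real) \<Rightarrow> real ^ 'k \<Rightarrow> real" where
  "laplace_beltrami g f x =
     (\<Sum>i\<in>UNIV. partial i (\<lambda>y. sqrt (det (g y)) *
        (\<Sum>j\<in>UNIV. matrix_inv (g y) $ i $ j * partial j f y)) x) / sqrt (det (g x))"

definition C2_hproj :: "('n::finite hproj \<Rightarrow> real) \<Rightarrow> bool" where
  "C2_hproj u \<longleftrightarrow> (\<forall>a. C2 (u \<circ> hchart a))"

text \<open>The Laplace--Beltrami operator does not depend on the chart, so any chart around \<open>p\<close> will do.\<close>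

definition hproj_laplacian :: "('n::finite hproj \<Rightarrow> real) \<Rightarrow> 'n hproj \<Rightarrow> real" where
  "hproj_laplacian u p =
     (let (a, y) = (SOME (a, y). hchart a y = p)
      in laplace_beltrami (fs_metric a) (u \<circ> hchart a) y)"

definition positive_solutions :: "real \<Rightarrow> real \<Rightarrow> ('n::finite hproj \<Rightarrow> real) set" where
  "positive_solutions q lam =
     {u. C2_hproj u \<and> (\<forall>p. u p > 0) \<and>
         (\<forall>p. - hproj_laplacian u p + lam * u p = lam * u p powr q)}"

definition alpha :: "nat \<Rightarrow> real \<Rightarrow> nat \<Rightarrow> real" where
  "alpha n q k = 4 * real k * (4 * real k + 4 * real n + 2) / (q - 1)"

end

theory Submission
  imports Defs "HOL-Complex_Analysis.Great_Picard"
begin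

text \<open>
  Solutions are counted as functions, and the isometry group of the projective space acts on the
  set of solutions. A single nonconstant positive solution therefore produces a continuum of them,
  and the theorem follows from the existence of one nonconstant positive solution for
  \<open>lam > alpha n q 1\<close>, where the constant solution 1 is not a minimiser of the constrained energy.

  \<^emph>\<open>Reduction to an ordinary equation.\<close> For a unit vector \<open>v\<close> with real entries the function
  \<open>s = norm (\<Sum>i. v i x i)\<^sup>2 / norm x\<^sup>2\<close> is well defined on the lines; its level sets are the distance
  spheres around the point spanned by \<open>v\<close>. An explicit computation in the affine charts
  (\<open>laplace_beltrami_sigma\<close>), based on closed forms of the metric, its determinant and its inverse,
  turns the Laplacian of \<open>U(s)\<close> into \<open>4 s (1 - s) U'' + (8 - 8 (n + 1) s) U'\<close>. With
  \<open>\<kappa> = 2 n - 1\<close> and \<open>\<mu> = lam / 4\<close> the equation for \<open>U\<close> is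
  \<open>s (1 - s) U'' + (2 - (\<kappa> + 3) s) U' = \<mu> (U - U\<^sup>q)\<close> on \<open>[0, 1]\<close>, or in divergence form
  \<open>(s\<^sup>2 (1 - s)\<^sup>\<kappa>\<^sup>+\<^sup>1 U')' = \<mu> s (1 - s)\<^sup>\<kappa> (U - U\<^sup>q)\<close>.

  \<^emph>\<open>Existence of a profile.\<close> Let \<open>K h\<close> be the solution \<open>f\<close> of the linear equation with \<open>U - U\<^sup>q\<close>
  replaced by \<open>f - h\<close>. The nonlinear power iteration \<open>u \<mapsto> c K(u\<^sup>q)\<close>, where \<open>c\<close> normalises the weighted
  integral of \<open>u\<^sup>q\<^sup>+\<^sup>1\<close>, decreases the energy, which is the quadratic form of the linear equation, and the energy drop controls the distance between
  consecutive iterates (\<open>power_step\<close>). Hence every limit point is a fixed point. If the iteration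
  starts with less energy than the constant function 1 (\<open>unstable_start\<close>), then the factors
  \<open>c\<close> stay below a number less than 1, whereas a constant limit would need \<open>c = 1\<close>.

  Compactness comes from monotonicity: \<open>K\<close> maps decreasing functions to decreasing functions
  (\<open>solves_decreasing\<close>), so blow-up is possible only at \<open>s = 0\<close>, the side of the cut locus of the
  centre. There the energy gives \<open>u \<le> M / sqrt s\<close> (\<open>profile_bound\<close>), and since the
  subcriticality assumption with \<open>n \<ge> 2\<close> gives \<open>q < 2\<close>, one further application of \<open>K\<close> turns this into
  a uniform bound (\<open>power_step_bound\<close>). The Arzela--Ascoli theorem does the rest.

  \<^emph>\<open>Distinctness.\<close> If \<open>v\<close> runs through a circle of unit vectors, the restriction of \<open>U(s)\<close> to a
  projective circle is \<open>U(cos\<^sup>2 (\<theta> - t))\<close>. Two equal functions would make \<open>U(cos\<^sup>2 t)\<close>, which is monotone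
  on \<open>[0, pi/2]\<close>, periodic with a period below \<open>pi/2\<close>, and \<open>U\<close> would be constant
  (\<open>height_family_inj\<close>).
\<close>

section \<open>Calculus on the unit interval\<close>

lemma increasing_of_deriv_within:
  fixes g g' :: "real \<Rightarrow> real"
  assumes "0 \<le> a" "a \<le> b" "b \<le> 1" and "continuous_on {a..b} g"
    and "\<And>x. a < x \<Longrightarrow> x < b \<Longrightarrow> (g has_real_derivative g' x) (at x within {0..1})"
    and "\<And>x. a < x \<Longrightarrow> x < b \<Longrightarrow> 0 \<le> g' x"
  shows "g a \<le> g b"
proof (rule DERIV_nonneg_imp_increasing_open[OF \<open>a \<le> b\<close> _ assms(4)])
  fix x assume x: "a < x" "x < b"
  then have "at x within {0..1} = at x"
    using assms by (intro at_within_Icc_at) auto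
  then show "\<exists>y. (g has_real_derivative y) (at x) \<and> 0 \<le> y"
    using assms(5,6)[OF x] by auto
qed

lemma deriv_within_cont:
  fixes g g' :: "real \<Rightarrow> real"
  assumes "\<And>x. x \<in> {0..1} \<Longrightarrow> (g has_real_derivative g' x) (at x within {0..1})"
  shows "continuous_on {0..1} g"
  using assms DERIV_continuous_on by blast

lemma MVT_within:
  fixes g g' :: "real \<Rightarrow> real"
  assumes "\<And>x. x \<in> {0..1} \<Longrightarrow> (g has_real_derivative g' x) (at x within {0..1})"
    and "0 \<le> a" "a < b" "b \<le> 1"
  obtains x where "a < x" "x < b" "g b - g a = (b - a) * g' x"
proof -
  have c: "continuous_on {a..b} g"
    by (rule continuous_on_subset[OF deriv_within_cont[OF assms(1)]]) (use assms in auto)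
  have d: "(g has_real_derivative g' x) (at x)" if "a < x" "x < b" for x
  proof -
    have "at x within {0..1} = at x" using that assms by (intro at_within_Icc_at) auto
    then show ?thesis using assms(1)[of x] that assms by auto
  qed
  obtain l z where z: "a < z" "z < b" "(g has_real_derivative l) (at z)" "g b - g a = (b - a) * l"
    using MVT[OF \<open>a < b\<close> c] d real_differentiable_def by blast
  then have "l = g' z" using d DERIV_unique by blast
  with z that show ?thesis by blast
qed

lemma continuous_less_nearby:
  fixes f :: "real \<Rightarrow> real"
  assumes "continuous_on S f" "m \<in> S" "f m < c"
  obtains e where "e > 0" "\<And>t. t \<in> S \<Longrightarrow> \<bar>t - m\<bar> < e \<Longrightarrow> f t < c"
proof -
  obtain e where "e > 0" "\<forall>t\<in>S. dist t m < e \<longrightarrow> dist (f t) (f m) < c - f m"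
    using assms unfolding continuous_on_iff by (meson diff_gt_0_iff_gt)
  then show ?thesis by (intro that[of e]) (force simp: dist_real_def)+
qed

lemma deriv_uniform_limit:
  fixes f f1 :: "nat \<Rightarrow> real \<Rightarrow> real"
  assumes d: "\<And>n s. s \<in> {0..1} \<Longrightarrow> (f n has_real_derivative f1 n s) (at s within {0..1})"
    and lf: "uniform_limit {0..1} f F sequentially"
    and lf1: "uniform_limit {0..1} f1 F1 sequentially"
    and s: "s \<in> {0..1}"
  shows "(F has_real_derivative F1 s) (at s within {0..1})"
proof -
  have lim: "(\<lambda>n. f n x) \<longlonglongrightarrow> F x" if "x \<in> {0..1}" for x
    using tendsto_uniform_limitI[OF lf that] .
  have "\<exists>g. \<forall>x\<in>{0..1}. (\<lambda>n. f n x) \<longlonglongrightarrow> g x \<and> (g has_derivative (*) (F1 x)) (at x within {0..1})"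
  proof (rule has_derivative_sequence[where f' = "\<lambda>n x. (*) (f1 n x)"])
    show "(f n has_derivative (*) (f1 n x)) (at x within {0..1})" if "x \<in> {0..1}" for n x
      using d[OF that] by (simp add: has_field_derivative_def)
    fix e :: real assume "0 < e"
    with lf1 have "\<forall>\<^sub>F n in sequentially. \<forall>x\<in>{0..1}. dist (f1 n x) (F1 x) < e"
      by (rule uniform_limitD)
    then show "\<forall>\<^sub>F n in sequentially. \<forall>x\<in>{0..1}. \<forall>h. norm (f1 n x * h - F1 x * h) \<le> e * norm h"
    proof (eventually_elim, intro ballI allI)
      fix n and x h :: real
      assume "\<forall>x\<in>{0..1}. dist (f1 n x) (F1 x) < e" "x \<in> {0..1}"
      then have "\<bar>f1 n x - F1 x\<bar> \<le> e" by (simp add: dist_real_def less_imp_le)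
      then show "norm (f1 n x * h - F1 x * h) \<le> e * norm h"
        by (simp add: left_diff_distrib[symmetric] abs_mult mult_right_mono)
    qed
  qed (use lim[of 0] in auto)
  then obtain g where "\<forall>x\<in>{0..1}. (\<lambda>n. f n x) \<longlonglongrightarrow> g x \<and> (g has_derivative (*) (F1 x)) (at x within {0..1})"
    by blast
  then have g: "\<And>x. x \<in> {0..1} \<Longrightarrow> (\<lambda>n. f n x) \<longlonglongrightarrow> g x"
    "\<And>x. x \<in> {0..1} \<Longrightarrow> (g has_real_derivative F1 x) (at x within {0..1})"
    by (auto simp: has_field_derivative_def)
  have "g x = F x" if "x \<in> {0..1}" for x
    using LIMSEQ_unique[OF g(1) lim] that by blast
  then show ?thesis
    using has_field_derivative_transform_within[OF g(2)[OF s] zero_less_one s] by auto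
qed

text \<open>
  A Lipschitz solution operator \<open>h \<mapsto> f\<close> carries uniform convergence of the data over to the solutions.
\<close>
lemma uniform_Cauchy_limit:
  fixes f h :: "nat \<Rightarrow> real \<Rightarrow> real"
  assumes "uniform_limit S h H sequentially" and "C \<ge> 0"
    and "\<And>m n R. (\<And>s. s \<in> S \<Longrightarrow> \<bar>h m s - h n s\<bar> \<le> R) \<Longrightarrow> (\<And>s. s \<in> S \<Longrightarrow> \<bar>f m s - f n s\<bar> \<le> C * R)"
  shows "\<exists>F. uniform_limit S f F sequentially"
proof -
  have "uniformly_Cauchy_on S f"
  proof (rule uniformly_Cauchy_onI)
    fix e :: real assume "0 < e"
    define d where "d = e / (C + 1)"
    have "d > 0" using \<open>0 < e\<close> \<open>C \<ge> 0\<close> by (simp add: d_def)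
    have "uniformly_Cauchy_on S h"
      using assms(1) uniformly_convergent_Cauchy uniformly_convergent_on_def by blast
    then obtain M where M: "\<And>s m n. s \<in> S \<Longrightarrow> m \<ge> M \<Longrightarrow> n \<ge> M \<Longrightarrow> dist (h m s) (h n s) < d"
      using \<open>d > 0\<close> unfolding uniformly_Cauchy_on_def by meson
    have "dist (f m s) (f n s) < e" if "s \<in> S" "m \<ge> M" "n \<ge> M" for s m n
    proof -
      have "\<bar>f m s - f n s\<bar> \<le> C * d"
        using M that by (intro assms(3)) (auto simp: dist_real_def less_imp_le)
      also have "C * d < e" using \<open>0 < e\<close> \<open>C \<ge> 0\<close> by (simp add: d_def field_simps)
      finally show ?thesis by (simp add: dist_real_def)
    qed
    then show "\<exists>M. \<forall>x\<in>S. \<forall>m\<ge>M. \<forall>n\<ge>M. dist (f m x) (f n x) < e" by blast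
  qed
  then have "uniformly_convergent_on S f" by (rule Cauchy_uniformly_convergent)
  then show ?thesis by (simp add: uniformly_convergent_on_def)
qed

lemma uniform_limit_mult_continuous:
  fixes w F :: "real \<Rightarrow> real"
  assumes "continuous_on {0..1} w" "uniform_limit {0..1} f F sequentially" "continuous_on {0..1} F"
  shows "uniform_limit {0..1} (\<lambda>n s. w s * f n s) (\<lambda>s. w s * F s) sequentially"
  using assms
  by (intro uniform_lim_mult uniform_limit_const compact_imp_bounded compact_continuous_image) auto

text \<open>
  By the mean value theorem the flux \<open>s\<^sup>a (1 - s)\<^sup>b f1\<close>, which vanishes at both ends, is at most \<open>R s\<^sup>a\<close> and at
  most \<open>R (1 - s)\<^sup>b\<close>. Dividing the first bound by the weight on the left half and the second one on the right
  half gives a bound on \<open>f1\<close> that does not see the degeneration of the weight. It serves both \<open>f'\<close> and, with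
  shifted exponents, \<open>f''\<close>.
\<close>
lemma flux_bound:
  fixes f1 r :: "real \<Rightarrow> real"
  assumes ab: "a \<ge> 1" "b \<ge> 1" and c: "continuous_on {0..1} f1"
    and d: "\<And>s. s \<in> {0..1} \<Longrightarrow> ((\<lambda>s. s^a * (1-s)^b * f1 s) has_real_derivative
              s^(a-1) * (1-s)^(b-1) * r s) (at s within {0..1})"
    and r: "\<And>s. s \<in> {0..1} \<Longrightarrow> \<bar>r s\<bar> \<le> R"
    and s: "s \<in> {0..1}"
  shows "\<bar>f1 s\<bar> \<le> 2^(a+b) * R"
proof -
  have R: "R \<ge> 0" using r[of 0] by auto
  define G where "G = (\<lambda>s. s^a * (1-s)^b * f1 s)"
  define G' where "G' = (\<lambda>s. s^(a-1) * (1-s)^(b-1) * r s)"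
  have dG: "(G has_real_derivative G' s) (at s within {0..1})" if "s \<in> {0..1}" for s
    using d[OF that] by (simp add: G_def G'_def)
  have G0: "G 0 = 0" "G 1 = 0" using ab by (auto simp: G_def)
  have left: "\<bar>G s\<bar> \<le> R * s^a" and right: "\<bar>G s\<bar> \<le> R * (1-s)^b" if s: "0 < s" "s < 1" for s
  proof -
    obtain x where x: "0 < x" "x < s" "G s - G 0 = (s - 0) * G' x"
      by (rule MVT_within[of G G' 0 s]) (use dG s in auto)
    have "x^(a-1) * ((1-x)^(b-1) * \<bar>r x\<bar>) \<le> s^(a-1) * (1 * R)"
      using x s r[of x] by (intro mult_mono power_mono) (auto intro: power_le_one)
    then have "s * \<bar>G' x\<bar> \<le> s * (s^(a-1) * R)"
      using x s by (intro mult_left_mono) (auto simp: G'_def abs_mult mult.assoc)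
    then show "\<bar>G s\<bar> \<le> R * s^a"
      using x(3) G0 s ab by (simp add: abs_mult power_eq_if[of s a] mult_ac)
    obtain y where y: "s < y" "y < 1" "G 1 - G s = (1 - s) * G' y"
      by (rule MVT_within[of G G' s 1]) (use dG s in auto)
    have "(1-y)^(b-1) * (y^(a-1) * \<bar>r y\<bar>) \<le> (1-s)^(b-1) * (1 * R)"
      using y s r[of y] by (intro mult_mono power_mono) (auto intro: power_le_one)
    then have "(1-s) * \<bar>G' y\<bar> \<le> (1-s) * ((1-s)^(b-1) * R)"
      using y s by (intro mult_left_mono) (auto simp: G'_def abs_mult mult_ac)
    moreover have "\<bar>G s\<bar> = \<bar>(1 - s) * G' y\<bar>" using y(3) G0 by simp
    ultimately show "\<bar>G s\<bar> \<le> R * (1-s)^b"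
      using s ab by (simp add: abs_mult power_eq_if[of "1-s" b] mult_ac)
  qed
  have divide: "\<bar>z\<bar> \<le> 2^(a+b) * R"
    if "x^m * (y^l * \<bar>z\<bar>) \<le> R * x^m" "0 < x" "1/2 \<le> y" "l \<le> a + b" for x y z :: real and m l
  proof -
    have 1: "y^l * \<bar>z\<bar> \<le> R" using that(1,2) by (simp add: mult.commute[of R] mult_le_cancel_left_pos)
    have "1 \<le> (2 * y)^l" using that by (intro one_le_power) auto
    then have "\<bar>z\<bar> \<le> (2 * y)^l * \<bar>z\<bar>" by (simp add: mult_le_cancel_right1)
    also have "\<dots> = 2^l * (y^l * \<bar>z\<bar>)" by (simp only: power_mult_distrib mult.assoc)
    also have "\<dots> \<le> 2^(a+b) * R" using 1 R that by (intro mult_mono power_increasing) auto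
    finally show ?thesis .
  qed
  have int: "norm (f1 s) \<le> 2^(a+b) * R" if s: "s \<in> {0<..<1}" for s
  proof (cases "s \<le> 1/2")
    case True
    then show ?thesis using left[of s] s divide[of s a "1-s" b "f1 s"]
      by (simp add: G_def abs_mult mult.assoc)
  next
    case False
    then show ?thesis using right[of s] s divide[of "1-s" b s a "f1 s"]
      by (simp add: G_def abs_mult mult_ac)
  qed
  have "norm (f1 s) \<le> 2^(a+b) * R"
    by (rule continuous_on_closure_norm_le[of "{0<..<1}"]) (use c s int in auto)
  then show ?thesis by simp
qed

section \<open>The linear radial equation\<close>

locale radial =
  fixes \<kappa> :: nat and \<mu> :: real
  assumes kappa: "\<kappa> \<ge> 1" and mu: "\<mu> > 0"
begin

text \<open>
  \<open>wt\<close> is, up to a constant, the density of the function \<open>s\<close> with respect to the volume, and \<open>pw\<close> is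
  \<open>s (1 - s) wt\<close>, where \<open>4 s (1 - s)\<close> is the squared length of the gradient of \<open>s\<close>.
\<close>
definition wt :: "real \<Rightarrow> real" where "wt s = s * (1-s)^\<kappa>"
definition pw :: "real \<Rightarrow> real" where "pw s = s\<^sup>2 * (1-s)^(\<kappa>+1)"

text \<open>
  The boundary condition at the singular ends \<open>0\<close> and \<open>1\<close> is that the derivative \<open>f1\<close> extends continuously
  to the closed interval. The divergence form of the second clause makes sense for merely continuous \<open>h\<close>.
\<close>
definition solves :: "(real \<Rightarrow> real) \<Rightarrow> (real \<Rightarrow> real) \<Rightarrow> (real \<Rightarrow> real) \<Rightarrow> bool" where
  "solves h f f1 \<longleftrightarrow>
     (\<forall>s\<in>{0..1}. (f has_real_derivative f1 s) (at s within {0..1})) \<and> continuous_on {0..1} f1 \<and>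
     (\<forall>s\<in>{0..1}. ((\<lambda>s. pw s * f1 s) has_real_derivative \<mu> * wt s * (f s - h s)) (at s within {0..1}))"

lemma wt_pos: "0 < s \<Longrightarrow> s < 1 \<Longrightarrow> 0 < wt s"
  and wt_nonneg: "0 \<le> s \<Longrightarrow> s \<le> 1 \<Longrightarrow> 0 \<le> wt s"
  and pw_pos: "0 < s \<Longrightarrow> s < 1 \<Longrightarrow> 0 < pw s"
  and pw_nonneg: "0 \<le> s \<Longrightarrow> s \<le> 1 \<Longrightarrow> 0 \<le> pw s"
  and pw_ends: "pw 0 = 0" "pw 1 = 0"
  by (auto simp: wt_def pw_def)

lemma cont_wt [continuous_intros]: "continuous_on S wt"
  and cont_pw [continuous_intros]: "continuous_on S pw"
  unfolding wt_def[abs_def] pw_def[abs_def] by (intro continuous_intros)+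

lemma solvesD:
  assumes "solves h f f1"
  shows "s \<in> {0..1} \<Longrightarrow> (f has_real_derivative f1 s) (at s within {0..1})"
    and "continuous_on {0..1} f1"
    and "s \<in> {0..1} \<Longrightarrow> ((\<lambda>s. pw s * f1 s) has_real_derivative \<mu> * wt s * (f s - h s)) (at s within {0..1})"
    and "continuous_on {0..1} f"
  using assms deriv_within_cont[of f f1] by (auto simp: solves_def)

lemma solves_combine:
  assumes "solves h f f1" "solves k g g1"
  shows "solves (\<lambda>s. a * h s + b * k s) (\<lambda>s. a * f s + b * g s) (\<lambda>s. a * f1 s + b * g1 s)"
  unfolding solves_def
proof (intro conjI ballI)
  show "continuous_on {0..1} (\<lambda>s. a * f1 s + b * g1 s)"
    using solvesD(2)[OF assms(1)] solvesD(2)[OF assms(2)] by (intro continuous_intros)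
  fix s :: real assume s: "s \<in> {0..1}"
  show "((\<lambda>s. a * f s + b * g s) has_real_derivative a * f1 s + b * g1 s) (at s within {0..1})"
    by (rule derivative_eq_intros solvesD(1)[OF assms(1) s] solvesD(1)[OF assms(2) s] refl | simp)+
  have "((\<lambda>s. a * (pw s * f1 s) + b * (pw s * g1 s)) has_real_derivative
       a * (\<mu> * wt s * (f s - h s)) + b * (\<mu> * wt s * (g s - k s))) (at s within {0..1})"
    by (rule derivative_eq_intros solvesD(3)[OF assms(1) s] solvesD(3)[OF assms(2) s] refl | simp)+
  then show "((\<lambda>s. pw s * (a * f1 s + b * g1 s)) has_real_derivative
       \<mu> * wt s * (a * f s + b * g s - (a * h s + b * k s))) (at s within {0..1})"
    by (simp add: algebra_simps)
qed

lemma solves_cong: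
  assumes "solves h f f1" "\<And>s. s \<in> {0..1} \<Longrightarrow> h s = k s" "\<And>s. s \<in> {0..1} \<Longrightarrow> f s = g s"
    "\<And>s. s \<in> {0..1} \<Longrightarrow> f1 s = g1 s"
  shows "solves k g g1"
  unfolding solves_def
proof (intro conjI ballI)
  show "continuous_on {0..1} g1"
    using solvesD(2)[OF assms(1)] assms(4) continuous_on_cong by blast
  fix s :: real assume s: "s \<in> {0..1}"
  show "(g has_real_derivative g1 s) (at s within {0..1})"
    by (rule has_field_derivative_transform_within[OF _ zero_less_one s, of f])
       (use solvesD(1)[OF assms(1) s] assms s in auto)
  show "((\<lambda>s. pw s * g1 s) has_real_derivative \<mu> * wt s * (g s - k s)) (at s within {0..1})"
    by (rule has_field_derivative_transform_within[OF _ zero_less_one s, of "\<lambda>s. pw s * f1 s"])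
       (use solvesD(3)[OF assms(1) s] assms s in auto)
qed

text \<open>
  Maximum principle. At a minimum \<open>m\<close> of \<open>f\<close> the flux vanishes. If \<open>f m < c\<close>, the flux strictly decreases
  near \<open>m\<close>, so \<open>f\<close> would fall below \<open>f m\<close> on the side of \<open>m\<close> that lies in the interval.
\<close>
lemma solves_ge:
  assumes sol: "solves h f f1" and h: "\<And>s. s \<in> {0..1} \<Longrightarrow> c \<le> h s" and s: "s \<in> {0..1}"
  shows "c \<le> f s"
proof (rule ccontr)
  assume neg: "\<not> c \<le> f s"
  note d = solvesD(1)[OF sol] and dG = solvesD(3)[OF sol] and cf = solvesD(4)[OF sol]
  obtain m where m: "m \<in> {0..1}" and min: "\<And>t. t \<in> {0..1} \<Longrightarrow> f m \<le> f t"
    using continuous_attains_inf[OF _ _ cf] by auto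
  have fm: "f m < c" using min[OF s] neg by simp
  \<comment> \<open>at an end point the weight vanishes, at an interior minimum the derivative does\<close>
  have Gm: "pw m * f1 m = 0"
  proof (cases "m = 0 \<or> m = 1")
    case True then show ?thesis by (auto simp: pw_def)
  next
    case False
    then have m01: "0 < m" "m < 1" using m by auto
    then have "(f has_real_derivative f1 m) (at m)" using d[OF m] at_within_Icc_at by metis
    moreover have "\<forall>y. \<bar>m - y\<bar> < min m (1-m) \<longrightarrow> f m \<le> f y"
      by (intro allI impI min) auto
    ultimately have "f1 m = 0" using m01 DERIV_local_min[of f "f1 m" m "min m (1-m)"] by auto
    then show ?thesis by simp
  qed
  obtain e where e: "e > 0" and near: "\<And>t. t \<in> {0..1} \<Longrightarrow> \<bar>t - m\<bar> < e \<Longrightarrow> f t < c"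
    using continuous_less_nearby[OF cf m fm] by blast
  show False
  proof (cases "m < 1")
    case True
    define t where "t = min 1 (m + e/2)"
    have t: "m < t" "t \<le> 1" "t \<le> m + e/2" using True e by (auto simp: t_def)
    obtain x where x: "m < x" "x < t" "f t - f m = (t - m) * f1 x"
      using MVT_within[of f f1 m t, OF d] m t by auto
    have "0 \<le> (t - m) * f1 x" using min[of t] t m x(3) by auto
    then have "0 \<le> f1 x" using t by (simp add: zero_le_mult_iff)
    then have "0 \<le> pw x * f1 x" using x m t by (intro mult_nonneg_nonneg pw_nonneg) auto
    moreover obtain y where y: "m < y" "y < x"
        "pw x * f1 x - pw m * f1 m = (x - m) * (\<mu> * wt y * (f y - h y))"
      using MVT_within[of "\<lambda>s. pw s * f1 s" _ m x, OF dG] m t x by auto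
    moreover have "f y < h y"
      using near[of y] h[of y] y x t m e by auto
    then have "(x - m) * (\<mu> * wt y * (f y - h y)) < 0"
      using mu wt_pos[of y] y x m t by (intro mult_pos_neg) auto
    ultimately show False using Gm by auto
  next
    case False
    then have m1: "m = 1" using m by auto
    define t where "t = max 0 (1 - e/2)"
    have t: "0 \<le> t" "t < 1" "1 - e/2 \<le> t" using e by (auto simp: t_def)
    obtain x where x: "t < x" "x < 1" "f 1 - f t = (1 - t) * f1 x"
      using MVT_within[of f f1 t 1, OF d] t by auto
    have "(1 - t) * f1 x \<le> 0" using min[of t] t m1 x(3) by auto
    then have "f1 x \<le> 0" using t by (simp add: mult_le_0_iff)
    then have "pw x * f1 x \<le> 0" using x t by (intro mult_nonneg_nonpos pw_nonneg) auto
    moreover obtain y where y: "x < y" "y < 1"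
        "pw 1 * f1 1 - pw x * f1 x = (1 - x) * (\<mu> * wt y * (f y - h y))"
      using MVT_within[of "\<lambda>s. pw s * f1 s" _ x 1, OF dG] t x by auto
    moreover have "f y < h y"
      using near[of y] h[of y] y x t m1 e by auto
    then have "(1 - x) * (\<mu> * wt y * (f y - h y)) < 0"
      using mu wt_pos[of y] y x t by (intro mult_pos_neg) auto
    ultimately show False using Gm m1 by auto
  qed
qed

lemma solves_abs_le:
  assumes "solves h f f1" and "\<And>s. s \<in> {0..1} \<Longrightarrow> \<bar>h s\<bar> \<le> R" and s: "s \<in> {0..1}"
  shows "\<bar>f s\<bar> \<le> R"
proof -
  have "- R \<le> f s"
    using assms by (intro solves_ge[OF assms(1)]) (auto simp: abs_le_iff minus_le_iff)
  moreover have "- R \<le> (-1) * f s + 0 * f s"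
    using assms(2) by (intro solves_ge[OF solves_combine[OF assms(1,1), of "-1" 0] _ s])
       (auto simp: abs_le_iff)
  ultimately show ?thesis by auto
qed

lemma solves_deriv_le:
  assumes "solves h f f1" and R: "\<And>s. s \<in> {0..1} \<Longrightarrow> \<bar>h s\<bar> \<le> R" and s: "s \<in> {0..1}"
  shows "\<bar>f1 s\<bar> \<le> 2^(\<kappa>+3) * (\<mu> * (2 * R))"
proof -
  have "\<bar>f1 s\<bar> \<le> 2^(2 + (\<kappa>+1)) * (\<mu> * (2 * R))"
  proof (rule flux_bound[of 2 "\<kappa>+1" f1 "\<lambda>s. \<mu> * (f s - h s)" "\<mu> * (2 * R)" s])
    show "((\<lambda>s. s\<^sup>2 * (1-s)^(\<kappa>+1) * f1 s) has_real_derivative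
        s^(2-1) * (1-s)^(\<kappa>+1-1) * (\<mu> * (f s - h s))) (at s within {0..1})"
      if "s \<in> {0..1}" for s :: real
      using solvesD(3)[OF assms(1) that] by (simp add: pw_def wt_def mult_ac)
    fix s :: real assume s: "s \<in> {0..1}"
    have "\<bar>f s - h s\<bar> \<le> 2 * R"
      using solves_abs_le[OF assms(1) R s] R[OF s] by linarith
    then show "\<bar>\<mu> * (f s - h s)\<bar> \<le> \<mu> * (2 * R)" using mu by (simp add: abs_mult)
  qed (use solvesD(2)[OF assms(1)] s in auto)
  then show ?thesis by (simp add: numeral_eq_Suc)
qed

lemma solves_unique:
  assumes "solves h f f1" "solves h g g1" "s \<in> {0..1}"
  shows "f s = g s" "f1 s = g1 s"
proof -
  have sol: "solves (\<lambda>s. 1 * h s + (-1) * h s) (\<lambda>s. 1 * f s + (-1) * g s) (\<lambda>s. 1 * f1 s + (-1) * g1 s)"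
    by (rule solves_combine[OF assms(1,2)])
  show "f s = g s" using solves_abs_le[OF sol, of 0 s] assms by simp
  show "f1 s = g1 s" using solves_deriv_le[OF sol, of 0 s] assms by simp
qed

text \<open>
  By \<open>solves_abs_le\<close> and \<open>solves_deriv_le\<close>, applied to differences, the solution depends Lipschitz
  continuously on the data, together with its derivative.
\<close>
lemma solves_uniform_limit:
  assumes sol: "\<And>n. solves (h n) (f n) (f1 n)" and lim: "uniform_limit {0..1} h H sequentially"
    and cH: "continuous_on {0..1} H"
  obtains F F1 where "solves H F F1" "uniform_limit {0..1} f F sequentially"
    "uniform_limit {0..1} f1 F1 sequentially"
proof -
  have diff: "solves (\<lambda>s. 1 * h m s + (-1) * h n s) (\<lambda>s. 1 * f m s + (-1) * f n s) (\<lambda>s. 1 * f1 m s + (-1) * f1 n s)"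
    for m n by (rule solves_combine[OF sol sol])
  have "\<exists>F. uniform_limit {0..1} f F sequentially"
  proof (rule uniform_Cauchy_limit[OF lim, of 1])
    show "\<bar>f m s - f n s\<bar> \<le> 1 * R" if "\<And>s. s \<in> {0..1} \<Longrightarrow> \<bar>h m s - h n s\<bar> \<le> R" "s \<in> {0..1}" for m n s R
      using solves_abs_le[OF diff[of m n], of R s] that by simp
  qed simp
  then obtain F where F: "uniform_limit {0..1} f F sequentially" ..
  have "\<exists>F. uniform_limit {0..1} f1 F sequentially"
  proof (rule uniform_Cauchy_limit[OF lim, of "2^(\<kappa>+3) * \<mu> * 2"])
    show "\<bar>f1 m s - f1 n s\<bar> \<le> 2^(\<kappa>+3) * \<mu> * 2 * R" if "\<And>s. s \<in> {0..1} \<Longrightarrow> \<bar>h m s - h n s\<bar> \<le> R" "s \<in> {0..1}" for m n s R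
      using solves_deriv_le[OF diff[of m n], of R s] that by (simp add: mult_ac)
  qed (use mu in simp)
  then obtain F1 where F1: "uniform_limit {0..1} f1 F1 sequentially" ..
  have cF1: "continuous_on {0..1} F1"
    by (rule uniform_limit_theorem[OF _ F1]) (use solvesD(2)[OF sol] in auto)
  have cF: "continuous_on {0..1} F"
    by (rule uniform_limit_theorem[OF _ F]) (use solvesD(4)[OF sol] in auto)
  have "solves H F F1"
    unfolding solves_def
  proof (intro conjI ballI cF1)
    fix s :: real assume s: "s \<in> {0..1}"
    show "(F has_real_derivative F1 s) (at s within {0..1})"
      by (rule deriv_uniform_limit[OF solvesD(1)[OF sol] F F1 s])
    have "uniform_limit {0..1} (\<lambda>n s. \<mu> * wt s * (f n s - h n s)) (\<lambda>s. \<mu> * wt s * (F s - H s)) sequentially"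
      by (intro uniform_limit_mult_continuous uniform_limit_minus F lim continuous_intros cF cH)
    moreover have "uniform_limit {0..1} (\<lambda>n s. pw s * f1 n s) (\<lambda>s. pw s * F1 s) sequentially"
      by (rule uniform_limit_mult_continuous[OF cont_pw F1 cF1])
    ultimately show "((\<lambda>s. pw s * F1 s) has_real_derivative \<mu> * wt s * (F s - H s)) (at s within {0..1})"
      by (intro deriv_uniform_limit[where f = "\<lambda>n s. pw s * f1 n s", OF solvesD(3)[OF sol] _ _ s])
  qed
  with F F1 that show ?thesis by blast
qed

end

section \<open>Solvability of the linear equation\<close>

lemma poly_dense:
  fixes h :: "real \<Rightarrow> real"
  assumes "continuous_on {0..1} h"
  obtains p :: "nat \<Rightarrow> real poly" where "uniform_limit {0..1} (\<lambda>n. poly (p n)) h sequentially"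
proof -
  have "\<exists>p. \<forall>s\<in>{0..1}. \<bar>h s - poly p s\<bar> < inverse (real (Suc n))" for n
  proof -
    obtain g where g: "real_polynomial_function g" "\<And>x. x \<in> {0..1} \<Longrightarrow> \<bar>h x - g x\<bar> < inverse (real (Suc n))"
      using Stone_Weierstrass_real_polynomial_function[OF compact_Icc assms, of "inverse (real (Suc n))"] by auto
    then obtain a N where "g = (\<lambda>x. \<Sum>i\<le>N. a i * x ^ i)"
      by (auto simp: real_polynomial_function_iff_sum)
    then have "g = poly (\<Sum>i\<le>N. monom (a i) i)" by (auto simp: poly_sum poly_monom)
    with g show ?thesis by metis
  qed
  then obtain p where p: "\<And>n s. s \<in> {0..1} \<Longrightarrow> \<bar>h s - poly (p n) s\<bar> < inverse (real (Suc n))"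
    by metis
  have "uniform_limit {0..1} (\<lambda>n. poly (p n)) h sequentially"
  proof (rule uniform_limitI)
    fix e :: real assume "0 < e"
    then have "\<forall>\<^sub>F n in sequentially. inverse (real (Suc n)) < e"
      using LIMSEQ_inverse_real_of_nat order_tendstoD(2) by blast
    then show "\<forall>\<^sub>F n in sequentially. \<forall>s\<in>{0..1}. dist (poly (p n) s) (h s) < e"
    proof (eventually_elim, intro ballI)
      fix n and s :: real assume "inverse (real (Suc n)) < e" "s \<in> {0..1}"
      then show "dist (poly (p n) s) (h s) < e" using p[of s n] by (simp add: dist_real_def abs_minus_commute)
    qed
  qed
  then show ?thesis by (rule that)
qed

lemma pderiv_sum: "pderiv (sum f A) = (\<Sum>x\<in>A. pderiv (f x))"
  by (induction A rule: infinite_finite_induct) (simp_all add: pderiv_add)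

lemma poly_antiderivative:
  fixes p :: "real poly"
  obtains q where "pderiv q = p" "poly q 0 = c"
proof -
  define q where "q = [:c:] + (\<Sum>i\<le>degree p. monom (coeff p i / real (Suc i)) (Suc i))"
  have "pderiv q = (\<Sum>i\<le>degree p. monom (coeff p i) i)"
    unfolding q_def by (simp add: pderiv_add pderiv_pCons pderiv_monom pderiv_sum del: of_nat_Suc)
  then have "pderiv q = p" by (simp add: poly_as_sum_of_monoms)
  moreover have "poly q 0 = c" by (simp add: q_def poly_sum poly_monom)
  ultimately show ?thesis by (rule that)
qed

context radial
begin

text \<open>
  The hypergeometric operator whose polynomial eigenfunctions are Jacobi polynomials.
\<close>
definition jacobi_op :: "real poly \<Rightarrow> real poly" where
  "jacobi_op p = [:0, 1, -1:] * pderiv (pderiv p) + [:2, - (real \<kappa> + 3):] * pderiv p"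

lemma coeff_jacobi_op:
  "coeff (jacobi_op p) i =
     (real i + 1) * (real i + 2) * coeff p (Suc i) - real i * (real i + real \<kappa> + 2) * coeff p i"
proof (cases i)
  case 0
  then show ?thesis by (simp add: jacobi_op_def coeff_pderiv)
next
  case (Suc j)
  then show ?thesis
    by (cases j) (simp_all add: jacobi_op_def coeff_pderiv coeff_pCons algebra_simps)
qed

text \<open>
  The operator \<open>jacobi_op\<close> is triangular in the monomial basis with nonpositive diagonal entries, so
  \<open>\<mu> - jacobi_op\<close> is invertible on the polynomials of each degree; the induction removes the leading
  coefficient.
\<close>
lemma poly_resolvent:
  "\<exists>p. smult \<mu> p - jacobi_op p = smult \<mu> h"
proof -
  have "\<exists>p. smult \<mu> p - jacobi_op p = h" if "\<And>i. i \<ge> n \<Longrightarrow> coeff h i = 0" for h n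
    using that
  proof (induction n arbitrary: h)
    case 0
    then have "h = 0" by (intro poly_eqI) simp
    then show ?case by (intro exI[of _ 0]) (simp add: jacobi_op_def)
  next
    case (Suc n)
    define d where "d = \<mu> + real n * (real n + real \<kappa> + 2)"
    have d: "d > 0" using mu by (simp add: d_def add_pos_nonneg)
    define c where "c = coeff h n / d"
    define m where "m = monom c n"
    have "coeff (h - (smult \<mu> m - jacobi_op m)) i = 0" if "i \<ge> n" for i
    proof (cases "i = n")
      case True
      have "coeff (smult \<mu> m - jacobi_op m) n = d * c"
        by (simp add: coeff_jacobi_op m_def d_def algebra_simps)
      then show ?thesis using True d by (simp add: c_def)
    next
      case False
      then show ?thesis using that Suc.prems[of i] by (simp add: coeff_jacobi_op m_def)
    qed
    then obtain p where "smult \<mu> p - jacobi_op p = h - (smult \<mu> m - jacobi_op m)"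
      using Suc.IH by blast
    then have "smult \<mu> (p + m) - jacobi_op (p + m) = h"
      by (simp add: jacobi_op_def pderiv_add algebra_simps smult_add_right)
    then show ?case by blast
  qed
  from this[of "Suc (degree (smult \<mu> h))"] show ?thesis
    by (metis Suc_le_eq coeff_eq_0)
qed

lemma poly_jacobi_op:
  "poly (jacobi_op p) s = s * (1-s) * poly (pderiv (pderiv p)) s + (2 - (real \<kappa> + 3) * s) * poly (pderiv p) s"
  by (simp add: jacobi_op_def algebra_simps)

lemma flux_deriv:
  fixes f1 :: "real \<Rightarrow> real"
  assumes "(f1 has_real_derivative f2) (at s within S)"
  shows "((\<lambda>s. s^(Suc a) * (1-s)^(Suc b) * f1 s) has_real_derivative
     s^a * (1-s)^b * (s * (1-s) * f2 + (real (Suc a) - real (Suc a + Suc b) * s) * f1 s)) (at s within S)"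
  by (rule derivative_eq_intros assms refl | simp)+ (simp add: algebra_simps)

lemma solves_poly:
  assumes "smult \<mu> p - jacobi_op p = smult \<mu> h"
  shows "solves (poly h) (poly p) (poly (pderiv p))"
  unfolding solves_def
proof (intro conjI ballI)
  fix s :: real
  show "(poly p has_real_derivative poly (pderiv p) s) (at s within {0..1})"
    using poly_DERIV has_field_derivative_at_within by blast
  have "jacobi_op p = smult \<mu> (p - h)" using assms by (simp add: smult_diff_right algebra_simps)
  then have *: "poly (jacobi_op p) s = \<mu> * (poly p s - poly h s)" by simp
  have "(poly (pderiv p) has_real_derivative poly (pderiv (pderiv p)) s) (at s within {0..1})"
    using poly_DERIV has_field_derivative_at_within by blast
  from flux_deriv[OF this, of 1 \<kappa>]
  have "((\<lambda>s. pw s * poly (pderiv p) s) has_real_derivative wt s * poly (jacobi_op p) s) (at s within {0..1})"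
    by (simp add: pw_def wt_def poly_jacobi_op power2_eq_square add.commute)
  then show "((\<lambda>s. pw s * poly (pderiv p) s) has_real_derivative \<mu> * wt s * (poly p s - poly h s)) (at s within {0..1})"
    unfolding * by (simp add: mult_ac)
qed (intro continuous_intros)

text \<open>
  Polynomial data are dense, and the solution operator is continuous.
\<close>
lemma solves_exists:
  assumes "continuous_on {0..1} h"
  obtains f f1 where "solves h f f1"
proof -
  obtain p where p: "uniform_limit {0..1} (\<lambda>n. poly (p n)) h sequentially"
    using poly_dense[OF assms] .
  have "\<forall>n. \<exists>q. smult \<mu> q - jacobi_op q = smult \<mu> (p n)"
    using poly_resolvent by blast
  then obtain q where q: "\<And>n. smult \<mu> (q n) - jacobi_op (q n) = smult \<mu> (p n)"
    by metis
  show ?thesis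
    using solves_uniform_limit[OF solves_poly[OF q] p assms] that by blast
qed

text \<open>
  The derivative of a polynomial solution satisfies an equation of the same type with exponents raised by
  one, so \<open>flux_bound\<close> controls second derivatives by the first derivative of the data. Data that
  converge together with their derivatives thus give solutions that converge in \<open>C\<^sup>2\<close> up to the singular
  ends.
\<close>
lemma solves_C2:
  assumes sol: "solves h f f1"
    and h: "\<And>s. s \<in> {0..1} \<Longrightarrow> (h has_real_derivative h1 s) (at s within {0..1})"
    and ch1: "continuous_on {0..1} h1"
  obtains f2 where "continuous_on {0..1} f2"
    "\<And>s. s \<in> {0..1} \<Longrightarrow> (f1 has_real_derivative f2 s) (at s within {0..1})"
    "\<And>s. s \<in> {0..1} \<Longrightarrow> s * (1-s) * f2 s + (2 - (real \<kappa> + 3) * s) * f1 s = \<mu> * (f s - h s)"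
proof -
  obtain g where g: "uniform_limit {0..1} (\<lambda>n. poly (g n)) h1 sequentially"
    using poly_dense[OF ch1] .
  have "\<exists>q. pderiv q = g n \<and> poly q 0 = h 0" for n
    using poly_antiderivative[of "g n" "h 0"] by blast
  then obtain p where p: "\<And>n. pderiv (p n) = g n" "\<And>n. poly (p n) 0 = h 0"
    by metis
  have dp: "(poly q has_real_derivative poly (pderiv q) s) (at s within {0..1})" for q :: "real poly" and s
    using poly_DERIV has_field_derivative_at_within by blast
  have limp: "uniform_limit {0..1} (\<lambda>n. poly (p n)) h sequentially"
  proof (rule uniform_limitI)
    fix e :: real assume "0 < e"
    then have "\<forall>\<^sub>F n in sequentially. \<forall>s\<in>{0..1}. dist (poly (g n) s) (h1 s) < e/2"
      by (intro uniform_limitD[OF g]) auto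
    then show "\<forall>\<^sub>F n in sequentially. \<forall>s\<in>{0..1}. dist (poly (p n) s) (h s) < e"
    proof (eventually_elim, intro ballI)
      fix n and s :: real assume *: "\<forall>s\<in>{0..1}. dist (poly (g n) s) (h1 s) < e/2" and s: "s \<in> {0..1}"
      have "norm ((poly (p n) s - h s) - (poly (p n) 0 - h 0)) \<le> e/2 * norm (s - 0)"
      proof (rule field_differentiable_bound[where S = "{0..1}" and f' = "\<lambda>s. poly (g n) s - h1 s"])
        show "((\<lambda>s. poly (p n) s - h s) has_field_derivative poly (g n) s - h1 s) (at s within {0..1})"
          if "s \<in> {0..1}" for s
          using dp[of "p n" s] h[OF that] p(1) by (auto intro: DERIV_diff)
        show "norm (poly (g n) s - h1 s) \<le> e/2" if "s \<in> {0..1}" for s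
          using * that by (force simp: dist_real_def)
      qed (use s in auto)
      also have "\<dots> \<le> e/2 * 1" using s \<open>0 < e\<close> by (intro mult_left_mono) auto
      finally show "dist (poly (p n) s) (h s) < e" using p(2) \<open>0 < e\<close> by (simp add: dist_real_def)
    qed
  qed
  have "\<forall>n. \<exists>q. smult \<mu> q - jacobi_op q = smult \<mu> (p n)"
    using poly_resolvent by blast
  then obtain q where q: "\<And>n. smult \<mu> (q n) - jacobi_op (q n) = smult \<mu> (p n)"
    by metis
  note solq = solves_poly[OF q]
  obtain F F1 where F: "solves h F F1" "uniform_limit {0..1} (\<lambda>n. poly (q n)) F sequentially"
    "uniform_limit {0..1} (\<lambda>n. poly (pderiv (q n))) F1 sequentially"
    using solves_uniform_limit[OF solq limp deriv_within_cont[OF h]] .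
  have jq: "jacobi_op (q n) = smult \<mu> (q n - p n)" for n
    using q[of n] by (simp add: smult_diff_right algebra_simps)
  define f2 where "f2 n = poly (pderiv (pderiv (q n)))" for n
  have "uniform_limit {0..1} (\<lambda>n s. \<mu> * (poly (pderiv (q n)) s - poly (g n) s) + (real \<kappa> + 3) * poly (pderiv (q n)) s)
      (\<lambda>s. \<mu> * (F1 s - h1 s) + (real \<kappa> + 3) * F1 s) sequentially" (is "uniform_limit _ ?r ?R _")
    by (intro uniform_limit_add uniform_limit_minus bounded_linear.uniform_limit[OF bounded_linear_mult_right] F g) 
  then have "\<exists>F2. uniform_limit {0..1} f2 F2 sequentially"
  proof (rule uniform_Cauchy_limit[of _ _ _ "2^(3 + (\<kappa>+2))"])
    fix m n R and s :: real assume R: "\<And>s. s \<in> {0..1} \<Longrightarrow> \<bar>?r m s - ?r n s\<bar> \<le> R" and s: "s \<in> {0..1}"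
    have r: "s * (1-s) * poly (pderiv (pderiv (pderiv (q n)))) s + (3 - (real \<kappa> + 5) * s) * f2 n s = ?r n s" for n s
    proof -
      have "poly (pderiv (jacobi_op (q n))) s = poly (pderiv (smult \<mu> (q n - p n))) s"
        by (simp add: jq)
      then show ?thesis
        by (simp add: f2_def jacobi_op_def pderiv_mult pderiv_add pderiv_pCons pderiv_diff pderiv_smult pderiv_minus p(1) algebra_simps)
    qed
    show "\<bar>f2 m s - f2 n s\<bar> \<le> 2^(3 + (\<kappa>+2)) * R"
    proof (rule flux_bound[of 3 "\<kappa>+2" "\<lambda>s. f2 m s - f2 n s" "\<lambda>s. ?r m s - ?r n s" R s])
      show "((\<lambda>s. s^3 * (1-s)^(\<kappa>+2) * (f2 m s - f2 n s)) has_real_derivative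
          s^(3-1) * (1-s)^(\<kappa>+2-1) * (?r m s - ?r n s)) (at s within {0..1})" for s :: real
      proof -
        have "((\<lambda>s. f2 m s - f2 n s) has_real_derivative
          poly (pderiv (pderiv (pderiv (q m)))) s - poly (pderiv (pderiv (pderiv (q n)))) s) (at s within {0..1})"
          unfolding f2_def by (intro DERIV_diff dp)
        from flux_deriv[OF this, of 2 "\<kappa>+1"] show ?thesis
          unfolding r[symmetric] by (simp add: numeral_eq_Suc algebra_simps)
      qed
    qed (use R s in \<open>auto simp: f2_def intro!: continuous_intros\<close>)
  qed simp
  then obtain F2 where F2: "uniform_limit {0..1} f2 F2 sequentially" ..
  have dF1: "(F1 has_real_derivative F2 s) (at s within {0..1})" if "s \<in> {0..1}" for s
    by (rule deriv_uniform_limit[OF _ F(3) F2 that]) (simp add: f2_def dp)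
  have cF2: "continuous_on {0..1} F2"
    by (rule uniform_limit_theorem[OF _ F2]) (auto simp: f2_def intro!: always_eventually continuous_intros)
  have eqn: "s * (1-s) * F2 s + (2 - (real \<kappa> + 3) * s) * F1 s = \<mu> * (F s - h s)" if s: "s \<in> {0..1}" for s
  proof (rule LIMSEQ_unique)
    note l = tendsto_uniform_limitI[OF _ s]
    show "(\<lambda>n. s * (1-s) * f2 n s + (2 - (real \<kappa> + 3) * s) * poly (pderiv (q n)) s) \<longlonglongrightarrow>
      s * (1-s) * F2 s + (2 - (real \<kappa> + 3) * s) * F1 s"
      by (intro tendsto_intros l F F2)
    have "s * (1-s) * f2 n s + (2 - (real \<kappa> + 3) * s) * poly (pderiv (q n)) s = \<mu> * (poly (q n) s - poly (p n) s)" for n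
      using poly_jacobi_op[of "q n" s] by (simp add: f2_def jq)
    then show "(\<lambda>n. s * (1-s) * f2 n s + (2 - (real \<kappa> + 3) * s) * poly (pderiv (q n)) s) \<longlonglongrightarrow> \<mu> * (F s - h s)"
      by (simp only:) (intro tendsto_intros l F limp)
  qed
  note u = solves_unique[OF sol F(1)]
  show ?thesis
  proof (rule that[of F2])
    show "(f1 has_real_derivative F2 s) (at s within {0..1})" if "s \<in> {0..1}" for s
      using has_field_derivative_transform_within[OF dF1[OF that] zero_less_one that] u by auto
  qed (use cF2 eqn u in auto)
qed

end

section \<open>Monotonicity, positivity and energy\<close>

lemma continuous_on_powr_const:
  fixes u :: "real \<Rightarrow> real"
  assumes "continuous_on S u" "\<And>s. s \<in> S \<Longrightarrow> 0 \<le> u s" "0 < r"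
  shows "continuous_on S (\<lambda>s. u s powr r)"
  using assms by (intro continuous_on_powr') (auto intro: continuous_intros)

lemma young_powr:
  fixes x y q :: real
  assumes "0 \<le> x" "0 \<le> y" "1 < q"
  shows "x powr q * y \<le> q / (q+1) * x powr (q+1) + 1 / (q+1) * y powr (q+1)"
proof (cases "x = 0 \<or> y = 0")
  case True
  then show ?thesis using assms by auto
next
  case False
  then have pos: "x > 0" "y > 0" using assms by auto
  have "(x powr (q+1)) powr (q/(q+1)) * (y powr (q+1)) powr (1/(q+1))
      \<le> q/(q+1) * x powr (q+1) + 1/(q+1) * y powr (q+1)"
    using assms pos by (intro Youngs_inequality_0) (auto simp: add_divide_distrib[symmetric])
  then show ?thesis using assms pos by (simp add: powr_powr)
qed

context radial
begin

text \<open>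
  If the flux were positive somewhere, it would have a positive maximum at an interior point \<open>m\<close>, where
  \<open>f m = h m\<close>. To the right of \<open>m\<close> the function \<open>f\<close> increases and \<open>h\<close> does not, so the derivative of the
  flux is positive there, which contradicts the maximality.
\<close>
lemma solves_decreasing:
  assumes sol: "solves h f f1" and h: "\<And>s t. 0 \<le> s \<Longrightarrow> s \<le> t \<Longrightarrow> t \<le> 1 \<Longrightarrow> h t \<le> h s"
    and st: "0 \<le> s" "s \<le> t" "t \<le> 1"
  shows "f t \<le> f s"
proof -
  note d = solvesD(1)[OF sol] and dG = solvesD(3)[OF sol] and cf1 = solvesD(2)[OF sol]
  define G where "G = (\<lambda>s. pw s * f1 s)"
  have cG: "continuous_on {0..1} G"
    using cf1 unfolding G_def by (intro continuous_intros)
  have G: "G x \<le> 0" if "x \<in> {0..1}" for x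
  proof (rule ccontr)
    assume neg: "\<not> G x \<le> 0"
    obtain m where m: "m \<in> {0..1}" and max: "\<And>t. t \<in> {0..1} \<Longrightarrow> G t \<le> G m"
      using continuous_attains_sup[OF _ _ cG] by auto
    have Gm: "G m > 0" using max[OF that] neg by simp
    then have m01: "0 < m" "m < 1" using m pw_ends unfolding G_def
      by (metis atLeastAtMost_iff less_eq_real_def mult_zero_left not_less_iff_gr_or_eq)+
    have "(G has_real_derivative \<mu> * wt m * (f m - h m)) (at m)"
      using dG[OF m] at_within_Icc_at[OF m01] by (simp add: G_def)
    moreover have "\<forall>y. \<bar>m - y\<bar> < min m (1-m) \<longrightarrow> G y \<le> G m"
      by (intro allI impI max) auto
    ultimately have "\<mu> * wt m * (f m - h m) = 0"
      using m01 DERIV_local_max[of G "\<mu> * wt m * (f m - h m)" m "min m (1-m)"] by auto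
    then have fm: "f m = h m" using mu wt_pos[OF m01] by auto
    have "f1 m > 0" using Gm pw_pos[OF m01] unfolding G_def by (simp add: zero_less_mult_iff)
    then obtain e where e: "e > 0" and near: "\<And>t. t \<in> {0..1} \<Longrightarrow> \<bar>t - m\<bar> < e \<Longrightarrow> - f1 t < 0"
      using continuous_less_nearby[OF continuous_on_minus[OF cf1] m, of 0] by auto
    define t where "t = min 1 (m + e/2)"
    have t: "m < t" "t \<le> 1" "t \<le> m + e/2" using m01 e by (auto simp: t_def)
    obtain y where y: "m < y" "y < t" "G t - G m = (t - m) * (\<mu> * wt y * (f y - h y))"
      using MVT_within[of G "\<lambda>y. \<mu> * wt y * (f y - h y)" m t] dG m t unfolding G_def by auto
    obtain z where z: "m < z" "z < y" "f y - f m = (y - m) * f1 z"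
      using MVT_within[of f f1 m y, OF d] m t y by auto
    have "f1 z > 0" using near[of z] z y t m e by auto
    then have "(y - m) * f1 z > 0" using y by simp
    then have "f m < f y" using z(3) by linarith
    moreover have "h y \<le> h m" using y t m by (intro h) auto
    ultimately have "0 < (t - m) * (\<mu> * wt y * (f y - h y))"
      using mu wt_pos[of y] y t m fm by (intro mult_pos_pos) auto
    then show False using y(3) max[of t] t m by auto
  qed
  have "- f s \<le> - f t"
  proof (rule increasing_of_deriv_within[where g = "\<lambda>s. - f s" and g' = "\<lambda>s. - f1 s"])
    show "((\<lambda>s. - f s) has_real_derivative - f1 x) (at x within {0..1})" if "s < x" "x < t" for x
      using d[of x] that st by (auto intro: DERIV_minus)
    show "0 \<le> - f1 x" if "s < x" "x < t" for x
      using G[of x] pw_pos[of x] that st by (auto simp: G_def mult_le_0_iff)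
    show "continuous_on {s..t} (\<lambda>s. - f s)"
      using continuous_on_subset[OF solvesD(4)[OF sol], of "{s..t}"] st by (auto intro: continuous_intros)
  qed (use st in auto)
  then show ?thesis by simp
qed

text \<open>
  Strong maximum principle at the end where a decreasing solution is smallest. The flux inequality bounds
  \<open>- f1\<close> by a multiple of \<open>f\<close> on \<open>[\<delta>, 1]\<close>, and Gronwall's inequality propagates the zero from \<open>1\<close> to \<open>\<delta>\<close>.
\<close>
lemma solves_zero_at_1:
  assumes sol: "solves h f f1" and h: "\<And>s. s \<in> {0..1} \<Longrightarrow> 0 \<le> h s"
    and dec: "\<And>s t. 0 \<le> s \<Longrightarrow> s \<le> t \<Longrightarrow> t \<le> 1 \<Longrightarrow> f t \<le> f s"
    and f1: "f 1 = 0" and s: "s \<in> {0..1}"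
  shows "f s = 0"
proof -
  note d = solvesD(1)[OF sol] and dG = solvesD(3)[OF sol] and cf = solvesD(4)[OF sol]
  have f0: "0 \<le> f s" if "s \<in> {0..1}" for s using solves_ge[OF sol h that] .
  have slope: "- (\<mu> / s\<^sup>2) * f s \<le> f1 s" if s: "0 < s" "s < 1" for s
  proof -
    obtain x where x: "s < x" "x < 1" "pw 1 * f1 1 - pw s * f1 s = (1 - s) * (\<mu> * wt x * (f x - h x))"
      using MVT_within[of "\<lambda>s. pw s * f1 s" _ s 1, OF dG] s by auto
    have "x * (1-x)^\<kappa> * (f x - h x) \<le> 1 * (1-s)^\<kappa> * f s"
      using h[of x] f0[of x] dec[of s x] x s
      by (intro order_trans[OF mult_left_mono[of "f x - h x" "f x"] mult_mono] mult_mono power_mono) auto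
    then have "(1-s) * (\<mu> * (wt x * (f x - h x))) \<le> (1-s) * (\<mu> * ((1-s)^\<kappa> * f s))"
      using s mu by (intro mult_left_mono) (auto simp: wt_def)
    then have "(1-s)^(\<kappa>+1) * (- (\<mu> * f s)) \<le> (1-s)^(\<kappa>+1) * (s\<^sup>2 * f1 s)"
      using x(3) by (simp add: pw_def mult_ac)
    then have "- (\<mu> * f s) \<le> s\<^sup>2 * f1 s" using s by (subst (asm) mult_le_cancel_left_pos) auto
    then show ?thesis using s by (simp add: field_simps)
  qed
  have pos: "f s = 0" if s: "0 < s" "s \<le> 1" for s
  proof -
    define k where "k = \<mu> / s\<^sup>2"
    have "f s * exp (k * s) \<le> f 1 * exp (k * 1)"
    proof (rule increasing_of_deriv_within[where g = "\<lambda>t. f t * exp (k * t)"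
          and g' = "\<lambda>t. f1 t * exp (k * t) + k * exp (k * t) * f t"])
      show "((\<lambda>t. f t * exp (k * t)) has_real_derivative f1 t * exp (k * t) + k * exp (k * t) * f t) (at t within {0..1})"
        if "s < t" "t < 1" for t
      proof -
        have t: "t \<in> {0..1}" using that s by auto
        have "((\<lambda>t. exp (k * t)) has_real_derivative k * exp (k * t)) (at t within {0..1})"
          by (rule derivative_eq_intros refl | simp)+
        from DERIV_mult[OF d[OF t] this] show ?thesis by (simp add: add.commute mult_ac)
      qed
      fix t assume t: "s < t" "t < 1"
      have "\<mu> / t\<^sup>2 \<le> k" using t s mu unfolding k_def by (intro divide_left_mono) (auto intro: power_mono)
      then have "\<mu> / t\<^sup>2 * f t \<le> k * f t" using f0[of t] t s by (intro mult_right_mono) auto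
      then have "0 \<le> f1 t + k * f t" using slope[of t] t s by simp
      then have "0 \<le> exp (k * t) * (f1 t + k * f t)" by (intro mult_nonneg_nonneg) auto
      then show "0 \<le> f1 t * exp (k * t) + k * exp (k * t) * f t" by (simp add: algebra_simps)
    next
      show "continuous_on {s..1} (\<lambda>t. f t * exp (k * t))"
        using continuous_on_subset[OF cf, of "{s..1}"] s by (auto intro!: continuous_intros)
    qed (use s in auto)
    then have "f s \<le> 0" using f1 by (simp add: mult_le_0_iff)
    then show ?thesis using f0[of s] s by auto
  qed
  have "norm (f s) \<le> 0"
    by (rule continuous_on_closure_norm_le[of "{0<..<1}" f]) (use cf s pos in auto)
  then show ?thesis by simp
qed

text \<open>
  The energy scalar product. A derivative is passed along with each function because the functions matter
  only on \<open>[0, 1]\<close>.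
\<close>
definition form where
  "form f f1 g g1 = integral {0..1} (\<lambda>s. pw s * f1 s * g1 s + \<mu> * wt s * f s * g s)" for f f1 g g1 :: "real \<Rightarrow> real"

definition is_C1 :: "(real \<Rightarrow> real) \<Rightarrow> (real \<Rightarrow> real) \<Rightarrow> bool" where
  "is_C1 f f1 \<longleftrightarrow> (\<forall>s\<in>{0..1}. (f has_real_derivative f1 s) (at s within {0..1})) \<and> continuous_on {0..1} f1"

lemma is_C1_cont: "is_C1 f f1 \<Longrightarrow> continuous_on {0..1} f" "is_C1 f f1 \<Longrightarrow> continuous_on {0..1} f1"
  using deriv_within_cont[of f f1] by (auto simp: is_C1_def)

lemma solves_is_C1: "solves h f f1 \<Longrightarrow> is_C1 f f1"
  by (simp add: solves_def is_C1_def)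

text \<open>
  Integration by parts; the boundary terms vanish because \<open>pw\<close> vanishes at both ends.
\<close>
lemma weak_form:
  assumes sol: "solves h f f1" and g: "is_C1 g g1" and ch: "continuous_on {0..1} h"
  shows "form f f1 g g1 = \<mu> * integral {0..1} (\<lambda>s. wt s * h s * g s)"
proof -
  have c: "continuous_on {0..1} f" "continuous_on {0..1} f1" "continuous_on {0..1} g" "continuous_on {0..1} g1"
    using solvesD(2,4)[OF sol] is_C1_cont[OF g] by auto
  have "((\<lambda>s. \<mu> * wt s * (f s - h s) * g s + g1 s * (pw s * f1 s)) has_integral
      (pw 1 * f1 1) * g 1 - (pw 0 * f1 0) * g 0) {0..1}"
  proof (rule fundamental_theorem_of_calculus)
    show "((\<lambda>s. (pw s * f1 s) * g s) has_vector_derivative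
        \<mu> * wt s * (f s - h s) * g s + g1 s * (pw s * f1 s)) (at s within {0..1})"
      if s: "s \<in> {0..1}" for s
      unfolding has_real_derivative_iff_has_vector_derivative[symmetric]
      by (rule DERIV_mult solvesD(3)[OF sol s])+ (use g s in \<open>auto simp: is_C1_def\<close>)
  qed simp
  then have "integral {0..1} (\<lambda>s. \<mu> * wt s * (f s - h s) * g s + g1 s * (pw s * f1 s)) = 0"
    by (simp add: pw_ends integral_unique)
  also have "(\<lambda>s. \<mu> * wt s * (f s - h s) * g s + g1 s * (pw s * f1 s))
    = (\<lambda>s. (pw s * f1 s * g1 s + \<mu> * wt s * f s * g s) - \<mu> * (wt s * h s * g s))"
    by (auto simp: algebra_simps)
  finally show ?thesis
    unfolding form_def
    by (subst (asm) integral_diff) (use c ch in \<open>auto intro!: integrable_continuous_interval continuous_intros\<close>)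
qed

lemma form_sq_nonneg: "0 \<le> form f f1 f f1"
  unfolding form_def
proof (cases "(\<lambda>s. pw s * f1 s * f1 s + \<mu> * wt s * f s * f s) integrable_on {0..1}")
  case True
  have "0 \<le> pw s * (f1 s * f1 s) + \<mu> * (wt s * (f s * f s))" if "s \<in> {0..1}" for s
    using that mu by (intro add_nonneg_nonneg mult_nonneg_nonneg pw_nonneg wt_nonneg zero_le_square) auto
  then show "0 \<le> integral {0..1} (\<lambda>s. pw s * f1 s * f1 s + \<mu> * wt s * f s * f s)"
    by (intro integral_nonneg True) (simp add: mult.assoc)
qed (simp add: not_integrable_integral)

lemma form_diff:
  assumes "is_C1 f f1" "is_C1 g g1"
  shows "form (\<lambda>s. f s - g s) (\<lambda>s. f1 s - g1 s) (\<lambda>s. f s - g s) (\<lambda>s. f1 s - g1 s)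
     = form f f1 f f1 - 2 * form f f1 g g1 + form g g1 g g1"
proof -
  note c = is_C1_cont[OF assms(1)] is_C1_cont[OF assms(2)]
  have i: "(\<lambda>s. pw s * f1 s * f1 s + \<mu> * wt s * f s * f s) integrable_on {0..1}"
    "(\<lambda>s. pw s * f1 s * g1 s + \<mu> * wt s * f s * g s) integrable_on {0..1}"
    "(\<lambda>s. pw s * g1 s * g1 s + \<mu> * wt s * g s * g s) integrable_on {0..1}"
    using c by (auto intro!: integrable_continuous_interval continuous_intros)
  have "((\<lambda>s. (pw s * f1 s * f1 s + \<mu> * wt s * f s * f s)
     - 2 * (pw s * f1 s * g1 s + \<mu> * wt s * f s * g s) + (pw s * g1 s * g1 s + \<mu> * wt s * g s * g s))
     has_integral form f f1 f f1 - 2 * form f f1 g g1 + form g g1 g g1) {0..1}"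
    unfolding form_def
    by (intro has_integral_add has_integral_diff has_integral_mult_right integrable_integral i)
  moreover have "(\<lambda>s. (pw s * f1 s * f1 s + \<mu> * wt s * f s * f s)
     - 2 * (pw s * f1 s * g1 s + \<mu> * wt s * f s * g s) + (pw s * g1 s * g1 s + \<mu> * wt s * g s * g s))
     = (\<lambda>s. pw s * (f1 s - g1 s) * (f1 s - g1 s) + \<mu> * wt s * (f s - g s) * (f s - g s))"
    by (simp add: fun_eq_iff algebra_simps)
  ultimately show ?thesis by (simp add: form_def integral_unique)
qed

lemma wt_integral_zero:
  assumes "continuous_on {0..1} g" "\<And>s. s \<in> {0..1} \<Longrightarrow> 0 \<le> g s" "integral {0..1} (\<lambda>s. wt s * g s) = 0"
    "s \<in> {0..1}"
  shows "g s = 0"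
proof -
  have z: "wt s * g s = 0" if "s \<in> {0..1}" for s
    using integral_eq_0_iff[of 0 1 "\<lambda>s. wt s * g s"] assms(2,3) that
      continuous_on_mult[OF cont_wt assms(1)]
    by (simp add: wt_nonneg)
  have "norm (g s) \<le> 0"
  proof (rule continuous_on_closure_norm_le[of "{0<..<1}" g])
    show "\<forall>y\<in>{0<..<1}. norm (g y) \<le> 0"
    proof
      fix y :: real assume "y \<in> {0<..<1}"
      then show "norm (g y) \<le> 0" using z[of y] wt_pos[of y] by auto
    qed
  qed (use assms in auto)
  then show ?thesis by simp
qed

definition volume :: real where "volume = integral {0..1} wt"

lemma volume_pos: "volume > 0"
proof -
  have "volume \<ge> 0" unfolding volume_def
    by (intro integral_nonneg integrable_continuous_interval continuous_intros) (auto simp: wt_nonneg)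
  moreover have "volume \<noteq> 0"
    using wt_integral_zero[of "\<lambda>_. 1" 0] by (auto simp: volume_def)
  ultimately show ?thesis by simp
qed

end

section \<open>The nonlinear power iteration\<close>

text \<open>
  The second order coefficient of \<open>(1 + x)\<^sup>q\<^sup>+\<^sup>1\<close> at \<open>0\<close> is \<open>(q + 1) q / 2 > \<theta>\<close>.
\<close>
lemma powr_quadratic_lower_bound:
  fixes q \<theta> :: real
  assumes "1 < q" "2 * \<theta> < (q+1) * q"
  shows "\<exists>d. 0 < d \<and> d < 1 \<and> (\<forall>x. \<bar>x\<bar> < d \<longrightarrow> 1 + (q+1) * x + \<theta> * x\<^sup>2 \<le> (1+x) powr (q+1))"
proof -
  \<comment> \<open>k and its derivative k1 vanish at 0, and k1 has positive slope there\<close>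
  define k where "k = (\<lambda>x::real. (1+x) powr (q+1) - (1 + (q+1) * x + \<theta> * x\<^sup>2))"
  define k1 where "k1 = (\<lambda>x::real. (q+1) * (1+x) powr q - ((q+1) + \<theta> * (2 * x)))"
  have dk: "(k has_real_derivative k1 x) (at x)" if "\<bar>x\<bar> < 1" for x
    unfolding k_def k1_def using that by (auto intro!: derivative_eq_intros)
  have "(k1 has_real_derivative (q+1) * q - 2 * \<theta>) (at 0)"
    unfolding k1_def by (auto intro!: derivative_eq_intros)
  then obtain d1 d2 where d1: "d1 > 0" "\<And>h. 0 < h \<Longrightarrow> h < d1 \<Longrightarrow> k1 0 < k1 (0 + h)"
    and d2: "d2 > 0" "\<And>h. 0 < h \<Longrightarrow> h < d2 \<Longrightarrow> k1 (0 - h) < k1 0"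
    using DERIV_pos_inc_right[of k1 _ 0] DERIV_pos_inc_left[of k1 _ 0] assms
    by (metis diff_gt_0_iff_gt)
  have k10: "k1 0 = 0" and k0: "k 0 = 0" by (auto simp: k1_def k_def)
  define d where "d = min (1/2) (min d1 d2)"
  have d: "0 < d" "d < 1" "d \<le> d1" "d \<le> d2" using d1 d2 by (auto simp: d_def)
  have "0 \<le> k x" if x: "\<bar>x\<bar> < d" for x
  proof (cases "x \<ge> 0")
    case True
    have "k 0 \<le> k x"
    proof (rule DERIV_nonneg_imp_nondecreasing[OF True])
      fix t assume t: "0 \<le> t" "t \<le> x"
      have "0 \<le> k1 t" using d1(2)[of t] t x d k10 by (cases "t = 0") auto
      then show "\<exists>y. (k has_real_derivative y) (at t) \<and> 0 \<le> y" using dk[of t] t x d by auto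
    qed
    then show ?thesis using k0 by simp
  next
    case False
    have "k 0 \<le> k x"
    proof (rule DERIV_nonpos_imp_nonincreasing[of x 0 k])
      fix t assume t: "x \<le> t" "t \<le> 0"
      have "k1 t \<le> 0" using d2(2)[of "-t"] t x d k10 by (cases "t = 0") auto
      then show "\<exists>y. (k has_real_derivative y) (at t) \<and> y \<le> 0" using dk[of t] t x d by auto
    qed (use False in auto)
    then show ?thesis using k0 by simp
  qed
  with d show ?thesis by (intro exI[of _ d]) (auto simp: k_def)
qed

text \<open>
  \<open>\<kappa> + 3\<close> is the first positive eigenvalue of \<open>f \<mapsto> - (pw f')' / wt\<close>. The last assumption says that the
  linearisation at the constant solution 1 has a negative direction orthogonal to the constants, which
  makes \<open>unstable_start\<close> possible; \<open>q < 2\<close> is what \<open>power_step_bound\<close> needs for an integrable derivative.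
\<close>
locale lane_emden = radial +
  fixes q :: real
  assumes q1: "1 < q" and q2: "q < 2" and unstable: "real \<kappa> + 3 < \<mu> * (q - 1)"
begin

text \<open>
  The constraint set of the iteration; the constant function 1 has the same weighted integral.
\<close>
definition profile :: "(real \<Rightarrow> real) \<Rightarrow> (real \<Rightarrow> real) \<Rightarrow> bool" where
  "profile u u1 \<longleftrightarrow> is_C1 u u1 \<and> (\<forall>s\<in>{0..1}. 0 \<le> u s) \<and>
     (\<forall>s t. 0 \<le> s \<longrightarrow> s \<le> t \<longrightarrow> t \<le> 1 \<longrightarrow> u t \<le> u s) \<and>
     integral {0..1} (\<lambda>s. wt s * u s powr (q+1)) = volume"

abbreviation energy :: "(real \<Rightarrow> real) \<Rightarrow> (real \<Rightarrow> real) \<Rightarrow> real" where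
  "energy u u1 \<equiv> form u u1 u u1"

lemma profileD:
  assumes "profile u u1"
  shows "is_C1 u u1" "s \<in> {0..1} \<Longrightarrow> 0 \<le> u s"
    "0 \<le> s \<Longrightarrow> s \<le> t \<Longrightarrow> t \<le> 1 \<Longrightarrow> u t \<le> u s"
    "integral {0..1} (\<lambda>s. wt s * u s powr (q+1)) = volume"
    "continuous_on {0..1} u" "continuous_on {0..1} u1"
    "0 < r \<Longrightarrow> continuous_on {0..1} (\<lambda>s. u s powr r)"
  using assms is_C1_cont[of u u1] continuous_on_powr_const[of "{0..1}" u r] by (auto simp: profile_def)

lemma form_scale: "form (\<lambda>s. c * f s) (\<lambda>s. c * f1 s) (\<lambda>s. c * f s) (\<lambda>s. c * f1 s) = c\<^sup>2 * form f f1 f f1"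
proof -
  have "(\<lambda>s. pw s * (c * f1 s) * (c * f1 s) + \<mu> * wt s * (c * f s) * (c * f s))
    = (\<lambda>s. c\<^sup>2 * (pw s * f1 s * f1 s + \<mu> * wt s * f s * f s))"
    by (simp add: fun_eq_iff power2_eq_square algebra_simps)
  then show ?thesis by (simp add: form_def)
qed

lemma is_C1_scale: "is_C1 f f1 \<Longrightarrow> is_C1 (\<lambda>s. c * f s) (\<lambda>s. c * f1 s)"
  unfolding is_C1_def by (auto intro!: DERIV_cmult continuous_intros)

lemma normalize:
  assumes f: "is_C1 f f1" "\<And>s. s \<in> {0..1} \<Longrightarrow> 0 \<le> f s"
    "\<And>s t. 0 \<le> s \<Longrightarrow> s \<le> t \<Longrightarrow> t \<le> 1 \<Longrightarrow> f t \<le> f s"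
    and N: "N = integral {0..1} (\<lambda>s. wt s * f s powr (q+1))" "N > 0"
    and c: "c = (volume / N) powr (1 / (q+1))"
  shows "0 < c" "profile (\<lambda>s. c * f s) (\<lambda>s. c * f1 s)"
proof -
  show c0: "0 < c" using N volume_pos by (simp add: c)
  have cp: "c powr (q+1) = volume / N"
    using N volume_pos q1 by (simp add: c powr_powr)
  have "integral {0..1} (\<lambda>s. wt s * (c * f s) powr (q+1)) = integral {0..1} (\<lambda>s. c powr (q+1) * (wt s * f s powr (q+1)))"
    using f(2) c0 by (intro integral_cong) (auto simp: powr_mult)
  also have "\<dots> = volume" using N by (simp add: cp)
  finally show "profile (\<lambda>s. c * f s) (\<lambda>s. c * f1 s)"
    using f c0 is_C1_scale[OF f(1)] by (simp add: profile_def)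
qed

text \<open>
  Put \<open>v = c K(u\<^sup>q)\<close>. The weak equation tested with \<open>u\<close> gives \<open>form v u = c \<mu> volume\<close>, and tested with \<open>v\<close>
  and estimated by Young's inequality it gives \<open>form v v \<le> c \<mu> volume\<close>, because \<open>u\<close> and \<open>v\<close> have the same
  normalisation. Then \<open>form (v - u) (v - u) = form v v - 2 form v u + form u u \<le> form u u - form v v\<close>. Since the
  left hand side is nonnegative, \<open>form v u \<le> form u u\<close> as well.
\<close>
lemma power_step:
  assumes u: "profile u u1"
  obtains c v v1 where "0 < c" "solves (\<lambda>s. c * u s powr q) v v1" "profile v v1"
    "c * \<mu> * volume \<le> energy u u1"
    "energy (\<lambda>s. v s - u s) (\<lambda>s. v1 s - u1 s) \<le> energy u u1 - energy v v1"
proof -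
  note uD = profileD[OF u]
  define h where "h = (\<lambda>s. u s powr q)"
  have ch: "continuous_on {0..1} h" unfolding h_def using uD(7)[of q] q1 by simp
  obtain f f1 where f: "solves h f f1" using solves_exists[OF ch] .
  note cf = solvesD(4)[OF f] and C1f = solves_is_C1[OF f]
  have f0: "0 \<le> f s" if "s \<in> {0..1}" for s
    by (rule solves_ge[OF f _ that]) (simp add: h_def)
  have fdec: "f t \<le> f s" if "0 \<le> s" "s \<le> t" "t \<le> 1" for s t
    by (rule solves_decreasing[OF f _ that]) (use uD(2,3) q1 in \<open>auto simp: h_def intro!: powr_mono2\<close>)
  define N where "N = integral {0..1} (\<lambda>s. wt s * f s powr (q+1))"
  have cfp: "continuous_on {0..1} (\<lambda>s. f s powr (q+1))"
    using continuous_on_powr_const[OF cf f0, of "q+1"] q1 by simp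
  have "N \<ge> 0" unfolding N_def
    by (intro integral_nonneg integrable_continuous_interval continuous_intros cfp) (auto simp: wt_nonneg)
  moreover have "N \<noteq> 0"
  proof
    assume "N = 0"
    then have fz: "f s = 0" if "s \<in> {0..1}" for s
      using wt_integral_zero[OF cfp _ _ that] unfolding N_def by simp
    have "form f f1 (\<lambda>_. 1) (\<lambda>_. 0) = \<mu> * integral {0..1} (\<lambda>s. wt s * h s * 1)"
      by (rule weak_form[OF f _ ch]) (simp add: is_C1_def)
    moreover have "form f f1 (\<lambda>_. 1) (\<lambda>_. 0) = integral {0..1} (\<lambda>s::real. 0)"
      unfolding form_def by (rule integral_cong) (simp add: fz)
    ultimately have "integral {0..1} (\<lambda>s. wt s * h s) = 0" using mu by simp
    then have "h s = 0" if "s \<in> {0..1}" for s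
      using wt_integral_zero[OF ch _ _ that] by (simp add: h_def)
    then have "u s = 0" if "s \<in> {0..1}" for s using that by (auto simp: h_def)
    then have "integral {0..1} (\<lambda>s. wt s * u s powr (q+1)) = integral {0..1} (\<lambda>s::real. 0)"
      by (intro integral_cong) simp
    then show False using uD(4) volume_pos by simp
  qed
  ultimately have N: "N > 0" by simp
  define c where "c = (volume / N) powr (1 / (q+1))"
  define v where "v = (\<lambda>s. c * f s)"
  define v1 where "v1 = (\<lambda>s. c * f1 s)"
  have c0: "0 < c" and prof: "profile v v1"
    using normalize[OF C1f f0 fdec N_def N c_def] by (auto simp: v_def v1_def)
  have sol: "solves (\<lambda>s. c * u s powr q) v v1"
    using solves_combine[OF f f, of c 0] by (simp add: h_def v_def v1_def)
  note vD = profileD[OF prof]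
  have ch': "continuous_on {0..1} (\<lambda>s. c * u s powr q)"
    using ch by (auto simp: h_def intro!: continuous_intros)
  have "form v v1 u u1 = \<mu> * integral {0..1} (\<lambda>s. wt s * (c * u s powr q) * u s)"
    by (rule weak_form[OF sol uD(1) ch'])
  also have "integral {0..1} (\<lambda>s. wt s * (c * u s powr q) * u s) = integral {0..1} (\<lambda>s. c * (wt s * u s powr (q+1)))"
    using uD(2) by (intro integral_cong) (auto simp: powr_add mult_ac)
  finally have vu: "form v v1 u u1 = c * \<mu> * volume" using uD(4) by simp
  have int: "(\<lambda>s. wt s * u s powr q * v s) integrable_on {0..1}"
    "(\<lambda>s. wt s * u s powr (q+1)) integrable_on {0..1}" "(\<lambda>s. wt s * v s powr (q+1)) integrable_on {0..1}"
    using uD(7)[of q] uD(7)[of "q+1"] vD(5) vD(7)[of "q+1"] q1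
    by (auto intro!: integrable_continuous_interval continuous_intros)
  have hi: "((\<lambda>s. q/(q+1) * (wt s * u s powr (q+1)) + 1/(q+1) * (wt s * v s powr (q+1))) has_integral
        q/(q+1) * volume + 1/(q+1) * volume) {0..1}"
    using integrable_integral[OF int(2)] integrable_integral[OF int(3)] uD(4) vD(4)
    by (intro has_integral_add has_integral_mult_right) simp_all
  have "(\<lambda>s. wt s * (c * u s powr q) * v s) = (\<lambda>s. c * (wt s * u s powr q * v s))"
    by (simp add: fun_eq_iff)
  with weak_form[OF sol vD(1) ch']
  have vv_eq: "form v v1 v v1 = c * \<mu> * integral {0..1} (\<lambda>s. wt s * u s powr q * v s)"
    by simp
  have "integral {0..1} (\<lambda>s. wt s * u s powr q * v s) \<le> q/(q+1) * volume + 1/(q+1) * volume"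
  proof (rule has_integral_le[OF integrable_integral[OF int(1)] hi])
    fix s :: real assume s: "s \<in> {0..1}"
    have "wt s * (u s powr q * v s) \<le> wt s * (q/(q+1) * u s powr (q+1) + 1/(q+1) * v s powr (q+1))"
      using young_powr[OF uD(2)[OF s] vD(2)[OF s] q1] wt_nonneg[of s] s by (intro mult_left_mono) auto
    then show "wt s * u s powr q * v s \<le> q/(q+1) * (wt s * u s powr (q+1)) + 1/(q+1) * (wt s * v s powr (q+1))"
      by (simp add: algebra_simps)
  qed
  also have "q/(q+1) * volume + 1/(q+1) * volume = (q/(q+1) + 1/(q+1)) * volume"
    by (rule distrib_right[symmetric])
  also have "q/(q+1) + 1/(q+1) = 1"
    using q1 by (simp add: add_divide_distrib[symmetric])
  finally have vv: "form v v1 v v1 \<le> form v v1 u u1"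
    unfolding vv_eq vu using c0 mu by (intro mult_left_mono) auto
  have diff: "energy (\<lambda>s. v s - u s) (\<lambda>s. v1 s - u1 s) = form v v1 v v1 - 2 * form v v1 u u1 + form u u1 u u1"
    by (rule form_diff[OF vD(1) uD(1)])
  have "0 \<le> energy (\<lambda>s. v s - u s) (\<lambda>s. v1 s - u1 s)" by (rule form_sq_nonneg)
  with diff vv have "form v v1 u u1 \<le> energy u u1" by linarith
  then have "c * \<mu> * volume \<le> energy u u1" by (simp add: vu)
  moreover have "energy (\<lambda>s. v s - u s) (\<lambda>s. v1 s - u1 s) \<le> energy u u1 - energy v v1"
    using diff vv by linarith
  ultimately show ?thesis by (rule that[OF c0 sol prof])
qed

text \<open>
  Perturb the constant 1 by a small multiple of the first eigenfunction \<open>\<phi> = 2 / k - s\<close> with \<open>k = \<kappa> + 3\<close>. The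
  energy grows by the factor \<open>1 + A y\<close> and the normalising integral by at least
  \<open>1 + \<theta> y\<close>, where \<open>y\<close> is proportional to \<open>\<epsilon>\<^sup>2\<close>. After normalisation the energy has dropped if
  \<open>A < 2 \<theta> / (q + 1)\<close>, and such a \<open>\<theta>\<close> below \<open>q (q + 1) / 2\<close> exists because \<open>A = 1 + k / \<mu> < q\<close>.
\<close>
lemma unstable_start:
  obtains u u1 where "profile u u1" "energy u u1 < \<mu> * volume"
proof -
  define k where "k = real \<kappa> + 3"
  have k: "k > 3" using kappa by (simp add: k_def)
  define \<phi> where "\<phi> = (\<lambda>s. 2 / k - s)"
  define B where "B = integral {0..1} (\<lambda>s. wt s * (\<phi> s)\<^sup>2)"
  have dpw: "(pw has_real_derivative k * (wt s * \<phi> s)) (at s within {0..1})" for s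
  proof -
    have "((\<lambda>_. 1) has_real_derivative 0) (at s within {0..1})" by simp
    from flux_deriv[OF this, of 1 \<kappa>] show ?thesis using k
      by (simp add: pw_def[abs_def] wt_def \<phi>_def k_def power2_eq_square add.commute right_diff_distrib mult_ac)
  qed
  have "((\<lambda>s. k * (wt s * \<phi> s)) has_integral pw 1 - pw 0) {0..1}"
    by (rule fundamental_theorem_of_calculus)
       (use dpw in \<open>auto simp: has_real_derivative_iff_has_vector_derivative\<close>)
  then have "((\<lambda>s. (1/k) * (k * (wt s * \<phi> s))) has_integral (1/k) * (pw 1 - pw 0)) {0..1}"
    by (rule has_integral_mult_right)
  then have mean: "((\<lambda>s. wt s * \<phi> s) has_integral 0) {0..1}" using k by (simp add: pw_ends)
  have iB: "((\<lambda>s. wt s * (\<phi> s)\<^sup>2) has_integral B) {0..1}"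
    unfolding B_def \<phi>_def by (intro integrable_integral integrable_continuous_interval continuous_intros)
  have iV: "(wt has_integral volume) {0..1}"
    unfolding volume_def by (intro integrable_integral integrable_continuous_interval continuous_intros)
  have "((\<lambda>s. k * (wt s * \<phi> s) * \<phi> s + (-1) * pw s) has_integral pw 1 * \<phi> 1 - pw 0 * \<phi> 0) {0..1}"
  proof (rule fundamental_theorem_of_calculus)
    show "((\<lambda>s. pw s * \<phi> s) has_vector_derivative k * (wt s * \<phi> s) * \<phi> s + (-1) * pw s) (at s within {0..1})" for s
      unfolding has_real_derivative_iff_has_vector_derivative[symmetric]
      by (rule DERIV_mult dpw)+ (auto simp: \<phi>_def intro!: derivative_eq_intros)
  qed simp
  from has_integral_diff[OF has_integral_mult_right[OF iB, of k] this]
  have ipw: "(pw has_integral k * B) {0..1}"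
    by (simp add: pw_ends power2_eq_square mult_ac)
  have B: "B > 0"
  proof -
    have "B \<ge> 0" by (rule has_integral_nonneg[OF iB]) (auto simp: wt_nonneg)
    moreover have "B \<noteq> 0"
    proof
      assume "B = 0"
      then have "(\<phi> 0)\<^sup>2 = 0"
        unfolding B_def by (intro wt_integral_zero[of "\<lambda>s. (\<phi> s)\<^sup>2"]) (auto simp: \<phi>_def intro!: continuous_intros)
      then show False using k by (simp add: \<phi>_def)
    qed
    ultimately show ?thesis by simp
  qed
  define A where "A = 1 + k / \<mu>"
  have A: "A < q" using unstable mu by (simp add: A_def k_def field_simps)
  \<comment> \<open>the mean of the two bounds (q + 1) A / 2 and (q + 1) q / 2 that \<theta> has to separate\<close>
  define \<theta> where "\<theta> = (q+1) * (A + q) / 4"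
  have "2 * \<theta> = (q+1) * ((A + q) / 2)" by (simp add: \<theta>_def)
  then have th2: "2 * \<theta> / (q+1) = (A + q) / 2" using q1 by simp
  have "(q+1) * (A + q) < (q+1) * (2 * q)" using A q1 by (intro mult_strict_left_mono) auto
  then have "2 * \<theta> < (q+1) * q" using \<open>2 * \<theta> = (q+1) * ((A + q) / 2)\<close> by argo
  have "A < 2 * \<theta> / (q+1)" using A unfolding th2 by simp
  obtain d where d: "0 < d" "d < 1" "\<And>x. \<bar>x\<bar> < d \<Longrightarrow> 1 + (q+1) * x + \<theta> * x\<^sup>2 \<le> (1+x) powr (q+1)"
    using powr_quadratic_lower_bound[OF q1 \<open>2 * \<theta> < (q+1) * q\<close>] by meson
  define \<psi> where "\<psi> = (\<lambda>y. (1 + \<theta> * y) powr (2/(q+1)) - (1 + A * y))"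
  have "(\<psi> has_real_derivative 2 * \<theta> / (q+1) - A) (at 0)"
  proof -
    have "((\<lambda>y. 1 + \<theta> * y) has_real_derivative \<theta>) (at 0)" "((\<lambda>y. 1 + A * y) has_real_derivative A) (at 0)"
      by (rule derivative_eq_intros refl | simp)+
    from DERIV_diff[OF DERIV_fun_powr[OF this(1), of "2/(q+1)"] this(2)] show ?thesis
      by (simp add: \<psi>_def)
  qed
  from DERIV_pos_inc_right[OF this] \<open>A < 2 * \<theta> / (q+1)\<close>
  obtain e where e: "e > 0" "\<And>h. 0 < h \<Longrightarrow> h < e \<Longrightarrow> \<psi> 0 < \<psi> (0 + h)" by auto
  define b where "b = B / volume"
  have b: "b > 0" using B volume_pos by (simp add: b_def)
  \<comment> \<open>small enough for the expansion of the power, and such that y stays below e\<close>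
  define \<epsilon> where "\<epsilon> = min (d/2) (min 1 (e / (2 * b)))"
  have \<epsilon>: "0 < \<epsilon>" "\<epsilon> < d" "\<epsilon> \<le> 1" "\<epsilon> \<le> e / (2 * b)" using d e b by (auto simp: \<epsilon>_def)
  define y where "y = \<epsilon>\<^sup>2 * b"
  have "\<epsilon>\<^sup>2 \<le> \<epsilon>" using \<epsilon> by (simp add: power2_eq_square mult_left_le)
  then have "y \<le> \<epsilon> * b" using b by (simp add: y_def)
  also have "\<dots> \<le> e / 2" using \<epsilon>(4) b by (simp add: field_simps)
  finally have y: "0 < y" "y < e" using \<epsilon> b e(1) by (auto simp: y_def)
  have Vy: "volume * y = \<epsilon>\<^sup>2 * B" using volume_pos by (simp add: y_def b_def)
  have psi: "1 + A * y < (1 + \<theta> * y) powr (2/(q+1))"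
    using e(2)[OF y] by (simp add: \<psi>_def)
  define f where "f = (\<lambda>s. 1 + \<epsilon> * \<phi> s)"
  define f1 where "f1 = (\<lambda>s::real. - \<epsilon>)"
  have C1: "is_C1 f f1" unfolding is_C1_def f_def f1_def \<phi>_def by (auto intro!: derivative_eq_intros)
  have ph: "\<bar>\<epsilon> * \<phi> s\<bar> < d" if "s \<in> {0..1}" for s
  proof -
    have "2 / k \<le> 1" "0 \<le> 2 / k" "0 \<le> s" "s \<le> 1" using k that by auto
    then have "\<bar>\<phi> s\<bar> \<le> 1" unfolding \<phi>_def by linarith
    then have "\<epsilon> * \<bar>\<phi> s\<bar> \<le> \<epsilon> * 1" using \<epsilon> by (intro mult_left_mono) auto
    then have "\<bar>\<epsilon> * \<phi> s\<bar> \<le> \<epsilon>" using \<epsilon>(1) by (simp add: abs_mult)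
    then show ?thesis using \<epsilon>(2) by linarith
  qed
  have f0: "0 \<le> f s" if "s \<in> {0..1}" for s using ph[OF that] d(2) unfolding f_def by linarith
  have fdec: "f t \<le> f s" if "0 \<le> s" "s \<le> t" "t \<le> 1" for s t using that \<epsilon>(1) by (simp add: f_def \<phi>_def)
  define N where "N = integral {0..1} (\<lambda>s. wt s * f s powr (q+1))"
  have iN: "((\<lambda>s. wt s * f s powr (q+1)) has_integral N) {0..1}"
    unfolding N_def
    by (rule integrable_integral, rule integrable_continuous_interval,
        rule continuous_on_mult[OF cont_wt continuous_on_powr_const[OF is_C1_cont(1)[OF C1] f0]])
       (use q1 in auto)
  have "((\<lambda>s. (wt s + (q+1) * \<epsilon> * (wt s * \<phi> s)) + \<theta> * \<epsilon>\<^sup>2 * (wt s * (\<phi> s)\<^sup>2)) has_integral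
      (volume + (q+1) * \<epsilon> * 0) + \<theta> * \<epsilon>\<^sup>2 * B) {0..1}"
    by (intro has_integral_add has_integral_mult_right iV iB mean)
  then have "(volume + (q+1) * \<epsilon> * 0) + \<theta> * \<epsilon>\<^sup>2 * B \<le> N"
  proof (rule has_integral_le[OF _ iN])
    fix s :: real assume s: "s \<in> {0..1}"
    have "wt s * (1 + (q+1) * (\<epsilon> * \<phi> s) + \<theta> * (\<epsilon> * \<phi> s)\<^sup>2) \<le> wt s * f s powr (q+1)"
      unfolding f_def using d(3)[OF ph[OF s]] s by (intro mult_left_mono wt_nonneg) auto
    then show "(wt s + (q+1) * \<epsilon> * (wt s * \<phi> s)) + \<theta> * \<epsilon>\<^sup>2 * (wt s * (\<phi> s)\<^sup>2) \<le> wt s * f s powr (q+1)"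
      by (simp add: algebra_simps power_mult_distrib)
  qed
  moreover have "volume * (1 + \<theta> * y) = (volume + (q+1) * \<epsilon> * 0) + \<theta> * \<epsilon>\<^sup>2 * B"
    using Vy by (simp add: distrib_left mult_ac)
  ultimately have Nge: "volume * (1 + \<theta> * y) \<le> N" by simp
  have th: "\<theta> > 0" using A q1 mu k by (simp add: \<theta>_def A_def add_pos_pos)
  have "0 < volume * (1 + \<theta> * y)" using th y volume_pos by (intro mult_pos_pos add_pos_pos) auto
  then have N: "N > 0" using Nge by simp
  define c where "c = (volume / N) powr (1 / (q+1))"
  note nrm = normalize[OF C1 f0 fdec N_def N c_def]
  have "((\<lambda>s. (\<epsilon>\<^sup>2 * pw s + \<mu> * ((wt s + 2 * \<epsilon> * (wt s * \<phi> s)) + \<epsilon>\<^sup>2 * (wt s * (\<phi> s)\<^sup>2)))) has_integral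
      \<epsilon>\<^sup>2 * (k * B) + \<mu> * ((volume + 2 * \<epsilon> * 0) + \<epsilon>\<^sup>2 * B)) {0..1}"
    by (intro has_integral_add has_integral_mult_right iV iB mean ipw)
  moreover have "(\<lambda>s. (\<epsilon>\<^sup>2 * pw s + \<mu> * ((wt s + 2 * \<epsilon> * (wt s * \<phi> s)) + \<epsilon>\<^sup>2 * (wt s * (\<phi> s)\<^sup>2))))
     = (\<lambda>s. pw s * f1 s * f1 s + \<mu> * wt s * f s * f s)"
    by (simp add: fun_eq_iff f_def f1_def power2_eq_square algebra_simps)
  ultimately have "energy f f1 = \<epsilon>\<^sup>2 * (k * B) + \<mu> * (volume + \<epsilon>\<^sup>2 * B)"
    by (simp add: form_def integral_unique)
  also have "\<dots> = \<mu> * volume * (1 + A * y)"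
  proof -
    have "\<mu> * A = \<mu> + k" using mu by (simp add: A_def distrib_left)
    moreover have "\<mu> * volume * (1 + A * y) = \<mu> * volume + \<mu> * A * (volume * y)" by (simp add: algebra_simps)
    ultimately show ?thesis unfolding Vy by (simp add: algebra_simps)
  qed
  finally have Ef: "energy f f1 = \<mu> * volume * (1 + A * y)" .
  have "c\<^sup>2 = (volume / N) powr (2 / (q+1))"
    using N volume_pos q1 by (simp add: c_def powr_power mult.commute)
  also have "\<dots> \<le> (1 / (1 + \<theta> * y)) powr (2 / (q+1))"
  proof (rule powr_mono2)
    have "0 < 1 + \<theta> * y" using th y by (simp add: add_pos_pos)
    then show "volume / N \<le> 1 / (1 + \<theta> * y)" using Nge N by (simp add: divide_le_eq pos_le_divide_eq)
  qed (use q1 N volume_pos in auto)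
  also have "\<dots> = 1 / (1 + \<theta> * y) powr (2 / (q+1))"
    using th y by (simp add: powr_divide add_nonneg_nonneg)
  finally have c2: "c\<^sup>2 \<le> 1 / (1 + \<theta> * y) powr (2 / (q+1))" .
  have pos: "0 < 1 + A * y" using y k mu by (simp add: A_def add_pos_pos)
  have "energy (\<lambda>s. c * f s) (\<lambda>s. c * f1 s) = \<mu> * volume * (c\<^sup>2 * (1 + A * y))"
    by (simp add: form_scale Ef)
  also have "\<dots> < \<mu> * volume * 1"
  proof (intro mult_strict_left_mono)
    have "c\<^sup>2 * (1 + A * y) \<le> 1 / (1 + \<theta> * y) powr (2 / (q+1)) * (1 + A * y)"
      using c2 pos by (intro mult_right_mono) auto
    also have "\<dots> < 1" using psi pos by (simp add: divide_less_eq)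
    finally show "c\<^sup>2 * (1 + A * y) < 1" .
  qed (use mu volume_pos in auto)
  finally show ?thesis using that[OF nrm(2)] by simp
qed

end

section \<open>Compactness and the limit profile\<close>

lemma uniform_limit_integral_Icc:
  fixes f :: "nat \<Rightarrow> real \<Rightarrow> real"
  assumes "uniform_limit {0..1} f g sequentially" "\<And>n. continuous_on {0..1} (f n)"
  shows "(\<lambda>n. integral {0..1} (f n)) \<longlonglongrightarrow> integral {0..1} g"
proof -
  obtain I J where IJ: "\<And>n. (f n has_integral I n) {0..1}" "(g has_integral J) {0..1}" "I \<longlonglongrightarrow> J"
    by (rule uniform_limit_integral[OF assms]) auto
  then have "integral {0..1} (f n) = I n" "integral {0..1} g = J" for n
    by (auto intro: integral_unique)
  with IJ(3) show ?thesis by simp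
qed

context lane_emden
begin

text \<open>
  At \<open>s = 1/2\<close> the mass term of the energy bounds a decreasing function. For smaller \<open>s\<close> integrate
  \<open>- u1 \<le> \<eta>/2 pw u1\<^sup>2 + 1 / (2 \<eta> pw)\<close> from \<open>s\<close> to \<open>1/2\<close>: the first term is bounded by \<open>\<eta>\<close> times the energy,
  the second one by a multiple of \<open>1 / (\<eta> s)\<close>, as \<open>pw\<close> is comparable to \<open>s\<^sup>2\<close>. The choice
  \<open>\<eta> = 1 / sqrt s\<close> balances the two.
\<close>
lemma profile_bound:
  obtains K M where "K > 0" "M > 0"
    "\<And>u u1. profile u u1 \<Longrightarrow> energy u u1 \<le> \<mu> * volume \<Longrightarrow> u (1/2) \<le> K"
    "\<And>u u1 s. profile u u1 \<Longrightarrow> energy u u1 \<le> \<mu> * volume \<Longrightarrow> 0 < s \<Longrightarrow> s \<le> 1 \<Longrightarrow> u s \<le> M / sqrt s"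
proof -
  define w0 where "w0 = integral {0..1/2} wt"
  have iw: "(wt has_integral w0) {0..1/2}"
    unfolding w0_def by (intro integrable_integral integrable_continuous_interval continuous_intros)
  have w0: "w0 > 0"
  proof -
    have "w0 \<ge> 0" by (rule has_integral_nonneg[OF iw]) (auto simp: wt_nonneg)
    moreover have "w0 \<noteq> 0"
    proof
      assume "w0 = 0"
      then have "\<forall>s\<in>{0..1/2}. wt s = 0"
        using integral_eq_0_iff[of 0 "1/2" wt] cont_wt unfolding w0_def by (auto simp: wt_nonneg)
      then show False using wt_pos[of "1/4"] by auto
    qed
    ultimately show ?thesis by simp
  qed
  define K where "K = 1 + volume / w0"
  define M where "M = K + \<mu> * volume + 2^\<kappa>"
  have K: "K \<ge> 1" using w0 volume_pos by (simp add: K_def)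
  have M: "M \<ge> K" using mu volume_pos by (simp add: M_def)
  have both: "u (1/2) \<le> K \<and> (\<forall>s. 0 < s \<and> s \<le> 1 \<longrightarrow> u s \<le> M / sqrt s)"
    if u: "profile u u1" and E: "energy u u1 \<le> \<mu> * volume" for u u1
  proof -
    note uD = profileD[OF u]
    define e where "e = (\<lambda>s. pw s * u1 s * u1 s + \<mu> * wt s * u s * u s)"
    have ce: "continuous_on {0..1} e" unfolding e_def by (intro continuous_intros uD)
    have e_terms: "0 \<le> pw s * u1 s * u1 s" "0 \<le> \<mu> * wt s * u s * u s" if "s \<in> {0..1}" for s
      using that mu by (auto simp: mult.assoc pw_nonneg wt_nonneg intro!: mult_nonneg_nonneg)
    have part: "integral {a..b} e \<le> \<mu> * volume" "e integrable_on {a..b}" if "0 \<le> a" "b \<le> 1" for a b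
    proof -
      show ie: "e integrable_on {a..b}"
        by (rule integrable_continuous_interval, rule continuous_on_subset[OF ce]) (use that in auto)
      have "integral {a..b} e \<le> integral {0..1} e"
      proof (rule integral_subset_le[OF _ ie])
        show "e integrable_on {0..1}" by (rule integrable_continuous_interval[OF ce])
        show "\<forall>x\<in>{0..1}. 0 \<le> e x" using e_terms unfolding e_def by (intro ballI add_nonneg_nonneg) auto
      qed (use that in auto)
      also have "\<dots> \<le> \<mu> * volume" using E by (simp add: form_def e_def)
      finally show "integral {a..b} e \<le> \<mu> * volume" .
    qed
    have half: "u (1/2) \<le> K"
    proof (rule ccontr)
      assume "\<not> u (1/2) \<le> K"
      then have uK: "u (1/2) > K" by simp
      have "(\<mu> * K) * w0 \<le> integral {0..1/2} e"
      proof (rule has_integral_le[OF has_integral_mult_right[OF iw] integrable_integral[OF part(2)]])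
        fix s :: real assume s: "s \<in> {0..1/2}"
        have "K \<le> u s" using uD(3)[of s "1/2"] s uK by auto
        then have "K \<le> u s * u s" using K mult_mono[of 1 "u s" K "u s"] by auto
        then have "\<mu> * wt s * K \<le> \<mu> * wt s * (u s * u s)"
          using mu s by (intro mult_left_mono mult_nonneg_nonneg wt_nonneg) auto
        then show "\<mu> * K * wt s \<le> e s" using e_terms(1)[of s] s by (simp add: e_def mult_ac)
      qed auto
      also have "\<dots> \<le> \<mu> * volume" by (rule part) auto
      finally have "K * w0 \<le> volume" using mu by (simp add: mult.assoc)
      then show False using w0 by (simp add: K_def distrib_right)
    qed
    have small: "u s \<le> M / sqrt s" if s: "0 < s" "s \<le> 1/2" for s
    proof -
      define \<eta> where "\<eta> = 1 / sqrt s"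
      have "sqrt s \<le> 1" using s by simp
      then have \<eta>: "\<eta> > 0" "1 / (\<eta> * s) = \<eta>" "1 \<le> \<eta>"
        using s by (auto simp: \<eta>_def divide_simps)
      have du: "((\<lambda>t. - u1 t) has_integral - u (1/2) - (- u s)) {s..1/2}"
      proof (rule fundamental_theorem_of_calculus)
        fix t assume t: "t \<in> {s..1/2}"
        have "(u has_real_derivative u1 t) (at t within {0..1})" using uD(1) t s by (simp add: is_C1_def)
        then have "((\<lambda>t. - u t) has_real_derivative - u1 t) (at t within {s..1/2})"
          using s by (intro DERIV_minus) (auto intro: DERIV_subset)
        then show "((\<lambda>t. - u t) has_vector_derivative - u1 t) (at t within {s..1/2})"
          by (simp add: has_real_derivative_iff_has_vector_derivative)
      qed (use s in auto)
      have dinv: "((\<lambda>t. 1 / t\<^sup>2) has_integral - 1 / (1/2) - (- 1 / s)) {s..1/2}"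
      proof (rule fundamental_theorem_of_calculus)
        fix t assume t: "t \<in> {s..1/2}"
        have "((\<lambda>t. - 1 / t) has_real_derivative 1 / t\<^sup>2) (at t within {s..1/2})"
          using t s by (auto intro!: derivative_eq_intros simp: power2_eq_square)
        then show "((\<lambda>t. - 1 / t) has_vector_derivative 1 / t\<^sup>2) (at t within {s..1/2})"
          by (simp add: has_real_derivative_iff_has_vector_derivative)
      qed (use s in auto)
      have "- u (1/2) - (- u s) \<le> \<eta> / 2 * integral {s..1/2} e + 2^\<kappa> / \<eta> * (- 1 / (1/2) - (- 1 / s))"
      proof (rule has_integral_le[OF du has_integral_add[OF has_integral_mult_right[OF integrable_integral[OF part(2)]]
              has_integral_mult_right[OF dinv]]])
        fix t :: real assume t: "t \<in> {s..1/2}"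
        then have t01: "0 < t" "t \<le> 1/2" using s by auto
        define p where "p = pw t"
        have "t\<^sup>2 * (1/2)^(\<kappa>+1) \<le> p" unfolding p_def pw_def using t01 by (intro mult_left_mono power_mono) auto
        then have pge: "t\<^sup>2 \<le> p * 2^(\<kappa>+1)" by (simp add: power_one_over field_simps)
        have p: "p > 0" unfolding p_def using t01 by (intro pw_pos) auto
        have "0 \<le> (\<eta> * p * u1 t + 1)\<^sup>2 / (2 * \<eta> * p)" using \<eta> p by simp
        also have "\<dots> = \<eta> / 2 * (p * u1 t * u1 t) + u1 t + 1 / (2 * \<eta> * p)"
          using \<eta> p by (simp add: field_simps power2_eq_square)
        finally have "- u1 t \<le> \<eta> / 2 * (p * u1 t * u1 t) + 1 / (2 * \<eta> * p)" by simp
        moreover have "1 / (2 * \<eta> * p) \<le> 2^\<kappa> / \<eta> * (1 / t\<^sup>2)"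
          using pge \<eta>(1) p t01 by (simp add: field_simps)
        moreover have "\<eta> / 2 * (p * u1 t * u1 t) \<le> \<eta> / 2 * e t"
          unfolding e_def p_def using \<eta>(1) e_terms(2)[of t] t01 by (intro mult_left_mono) auto
        ultimately show "- u1 t \<le> \<eta> / 2 * e t + 2^\<kappa> / \<eta> * (1 / t\<^sup>2)" by linarith
      qed (use s in auto)
      also have "\<dots> \<le> \<eta> / 2 * (\<mu> * volume) + 2^\<kappa> / \<eta> * (1 / s)"
        using \<eta>(1) s part(1)[of s "1/2"] by (intro add_mono mult_left_mono) auto
      also have "2^\<kappa> / \<eta> * (1 / s) = 2^\<kappa> * \<eta>" using \<eta>(2) by (metis divide_divide_eq_left mult.right_neutral times_divide_eq_right)
      finally have "u s \<le> K + (\<eta> / 2 * (\<mu> * volume) + 2^\<kappa> * \<eta>)" using half by linarith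
      also have "\<dots> \<le> K * \<eta> + (\<eta> * (\<mu> * volume) + 2^\<kappa> * \<eta>)"
        using \<eta> K mu volume_pos by (intro add_mono mult_right_mono) auto
      also have "\<dots> = M / sqrt s" by (simp add: M_def \<eta>_def algebra_simps add_divide_distrib)
      finally show ?thesis .
    qed
    have "u s \<le> M / sqrt s" if s: "0 < s" "s \<le> 1" for s
    proof (cases "s \<le> 1/2")
      case False
      have "u s \<le> K" using uD(3)[of "1/2" s] half s False by auto
      also have "\<dots> \<le> M * 1" using M by simp
      also have "\<dots> \<le> M * (1 / sqrt s)" using s K M by (intro mult_left_mono) auto
      finally show ?thesis by simp
    qed (use small s in auto)
    with half show ?thesis by blast
  qed
  show ?thesis
    by (rule that[of K M]) (use both K M in auto)
qed

text \<open>
  With \<open>u \<le> M / sqrt s\<close> the source term \<open>wt u\<^sup>q\<close> is at most \<open>M\<^sup>q s powr (1 - q/2)\<close>, so the flux of \<open>v\<close> is at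
  least a negative multiple of \<open>s powr (2 - q/2)\<close> and \<open>- v1\<close> is at most a multiple of \<open>s powr (- q/2)\<close>. This is
  integrable since \<open>q < 2\<close>. The integration is written as monotonicity of the sum of \<open>v\<close> and a power of \<open>s\<close>.
\<close>
lemma power_step_bound:
  assumes sol: "solves (\<lambda>s. c * u s powr q) v v1" and c: "0 < c" "c \<le> 1" and M: "M > 0"
    and u: "\<And>s. s \<in> {0..1} \<Longrightarrow> 0 \<le> u s" "\<And>s. 0 < s \<Longrightarrow> s \<le> 1 \<Longrightarrow> u s \<le> M / sqrt s"
    and v: "profile v v1" "v (1/2) \<le> K" and s: "s \<in> {0..1}"
  shows "v s \<le> K + \<mu> * M powr q * 2^(\<kappa>+1) / (1 - q/2)"
proof -
  note vD = profileD[OF v(1)]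
  define C where "C = \<mu> * M powr q"
  define r where "r = 2 - q/2"
  have C: "C > 0" using mu M by (simp add: C_def)
  have r: "r > 1" using q2 by (simp add: r_def)
  have rhs: "u t powr q \<le> M powr q * t powr (- q/2)" if t: "0 < t" "t \<le> 1" for t
  proof -
    have "u t powr q \<le> (M / sqrt t) powr q" using u[of t] t q1 by (intro powr_mono2) auto
    also have "\<dots> = M powr q * t powr (- q/2)"
      using t M by (simp add: powr_divide powr_half_sqrt[symmetric] powr_powr powr_minus_divide)
    finally show ?thesis .
  qed
  have flux: "- (C * s powr r) \<le> pw s * v1 s" if s: "0 < s" "s \<le> 1" for s
  proof -
    obtain t where t: "0 < t" "t < s" "pw s * v1 s - pw 0 * v1 0 = (s - 0) * (\<mu> * wt t * (v t - c * u t powr q))"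
      using MVT_within[of "\<lambda>s. pw s * v1 s" _ 0 s, OF solvesD(3)[OF sol]] s by auto
    have "c * u t powr q - v t \<le> 1 * u t powr q"
      using c vD(2)[of t] t s by (intro order_trans[OF _ mult_right_mono[of c 1]]) auto
    also have "\<dots> \<le> M powr q * t powr (- q/2)" using rhs[of t] t s by simp
    finally have 1: "c * u t powr q - v t \<le> M powr q * t powr (- q/2)" .
    have "wt t \<le> t * 1" unfolding wt_def using t s by (intro mult_left_mono power_le_one) auto
    then have "\<mu> * wt t * (c * u t powr q - v t) \<le> \<mu> * t * (M powr q * t powr (- q/2))"
      using t s mu M 1 wt_nonneg[of t]
      by (intro order_trans[OF mult_left_mono[OF 1] mult_right_mono]) auto
    also have "\<dots> = C * t powr (r-1)"
      using t by (simp add: C_def r_def powr_diff powr_minus_divide)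
    also have "\<dots> \<le> C * s powr (r-1)" using C r t by (intro mult_left_mono powr_mono2) auto
    finally have "s * (\<mu> * wt t * (c * u t powr q - v t)) \<le> s * (C * s powr (r-1))"
      using s by (intro mult_left_mono) auto
    also have "\<dots> = C * s powr r" using s by (simp add: powr_diff)
    finally have "s * (\<mu> * wt t * (c * u t powr q - v t)) \<le> C * s powr r" .
    then show ?thesis using t(3) by (simp add: pw_ends algebra_simps)
  qed
  define D where "D = C * 2^(\<kappa>+1) / (1 - q/2)"
  have D: "D > 0" using C q2 by (simp add: D_def)
  have slope: "- (D * ((1 - q/2) * t powr (- q/2))) \<le> v1 t" if t: "0 < t" "t \<le> 1/2" for t
  proof (cases "v1 t \<ge> 0")
    case True
    then show ?thesis using D q2 t by (intro order_trans[OF _ True]) (simp add: mult_nonneg_nonneg)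
  next
    case False
    have "t\<^sup>2 * - (C * t powr (- q/2)) = - (C * t powr r)"
      using t by (simp add: r_def powr_diff powr_minus_divide)
    also have "\<dots> \<le> t\<^sup>2 * ((1-t)^(\<kappa>+1) * v1 t)" using flux[of t] t by (simp add: pw_def mult.assoc)
    finally have 1: "- (C * t powr (- q/2)) \<le> (1-t)^(\<kappa>+1) * v1 t"
      using t by (subst (asm) mult_le_cancel_left_pos) auto
    have "1 \<le> (2 * (1-t))^(\<kappa>+1)" using t by (intro one_le_power) auto
    then have "(2 * (1-t))^(\<kappa>+1) * v1 t \<le> v1 t" using False mult_right_mono_neg[of 1 "(2 * (1-t))^(\<kappa>+1)" "v1 t"] by simp
    moreover have "2^(\<kappa>+1) * - (C * t powr (- q/2)) \<le> (2 * (1-t))^(\<kappa>+1) * v1 t"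
    proof -
      have "2^(\<kappa>+1) * - (C * t powr (- q/2)) \<le> 2^(\<kappa>+1) * ((1-t)^(\<kappa>+1) * v1 t)"
        by (rule mult_left_mono[OF 1]) simp
      then show ?thesis by (simp only: power_mult_distrib mult.assoc)
    qed
    moreover have "D * ((1 - q/2) * t powr (- q/2)) = 2^(\<kappa>+1) * (C * t powr (- q/2))"
      using q2 by (simp add: D_def)
    ultimately show ?thesis by linarith
  qed
  have "v 0 + D * 0 powr (1 - q/2) \<le> v (1/2) + D * (1/2) powr (1 - q/2)"
  proof (rule increasing_of_deriv_within[where g = "\<lambda>t. v t + D * t powr (1 - q/2)"
        and g' = "\<lambda>t. v1 t + D * ((1 - q/2) * t powr (- q/2))"])
    show "continuous_on {0..1/2} (\<lambda>t. v t + D * t powr (1 - q/2))"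
      using q2 by (intro continuous_intros continuous_on_powr_const continuous_on_subset[OF vD(5)]) auto
    fix t :: real assume t: "0 < t" "t < 1/2"
    have "((\<lambda>t. t powr (1 - q/2)) has_real_derivative (1 - q/2) * t powr (1 - q/2 - 1)) (at t within {0..1})"
      by (rule has_field_derivative_at_within[OF has_real_derivative_powr[OF t(1)]])
    then show "((\<lambda>t. v t + D * t powr (1 - q/2)) has_real_derivative v1 t + D * ((1 - q/2) * t powr (- q/2))) (at t within {0..1})"
      using t by (intro DERIV_add DERIV_cmult solvesD(1)[OF sol]) auto
    show "0 \<le> v1 t + D * ((1 - q/2) * t powr (- q/2))" using slope[of t] t by linarith
  qed auto
  moreover have "D * (1/2) powr (1 - q/2) \<le> D * 1"
    using D q2 by (intro mult_left_mono powr_le1) auto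
  moreover have "v s \<le> v 0" using vD(3)[of 0 s] s by auto
  ultimately show ?thesis using v(2) q2 by (simp add: D_def C_def)
qed

text \<open>
  The factors are bounded by the initial energy divided by \<open>\<mu> volume\<close>, because the energy decreases along
  the iteration and bounds \<open>c \<mu> volume\<close>.
\<close>
lemma power_iteration:
  obtains c0 :: real and u u1 c where "c0 < 1" "\<And>n::nat. profile (u n) (u1 n)" "\<And>n. energy (u n) (u1 n) \<le> \<mu> * volume"
    "\<And>n. 0 < c n" "\<And>n. c n \<le> c0" "\<And>n. solves (\<lambda>s. c n * u n s powr q) (u (Suc n)) (u1 (Suc n))"
    "\<And>n. energy (\<lambda>s. u (Suc n) s - u n s) (\<lambda>s. u1 (Suc n) s - u1 n s)
        \<le> energy (u n) (u1 n) - energy (u (Suc n)) (u1 (Suc n))"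
proof -
  obtain u0 u01 where start: "profile u0 u01" "energy u0 u01 < \<mu> * volume"
    using unstable_start .
  define E0 where "E0 = energy u0 u01"
  define c0 where "c0 = E0 / (\<mu> * volume)"
  have c0: "c0 < 1" using start(2) mu volume_pos by (simp add: c0_def E0_def)
  define P where "P = (\<lambda>(n::nat) (u, u1). profile u u1 \<and> energy u u1 \<le> E0)"
  define Q where "Q = (\<lambda>(n::nat) (u, u1) (v, v1). \<exists>c>0. solves (\<lambda>s. c * u s powr q) v v1 \<and>
      c * \<mu> * volume \<le> energy u u1 \<and>
      energy (\<lambda>s. v s - u s) (\<lambda>s. v1 s - u1 s) \<le> energy u u1 - energy v v1)"
  have "\<exists>x. \<forall>n. P n (x n) \<and> Q n (x n) (x (Suc n))"
  proof (rule dependent_nat_choice)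
    show "\<exists>x. P 0 x" using start by (auto simp: P_def E0_def)
    fix x n assume Px: "P n x"
    obtain u u1 where x: "x = (u, u1)" by (cases x)
    have pu: "profile u u1" "energy u u1 \<le> E0" using Px by (auto simp: P_def x)
    obtain c v v1 where *: "0 < c" "solves (\<lambda>s. c * u s powr q) v v1" "profile v v1"
      "c * \<mu> * volume \<le> energy u u1"
      "energy (\<lambda>s. v s - u s) (\<lambda>s. v1 s - u1 s) \<le> energy u u1 - energy v v1"
      using power_step[OF pu(1)] .
    have "energy v v1 \<le> E0"
      using *(5) pu(2) form_sq_nonneg[of "\<lambda>s. v s - u s" "\<lambda>s. v1 s - u1 s"] by linarith
    then have "P (Suc n) (v, v1) \<and> Q n x (v, v1)" using * by (auto simp: P_def Q_def x)
    then show "\<exists>y. P (Suc n) y \<and> Q n x y" by blast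
  qed
  then obtain x where x: "\<And>n. P n (x n)" "\<And>n. Q n (x n) (x (Suc n))" by blast
  define u where "u n = fst (x n)" for n
  define u1 where "u1 n = snd (x n)" for n
  have prof: "profile (u n) (u1 n)" and En: "energy (u n) (u1 n) \<le> E0" for n
    using x(1)[of n] by (auto simp: P_def u_def u1_def split: prod.splits)
  have "\<exists>c>0. solves (\<lambda>s. c * u n s powr q) (u (Suc n)) (u1 (Suc n)) \<and>
      c * \<mu> * volume \<le> energy (u n) (u1 n) \<and>
      energy (\<lambda>s. u (Suc n) s - u n s) (\<lambda>s. u1 (Suc n) s - u1 n s)
        \<le> energy (u n) (u1 n) - energy (u (Suc n)) (u1 (Suc n))" for n
    using x(2)[of n] by (auto simp: Q_def u_def u1_def split: prod.splits)
  then obtain c where c: "\<And>n. 0 < c n" "\<And>n. solves (\<lambda>s. c n * u n s powr q) (u (Suc n)) (u1 (Suc n))"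
    "\<And>n. c n * \<mu> * volume \<le> energy (u n) (u1 n)"
    "\<And>n. energy (\<lambda>s. u (Suc n) s - u n s) (\<lambda>s. u1 (Suc n) s - u1 n s)
        \<le> energy (u n) (u1 n) - energy (u (Suc n)) (u1 (Suc n))"
    by metis
  have cle: "c n \<le> c0" for n
    using c(3)[of n] En[of n] mu volume_pos by (simp add: c0_def pos_le_divide_eq mult.assoc)
  have En': "energy (u n) (u1 n) \<le> \<mu> * volume" for n using En[of n] start(2) by (simp add: E0_def)
  show ?thesis
    by (rule that[of c0 u u1 c, OF c0 prof En' c(1) cle c(2) c(4)])
qed

text \<open>
  From the second iterate on, functions and derivatives are uniformly bounded, so a subsequence
  \<open>u (j n)\<close> converges to some \<open>g\<close>, and the factors \<open>c (j n)\<close> can be taken to converge to \<open>cl\<close>. The next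
  iterates then converge to \<open>cl K(g\<^sup>q)\<close>. The energies decrease and are nonnegative, so the energy drops tend to
  zero, and this limit is \<open>g\<close> again.
\<close>
lemma power_iteration_limit:
  obtains cl g g1 where "solves (\<lambda>s. cl * g s powr q) g g1" "0 \<le> cl" "cl < 1"
    "\<And>s. s \<in> {0..1} \<Longrightarrow> 0 \<le> g s" "\<And>s t. 0 \<le> s \<Longrightarrow> s \<le> t \<Longrightarrow> t \<le> 1 \<Longrightarrow> g t \<le> g s"
    "integral {0..1} (\<lambda>s. wt s * g s powr (q+1)) = volume"
proof -
  obtain c0 u u1 c where c0: "c0 < 1" and prof: "\<And>n::nat. profile (u n) (u1 n)"
    and En: "\<And>n. energy (u n) (u1 n) \<le> \<mu> * volume" and c: "\<And>n. 0 < c n" and cle: "\<And>n. c n \<le> c0"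
    and sol: "\<And>n. solves (\<lambda>s. c n * u n s powr q) (u (Suc n)) (u1 (Suc n))"
    and step: "\<And>n. energy (\<lambda>s. u (Suc n) s - u n s) (\<lambda>s. u1 (Suc n) s - u1 n s)
        \<le> energy (u n) (u1 n) - energy (u (Suc n)) (u1 (Suc n))"
    using power_iteration by blast
  have cle1: "c n \<le> 1" for n using cle[of n] c0 by linarith
  obtain K M where KM: "K > 0" "M > 0" "\<And>n. u n (1/2) \<le> K"
    "\<And>n s. 0 < s \<Longrightarrow> s \<le> 1 \<Longrightarrow> u n s \<le> M / sqrt s"
    using profile_bound prof En by metis
  define B where "B = K + \<mu> * M powr q * 2^(\<kappa>+1) / (1 - q/2)"
  have uB: "u (Suc n) s \<in> {0..B}" if "s \<in> {0..1}" for n s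
    using power_step_bound[OF sol c(1) cle1 KM(2) profileD(2)[OF prof] KM(4) prof KM(3) that]
      profileD(2)[OF prof that] by (auto simp: B_def)
  have B0: "B \<ge> 0" using uB[of 0 0] by auto
  define L where "L = 2^(\<kappa>+3) * (\<mu> * (2 * B powr q))"
  have L0: "L \<ge> 0" using mu by (simp add: L_def)
  have u1L: "\<bar>u1 (Suc (Suc n)) s\<bar> \<le> L" if s: "s \<in> {0..1}" for n s
    unfolding L_def
  proof (rule solves_deriv_le[OF sol _ s])
    fix t :: real assume t: "t \<in> {0..1}"
    have "u (Suc n) t powr q \<le> B powr q" using uB[OF t, of n] q1 by (intro powr_mono2) auto
    then show "\<bar>c (Suc n) * u (Suc n) t powr q\<bar> \<le> B powr q"
      using c(1)[of "Suc n"] cle1[of "Suc n"] mult_mono[of "c (Suc n)" 1 "u (Suc n) t powr q" "B powr q"]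
      by (simp add: abs_mult)
  qed
  obtain g k where g: "continuous_on {0..1} g" "strict_mono (k :: nat \<Rightarrow> nat)"
    "\<And>e. 0 < e \<Longrightarrow> \<exists>N. \<forall>n x. n \<ge> N \<and> x \<in> {0..1} \<longrightarrow> norm (u (k n + 2) x - g x) < e"
  proof (rule Arzela_Ascoli[of "{0..1::real}" "\<lambda>n. u (n + 2)" B])
    show "norm (u (n + 2) x) \<le> B" if "x \<in> {0..1}" for n x using uB[OF that, of "Suc n"] by simp
    fix x e :: real assume x: "x \<in> {0..1}" and e: "0 < e"
    have lip: "norm (u (n + 2) x - u (n + 2) y) \<le> L * norm (x - y)" if "y \<in> {0..1}" for n y
      by (rule field_differentiable_bound[where S = "{0..1}" and f' = "u1 (n+2)"])
         (use that x u1L[of _ n] profileD(1)[OF prof, of "n+2"] in \<open>auto simp: is_C1_def\<close>)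
    have "norm (u (n + 2) x - u (n + 2) y) < e" if y: "y \<in> {0..1}" "norm (x - y) < e / (L + 1)" for n y
    proof -
      have "L * norm (x - y) \<le> L * (e / (L + 1))" using y L0 by (intro mult_left_mono) auto
      also have "\<dots> < e" using e L0 by (simp add: field_simps)
      finally show ?thesis using lip[OF y(1), of n] by linarith
    qed
    then show "\<exists>d. 0 < d \<and> (\<forall>n y. y \<in> {0..1} \<and> norm (x - y) < d \<longrightarrow> norm (u (n + 2) x - u (n + 2) y) < e)"
      using e L0 by (intro exI[of _ "e / (L + 1)"]) auto
  qed auto
  have "\<forall>n. c (k n + 2) \<in> {0..1}" using c(1) cle1 less_imp_le by auto
  then obtain cl r where r: "cl \<in> {0..1}" "strict_mono (r :: nat \<Rightarrow> nat)" "((\<lambda>n. c (k n + 2)) \<circ> r) \<longlonglongrightarrow> cl"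
    using seq_compactE[OF compact_imp_seq_compact[OF compact_Icc]] by metis
  define j where "j n = k (r n) + 2" for n
  have j_mono: "strict_mono j"
    using g(2) r(2) by (auto simp: j_def strict_mono_def)
  have climit: "(\<lambda>n. c (j n)) \<longlonglongrightarrow> cl" using r(3) by (simp add: j_def o_def)
  have clle: "cl \<le> c0" by (rule LIMSEQ_le_const2[OF climit]) (use cle in auto)
  have ulimit: "uniform_limit {0..1} (\<lambda>n. u (j n)) g sequentially"
  proof (rule uniform_limitI)
    fix e :: real assume "0 < e"
    then obtain N where N: "\<And>n x. n \<ge> N \<Longrightarrow> x \<in> {0..1} \<Longrightarrow> norm (u (k n + 2) x - g x) < e" using g(3) by blast
    have "\<forall>x\<in>{0..1}. dist (u (j n) x) (g x) < e" if "n \<ge> N" for n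
      using N[of "r n"] seq_suble[OF r(2), of n] that by (auto simp: j_def dist_norm)
    then show "\<forall>\<^sub>F n in sequentially. \<forall>x\<in>{0..1}. dist (u (j n) x) (g x) < e"
      unfolding eventually_sequentially by blast
  qed
  have ujB: "u (j n) s \<in> {0..B}" if "s \<in> {0..1}" for n s using uB[OF that, of "Suc (k (r n))"] by (simp add: j_def)
  have gl: "(\<lambda>n. u (j n) s) \<longlonglongrightarrow> g s" if "s \<in> {0..1}" for s using tendsto_uniform_limitI[OF ulimit that] .
  have gB: "g s \<in> {0..B}" if "s \<in> {0..1}" for s
    using LIMSEQ_le_const[OF gl[OF that], of 0] LIMSEQ_le_const2[OF gl[OF that], of B] ujB[OF that] by auto
  have gdec: "g t \<le> g s" if "0 \<le> s" "s \<le> t" "t \<le> 1" for s t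
    by (rule LIMSEQ_le[OF gl gl]) (use that profileD(3)[OF prof] in auto)
  have powlim: "uniform_limit {0..1} (\<lambda>n s. u (j n) s powr p) (\<lambda>s. g s powr p) sequentially" if "p > 0" for p
  proof (rule uniform_limit_compose_uniformly_continuous_on[OF ulimit])
    show "uniformly_continuous_on {0..B} (\<lambda>x. x powr p)"
      using that by (intro compact_uniformly_continuous continuous_on_powr_const) auto
  qed (use ujB in auto)
  have bdd: "bounded (f ` {0..1})" if "continuous_on {0..1} f" for f :: "real \<Rightarrow> real"
    using that by (intro compact_imp_bounded compact_continuous_image) auto
  have cgp: "continuous_on {0..1} (\<lambda>s. g s powr p)" if "p > 0" for p
    using continuous_on_powr_const[OF g(1)] gB that by auto
  have hlim: "uniform_limit {0..1} (\<lambda>n s. c (j n) * u (j n) s powr q) (\<lambda>s. cl * g s powr q) sequentially"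
  proof (rule uniform_lim_mult)
    show "uniform_limit {0..1} (\<lambda>n s. c (j n)) (\<lambda>s. cl) sequentially"
      using climit by (simp add: uniform_limit_iff tendsto_iff)
  qed (use powlim[of q] bdd cgp[of q] q1 in auto)
  have chg: "continuous_on {0..1} (\<lambda>s. cl * g s powr q)"
    using cgp[of q] q1 by (intro continuous_on_mult continuous_on_const) auto
  obtain f f1 where f: "solves (\<lambda>s. cl * g s powr q) f f1"
    "uniform_limit {0..1} (\<lambda>n. u (Suc (j n))) f sequentially"
    using solves_uniform_limit[OF sol hlim chg] by blast
  note wt_lim = uniform_limit_mult_continuous[OF cont_wt]
  have cf: "continuous_on {0..1} f" by (rule solvesD(4)[OF f(1)])
  have fg: "f s = g s" if s: "s \<in> {0..1}" for s
  proof -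
    define y where "y n s = u (Suc (j n)) s - u (j n) s" for n s
    have cy: "continuous_on {0..1} (y n)" for n
      unfolding y_def by (intro continuous_intros profileD(5)[OF prof])
    have cfg: "continuous_on {0..1} (\<lambda>s. f s - g s)" by (intro continuous_intros cf g(1))
    have "uniform_limit {0..1} y (\<lambda>s. f s - g s) sequentially"
      unfolding y_def by (rule uniform_limit_minus[OF f(2) ulimit])
    then have "uniform_limit {0..1} (\<lambda>n s. y n s * y n s) (\<lambda>s. (f s - g s) * (f s - g s)) sequentially"
      by (intro uniform_lim_mult bdd cfg)
    then have "(\<lambda>n. integral {0..1} (\<lambda>s. wt s * (y n s * y n s))) \<longlonglongrightarrow> integral {0..1} (\<lambda>s. wt s * ((f s - g s) * (f s - g s)))"
      using cfg cy cf g(1) by (intro uniform_limit_integral_Icc wt_lim continuous_intros) auto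
    moreover have "(\<lambda>n. integral {0..1} (\<lambda>s. wt s * (y n s * y n s))) \<longlonglongrightarrow> 0"
    proof (rule real_tendsto_sandwich[OF _ _ tendsto_const])
      define E where "E n = energy (u n) (u1 n)" for n
      have Edec: "E (Suc n) \<le> E n" for n
        using step[of n] form_sq_nonneg[of "\<lambda>s. u (Suc n) s - u n s" "\<lambda>s. u1 (Suc n) s - u1 n s"]
        by (simp add: E_def)
      have "decseq E" "\<forall>n. 0 \<le> E n" by (simp_all add: decseq_Suc_iff Edec) (simp add: E_def form_sq_nonneg)
      then obtain E' where E': "E \<longlonglongrightarrow> E'"
        by (rule decseq_convergent)
      have "(\<lambda>n. (E n - E (Suc n)) / \<mu>) \<longlonglongrightarrow> (E' - E') / \<mu>"
        using mu by (intro tendsto_intros E' LIMSEQ_Suc) auto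
      then have "((\<lambda>n. (E n - E (Suc n)) / \<mu>) \<circ> j) \<longlonglongrightarrow> (E' - E') / \<mu>"
        by (rule LIMSEQ_subseq_LIMSEQ[OF _ j_mono])
      then show "(\<lambda>n. (E (j n) - E (Suc (j n))) / \<mu>) \<longlonglongrightarrow> 0" by (simp add: o_def)
      show "\<forall>\<^sub>F n in sequentially. 0 \<le> integral {0..1} (\<lambda>s. wt s * (y n s * y n s))"
        by (intro always_eventually allI integral_nonneg integrable_continuous_interval continuous_intros cy)
           (use wt_nonneg in \<open>auto intro!: mult_nonneg_nonneg[OF _ zero_le_square]\<close>)
      have "\<mu> * integral {0..1} (\<lambda>s. wt s * (y n s * y n s)) \<le> E (j n) - E (Suc (j n))" for n
      proof -
        define z where "z s = u1 (Suc (j n)) s - u1 (j n) s" for s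
        have cz: "continuous_on {0..1} z" unfolding z_def by (intro continuous_intros profileD(6)[OF prof])
        have "integral {0..1} (\<lambda>s. \<mu> * (wt s * (y n s * y n s))) \<le> energy (y n) z"
          unfolding form_def
        proof (rule integral_le)
          fix s :: real assume s: "s \<in> {0..1}"
          have "0 \<le> pw s * (z s * z s)" using s pw_nonneg[of s] by (intro mult_nonneg_nonneg[OF _ zero_le_square]) auto
          then show "\<mu> * (wt s * (y n s * y n s)) \<le> pw s * z s * z s + \<mu> * wt s * y n s * y n s"
            by (simp add: mult.assoc)
        qed (intro integrable_continuous_interval continuous_intros cy cz)+
        also have "\<dots> \<le> E (j n) - E (Suc (j n))"
          using step[of "j n"] by (simp add: E_def y_def[abs_def] z_def[abs_def])
        finally show ?thesis by simp
      qed
      then show "\<forall>\<^sub>F n in sequentially. integral {0..1} (\<lambda>s. wt s * (y n s * y n s)) \<le> (E (j n) - E (Suc (j n))) / \<mu>"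
        using mu by (intro always_eventually) (auto simp: pos_le_divide_eq mult.commute)
    qed
    ultimately have "integral {0..1} (\<lambda>s. wt s * ((f s - g s) * (f s - g s))) = 0" by (rule LIMSEQ_unique)
    then have "(f s - g s) * (f s - g s) = 0"
      using wt_integral_zero[OF continuous_on_mult[OF cfg cfg] _ _ s] by simp
    then show ?thesis by simp
  qed
  have sg: "solves (\<lambda>s. cl * g s powr q) g f1"
    by (rule solves_cong[OF f(1)]) (use fg in auto)
  have mass: "integral {0..1} (\<lambda>s. wt s * g s powr (q+1)) = volume"
  proof (rule LIMSEQ_unique)
    show "(\<lambda>n. integral {0..1} (\<lambda>s. wt s * u (j n) s powr (q+1))) \<longlonglongrightarrow> integral {0..1} (\<lambda>s. wt s * g s powr (q+1))"
      using powlim[of "q+1"] cgp[of "q+1"] profileD(7)[OF prof, of "q+1"] q1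
      by (intro uniform_limit_integral_Icc wt_lim continuous_on_mult cont_wt) auto
    show "(\<lambda>n. integral {0..1} (\<lambda>s. wt s * u (j n) s powr (q+1))) \<longlonglongrightarrow> volume"
      using profileD(4)[OF prof] by simp
  qed
  show ?thesis
    by (rule that[OF sg _ _ _ gdec mass]) (use r(1) clle c0 gB in auto)
qed

text \<open>
  If \<open>g\<close> solves the equation with data \<open>cl g\<^sup>q\<close>, then \<open>a g\<close> with \<open>a\<^sup>q\<^sup>-\<^sup>1 = cl\<close> solves it with data \<open>(a g)\<^sup>q\<close>. A constant
  \<open>g\<close> would be 1 by its normalisation and force \<open>cl = 1\<close>.
\<close>
theorem exists_nonconstant_radial_solution:
  obtains U U1 U2 where
    "\<And>s. s \<in> {0..1} \<Longrightarrow> (U has_real_derivative U1 s) (at s within {0..1})"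
    "\<And>s. s \<in> {0..1} \<Longrightarrow> (U1 has_real_derivative U2 s) (at s within {0..1})"
    "continuous_on {0..1} U2"
    "\<And>s. s \<in> {0..1} \<Longrightarrow> s * (1-s) * U2 s + (2 - (real \<kappa> + 3) * s) * U1 s = \<mu> * (U s - U s powr q)"
    "\<And>s. s \<in> {0..1} \<Longrightarrow> 0 < U s"
    "\<And>s t. 0 \<le> s \<Longrightarrow> s \<le> t \<Longrightarrow> t \<le> 1 \<Longrightarrow> U t \<le> U s"
    "U 0 \<noteq> U 1"
proof -
  obtain cl g f1 where sg: "solves (\<lambda>s. cl * g s powr q) g f1" and cl_nonneg: "0 \<le> cl" and cl1: "cl < 1"
    and g0: "\<And>s. s \<in> {0..1} \<Longrightarrow> 0 \<le> g s" and gdec: "\<And>s t. 0 \<le> s \<Longrightarrow> s \<le> t \<Longrightarrow> t \<le> 1 \<Longrightarrow> g t \<le> g s"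
    and mass: "integral {0..1} (\<lambda>s. wt s * g s powr (q+1)) = volume"
    using power_iteration_limit by blast
  have nz: "\<not> (\<forall>s\<in>{0..1}. g s = 0)"
  proof
    assume "\<forall>s\<in>{0..1}. g s = 0"
    then have "integral {0..1} (\<lambda>s. wt s * g s powr (q+1)) = integral {0..1} (\<lambda>s::real. 0)"
      by (intro integral_cong) auto
    then show False using mass volume_pos by simp
  qed
  have cl0: "cl > 0"
  proof (rule ccontr)
    assume "\<not> cl > 0"
    then have "cl = 0" using cl_nonneg by auto
    then have "\<bar>g s\<bar> \<le> 0" if "s \<in> {0..1}" for s using solves_abs_le[OF sg _ that, of 0] by simp
    then show False using nz by auto
  qed
  have g1: "g 1 > 0"
  proof (rule ccontr)
    assume "\<not> g 1 > 0"
    then have "g 1 = 0" using g0[of 1] by auto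
    then have "g s = 0" if "s \<in> {0..1}" for s
      by (intro solves_zero_at_1[OF sg _ gdec _ that]) (use cl0 in auto)
    then show False using nz by auto
  qed
  have gpos: "g s > 0" if "s \<in> {0..1}" for s using gdec[of s 1] g1 that by auto
  have nonconst: "g 0 \<noteq> g 1"
  proof
    assume eq: "g 0 = g 1"
    have gc: "g s = g 1" if "s \<in> {0..1}" for s using gdec[of 0 s] gdec[of s 1] that eq by auto
    have "integral {0..1} (\<lambda>s. wt s * g s powr (q+1)) = integral {0..1} (\<lambda>s. wt s * g 1 powr (q+1))"
    proof (rule integral_cong)
      fix s :: real assume "s \<in> {0..1}"
      from gc[OF this] show "wt s * g s powr (q+1) = wt s * g 1 powr (q+1)" by (rule arg_cong)
    qed
    then have "g 1 powr (q+1) = 1" using mass volume_pos by (simp add: volume_def)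
    then have "(g 1 powr (q+1)) powr (1 / (q+1)) = 1" by simp
    then have "g 1 = 1" using g1 q1 by (simp add: powr_powr)
    have triv: "solves (\<lambda>_. cl) (\<lambda>_. cl) (\<lambda>_. 0)" by (simp add: solves_def)
    have "g s = 1" if "s \<in> {0..1}" for s using gc[OF that] \<open>g 1 = 1\<close> by (rule trans)
    then have "solves (\<lambda>_. cl) g f1" by (intro solves_cong[OF sg]) auto
    have "g 1 = cl" by (rule solves_unique(1)[OF \<open>solves (\<lambda>_. cl) g f1\<close> triv]) simp
    then have "cl = 1" using \<open>g 1 = 1\<close> by simp
    then show False using cl1 by simp
  qed
  define a where "a = cl powr (1 / (q-1))"
  have a: "a > 0" using cl0 by (simp add: a_def)
  have "a powr q = a powr ((q - 1) + 1)" by simp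
  also have "\<dots> = a powr (q - 1) * a powr 1" by (rule powr_add)
  also have "a powr (q - 1) = cl" using cl0 q1 by (simp add: a_def powr_powr)
  finally have aq: "a powr q = cl * a" using a by simp
  define U where "U = (\<lambda>s. a * g s)"
  define U1 where "U1 = (\<lambda>s. a * f1 s)"
  have "solves (\<lambda>s. a * (cl * g s powr q)) U U1"
    using solves_combine[OF sg sg, of a 0] by (simp add: U_def U1_def)
  then have sU: "solves (\<lambda>s. U s powr q) U U1"
    by (rule solves_cong) (use a g0 in \<open>auto simp: U_def powr_mult aq\<close>)
  have Upos: "U s > 0" if "s \<in> {0..1}" for s using gpos[OF that] a by (simp add: U_def)
  have dh: "((\<lambda>s. U s powr q) has_real_derivative q * U s powr (q-1) * U1 s) (at s within {0..1})" if s: "s \<in> {0..1}" for s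
    using DERIV_chain2[OF has_real_derivative_powr[OF Upos[OF s]] solvesD(1)[OF sU s], of q] .
  have ch: "continuous_on {0..1} (\<lambda>s. q * U s powr (q-1) * U1 s)"
    by (intro continuous_on_mult continuous_on_const continuous_on_powr_const solvesD(2,4)[OF sU])
       (use Upos q1 in \<open>auto intro: less_imp_le\<close>)
  obtain U2 where U2: "continuous_on {0..1} U2"
    "\<And>s. s \<in> {0..1} \<Longrightarrow> (U1 has_real_derivative U2 s) (at s within {0..1})"
    "\<And>s. s \<in> {0..1} \<Longrightarrow> s * (1-s) * U2 s + (2 - (real \<kappa> + 3) * s) * U1 s = \<mu> * (U s - U s powr q)"
    using solves_C2[OF sU dh ch] by blast
  show ?thesis
  proof (rule that[of U U1 U2])
    show "U t \<le> U s" if "0 \<le> s" "s \<le> t" "t \<le> 1" for s t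
      using gdec[OF that] a by (simp add: U_def)
    show "U 0 \<noteq> U 1" using nonconst a by (simp add: U_def)
  qed (use solvesD(1)[OF sU] U2 Upos in auto)
qed

end

section \<open>Quaternionic linear algebra\<close>

text \<open>
  The standard basis of the quaternions, indexed like the last coordinate of the chart vectors.
\<close>
definition qunit :: "4 \<Rightarrow> quat" where
  "qunit k = (if k = 1 then (1, 0) else if k = 2 then (\<i>, 0) else if k = 3 then (0, 1) else (0, \<i>))"

lemma qunit_simps: "qunit 1 = (1, 0)" "qunit 2 = (\<i>, 0)" "qunit 3 = (0, 1)" "qunit 4 = (0, \<i>)"
  by (simp_all add: qunit_def)

lemma sum_4: "sum f (UNIV :: 4 set) = f 1 + f 2 + f 3 + f 4"
  unfolding UNIV_4 by (simp add: add.assoc)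

lemma inner_quat: "(p :: quat) \<bullet> r = Re (fst p) * Re (fst r) + Im (fst p) * Im (fst r)
    + Re (snd p) * Re (snd r) + Im (snd p) * Im (snd r)"
  by (cases p; cases r) (simp add: inner_complex_def)

lemma inner_qunit: "qunit k \<bullet> qunit l = (if k = l then 1 else 0)"
  using exhaust_4[of k] exhaust_4[of l] by (auto simp: qunit_simps inner_quat)

lemma quat_expand: "(\<Sum>k\<in>UNIV. (p \<bullet> qunit k) *\<^sub>R qunit k) = p"
  by (cases p) (simp add: sum_4 qunit_simps inner_quat complex_eq_iff)

lemma quat_inner_expand: "(\<Sum>k\<in>UNIV. (p \<bullet> qunit k) * (r \<bullet> qunit k)) = p \<bullet> r"
  by (simp add: sum_4 qunit_simps inner_quat)

lemma qmult_inner_left: "qmult p r \<bullet> qmult p t = (p \<bullet> p) * (r \<bullet> t)"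
  by (simp add: inner_quat qmult_def algebra_simps)

lemma qmult_inner_right: "qmult r p \<bullet> qmult t p = (p \<bullet> p) * (r \<bullet> t)"
  by (simp add: inner_quat qmult_def algebra_simps)

lemma qmult_qunit_1: "qmult p (qunit 1) = p" "qmult (qunit 1) p = p"
  by (simp_all add: qmult_def qunit_simps)

lemma qmult_add_left: "qmult (p + r) t = qmult p t + qmult r t"
  and qmult_diff_left: "qmult (p - r) t = qmult p t - qmult r t"
  and qmult_scaleR_left: "qmult (c *\<^sub>R p) t = c *\<^sub>R qmult p t"
  and qmult_assoc: "qmult (qmult p r) t = qmult p (qmult r t)"
  by (simp_all add: qmult_def prod_eq_iff algebra_simps complex_eq_iff)

lemma qmult_zero_left: "qmult 0 t = 0"
  by (simp add: qmult_def zero_prod_def)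

lemma qmult_sum_left: "qmult (sum f A) t = (\<Sum>i\<in>A. qmult (f i) t)"
  by (induction A rule: infinite_finite_induct) (simp_all add: qmult_zero_left qmult_add_left)

lemma qcoord_expand: "qcoord y j = (\<Sum>k\<in>UNIV. y $ (j, k) *\<^sub>R qunit k)"
  by (simp add: qcoord_def sum_4 qunit_simps complex_eq_iff)

lemma qcoord_inner_qunit: "qcoord y j \<bullet> qunit k = y $ (j, k)"
  using exhaust_4[of k] by (auto simp: qcoord_def qunit_simps inner_quat)

lemma qcoord_linear: "qcoord (x + y) j = qcoord x j + qcoord y j" "qcoord (c *\<^sub>R x) j = c *\<^sub>R qcoord x j"
  by (simp_all add: qcoord_def complex_eq_iff)

lemma inner_qcoord: "y \<bullet> z = (\<Sum>j\<in>UNIV. qcoord y j \<bullet> qcoord z j)"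
proof -
  have "y \<bullet> z = (\<Sum>j\<in>UNIV. \<Sum>k\<in>UNIV. y $ (j, k) * z $ (j, k))"
    by (simp add: inner_vec_def sum.cartesian_product split_def)
  also have "\<dots> = (\<Sum>j\<in>UNIV. qcoord y j \<bullet> qcoord z j)"
  proof (rule sum.cong[OF refl])
    fix j
    show "(\<Sum>k\<in>UNIV. y $ (j, k) * z $ (j, k)) = qcoord y j \<bullet> qcoord z j"
      using quat_inner_expand[of "qcoord y j" "qcoord z j"] by (simp add: qcoord_inner_qunit)
  qed
  finally show ?thesis .
qed

definition of_quats :: "('n::finite \<Rightarrow> quat) \<Rightarrow> real ^ ('n \<times> 4)" where
  "of_quats f = (\<chi> p. f (fst p) \<bullet> qunit (snd p))"

lemma qcoord_of_quats: "qcoord (of_quats f) j = f j"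
  unfolding qcoord_expand by (simp add: of_quats_def quat_expand)

text \<open>
  Right multiplication of all affine coordinates by a basis quaternion. The vectors \<open>rmul k y\<close> span the
  quaternionic line through \<open>y\<close>; they are the directions in which the metric differs from a multiple of
  the Euclidean one.
\<close>
definition rmul :: "4 \<Rightarrow> real ^ ('n::finite \<times> 4) \<Rightarrow> real ^ ('n \<times> 4)" where
  "rmul k y = of_quats (\<lambda>j. qmult (qcoord y j) (qunit k))"

lemma qcoord_rmul: "qcoord (rmul k y) j = qmult (qcoord y j) (qunit k)"
  by (simp add: rmul_def qcoord_of_quats)

lemma of_quats_qcoord: "of_quats (qcoord y) = y"
  by (simp add: of_quats_def qcoord_inner_qunit vec_eq_iff)

lemma rmul_1: "rmul 1 y = y"
  by (simp add: rmul_def qmult_qunit_1 of_quats_qcoord)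

lemma linear_rmul: "linear (rmul k)"
  by (intro linearI) (simp_all add: rmul_def of_quats_def vec_eq_iff qcoord_linear qmult_add_left qmult_scaleR_left inner_add_left)

lemma inner_rmul: "rmul k y \<bullet> rmul l y = (if k = l then y \<bullet> y else 0)"
proof -
  have "rmul k y \<bullet> rmul l y = (\<Sum>j\<in>UNIV. (qcoord y j \<bullet> qcoord y j) * (qunit k \<bullet> qunit l))"
    by (simp add: inner_qcoord[of "rmul k y"] qcoord_rmul qmult_inner_left)
  then show ?thesis by (simp add: inner_qunit inner_qcoord[symmetric])
qed

lemma inner_rmul_self: "k \<noteq> 1 \<Longrightarrow> rmul k y \<bullet> y = 0"
  using inner_rmul[of k y 1] by (simp add: rmul_1)

section \<open>The metric in an affine chart\<close>

text \<open>
  The homogeneous coordinate that holds the \<open>j\<close>-th affine coordinate of the chart \<open>a\<close>. All charts are treated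
  at once by reindexing along this bijection onto the indices other than \<open>a\<close>.
\<close>
definition chart_index :: "'n option \<Rightarrow> 'n \<Rightarrow> 'n option" where
  "chart_index a j = (if a = Some j then None else Some j)"

lemma bij_chart_index: "bij_betw (chart_index a) UNIV (UNIV - {a})"
proof (rule bij_betwI')
  fix y assume "y \<in> UNIV - {a}"
  then show "\<exists>x\<in>UNIV. y = chart_index a x"
    by (intro bexI[of _ "case y of None \<Rightarrow> the a | Some j \<Rightarrow> j"])
       (auto simp: chart_index_def split: option.splits)
qed (auto simp: chart_index_def split: if_splits)

lemma sum_chart_index: "sum f (UNIV :: 'n::finite option set) = f a + (\<Sum>j\<in>UNIV. f (chart_index a j))"
proof -
  have "sum f UNIV = f a + sum f (UNIV - {a})" by (simp add: sum.remove)
  also have "sum f (UNIV - {a}) = (\<Sum>j\<in>UNIV. f (chart_index a j))"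
    by (rule sum.reindex_bij_betw[OF bij_chart_index, symmetric])
  finally show ?thesis .
qed

lemma affine_lift_at: "affine_lift a y $ a = qone"
  and affine_lift_chart_index: "affine_lift a y $ chart_index a j = qcoord y j"
  by (auto simp: affine_lift_def chart_index_def split: option.splits)

definition affine_lin :: "'n option \<Rightarrow> real ^ ('n::finite \<times> 4) \<Rightarrow> quat ^ ('n option)" where
  "affine_lin a y = affine_lift a y - affine_lift a 0"

lemma qcoord_0: "qcoord 0 j = 0"
  by (simp add: qcoord_def zero_prod_def complex_eq_iff Complex_eq_0)

lemma affine_lin_at: "affine_lin a y $ a = 0"
  and affine_lin_chart_index: "affine_lin a y $ chart_index a j = qcoord y j"
  by (simp_all add: affine_lin_def affine_lift_at affine_lift_chart_index qcoord_0)

lemma chart_index_cases: obtains "i = a" | j where "i = chart_index a j"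
  using bij_chart_index[of a] by (auto simp: bij_betw_def)

lemma vec_eq_chart: "x $ a = z $ a \<Longrightarrow> (\<And>j. x $ chart_index a j = z $ chart_index a j) \<Longrightarrow> x = z"
  by (metis chart_index_cases vec_eq_iff)

lemma linear_affine_lin: "linear (affine_lin a)"
  by (intro linearI; rule vec_eq_chart[of _ a])
     (simp_all add: affine_lin_at affine_lin_chart_index qcoord_linear)

lemma affine_lift_eq: "affine_lift a y = affine_lift a 0 + affine_lin a y"
  by (simp add: affine_lin_def)

lemma inner_affine_lin: "affine_lin a y \<bullet> affine_lin a z = y \<bullet> z"
  by (simp add: inner_vec_def[of "affine_lin a y"] sum_chart_index[of _ a] affine_lin_at affine_lin_chart_index inner_qcoord)

lemma inner_affine_lin_scale: "affine_lin a z \<bullet> qscale (affine_lift a y) (qunit k) = z \<bullet> rmul k y"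
  by (simp add: inner_vec_def[of "affine_lin a z"] sum_chart_index[of _ a] affine_lin_at affine_lin_chart_index
        affine_lift_chart_index qscale_def inner_qcoord qcoord_rmul)

lemma inner_affine_lift: "affine_lift a y \<bullet> affine_lift a y = 1 + y \<bullet> y"
  by (simp add: inner_vec_def[of "affine_lift a y"] sum_chart_index[of _ a] affine_lift_at
        affine_lift_chart_index inner_qcoord) (simp add: qone_def inner_quat)

lemma inner_qscale: "qscale x (qunit k) \<bullet> qscale x (qunit l) = (if k = l then x \<bullet> x else 0)"
proof -
  have "qscale x (qunit k) \<bullet> qscale x (qunit l) = (\<Sum>i\<in>UNIV. (x $ i \<bullet> x $ i) * (qunit k \<bullet> qunit l))"
    unfolding inner_vec_def qscale_def by (simp add: qmult_inner_left)
  then show ?thesis by (simp add: inner_qunit inner_vec_def)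
qed

lemma qscale_1: "qscale x (qunit 1) = x"
  by (simp add: qscale_def qmult_qunit_1)

lemma sum_qimag_units: "sum f qimag_units = f (qunit 2) + f (qunit 3) + f (qunit 4)"
  by (simp add: qimag_units_def qunit_simps complex_eq_iff add.assoc)

lemma orthonormal_complement_inner:
  fixes v w :: "'a::real_inner" and b :: "'k::finite \<Rightarrow> 'a"
  assumes "\<And>k l. b k \<bullet> b l = (if k = l then 1 else 0)"
  shows "(v - (\<Sum>k\<in>UNIV. (v \<bullet> b k) *\<^sub>R b k)) \<bullet> (w - (\<Sum>k\<in>UNIV. (w \<bullet> b k) *\<^sub>R b k))
     = v \<bullet> w - (\<Sum>k\<in>UNIV. (v \<bullet> b k) * (w \<bullet> b k))"
proof -
  have "(\<Sum>k\<in>UNIV. (v \<bullet> b k) *\<^sub>R b k) \<bullet> (\<Sum>k\<in>UNIV. (w \<bullet> b k) *\<^sub>R b k) = (\<Sum>k\<in>UNIV. (v \<bullet> b k) * (w \<bullet> b k))"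
    by (simp add: inner_sum_left inner_sum_right assms if_distrib sum.delta mult.commute cong: if_cong)
  moreover have "v \<bullet> (\<Sum>k\<in>UNIV. (w \<bullet> b k) *\<^sub>R b k) = (\<Sum>k\<in>UNIV. (v \<bullet> b k) * (w \<bullet> b k))"
    by (simp add: inner_sum_right mult.commute)
  moreover have "(\<Sum>k\<in>UNIV. (v \<bullet> b k) *\<^sub>R b k) \<bullet> w = (\<Sum>k\<in>UNIV. (v \<bullet> b k) * (w \<bullet> b k))"
    unfolding inner_sum_left inner_scaleR_left by (simp add: inner_commute[of "b _" w])
  ultimately show ?thesis by (simp only: inner_diff_left inner_diff_right)
qed

definition \<rho> :: "'a::real_inner \<Rightarrow> real" where "\<rho> y = 1 + y \<bullet> y"

lemma rho_pos: "\<rho> y > 0"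
  by (simp add: \<rho>_def add_pos_nonneg)

lemma norm_affine_lift: "norm (affine_lift a y) = sqrt (\<rho> y)"
  by (simp add: norm_eq_sqrt_inner inner_affine_lift \<rho>_def)

lemma sphere_section_deriv:
  "(sphere_section a has_derivative
     (\<lambda>\<xi>. (1 / sqrt (\<rho> y)) *\<^sub>R (affine_lin a \<xi> - ((\<xi> \<bullet> y) / \<rho> y) *\<^sub>R affine_lift a y))) (at y)"
proof -
  have bl: "bounded_linear (affine_lin a)" using linear_affine_lin by (rule linear_conv_bounded_linear[THEN iffD1])
  have dl: "(affine_lift a has_derivative affine_lin a) (at y)"
  proof -
    have "((\<lambda>y. affine_lift a 0 + affine_lin a y) has_derivative (\<lambda>\<xi>. 0 + affine_lin a \<xi>)) (at y)"
      by (intro has_derivative_add has_derivative_const bounded_linear_imp_has_derivative[OF bl])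
    moreover have "(\<lambda>y. affine_lift a 0 + affine_lin a y) = affine_lift a"
      by (rule ext) (rule affine_lift_eq[symmetric])
    ultimately show ?thesis by simp
  qed
  have dr: "(\<rho> has_derivative (\<lambda>\<xi>. 2 * (y \<bullet> \<xi>))) (at y)"
    unfolding \<rho>_def[abs_def] by (auto intro!: derivative_eq_intros simp: inner_commute)
  have "((\<lambda>t. inverse (sqrt t)) has_real_derivative - (inverse (sqrt (\<rho> y)) * inverse (\<rho> y) / 2)) (at (\<rho> y))"
  proof -
    have "- (inverse (sqrt (\<rho> y)) * (inverse (sqrt (\<rho> y)) / 2) * inverse (sqrt (\<rho> y)))
        = - (inverse (sqrt (\<rho> y)) * inverse (\<rho> y) / 2)"
      using rho_pos[of y] by (simp add: mult.assoc[symmetric] real_sqrt_mult_self flip: inverse_mult_distrib)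
    then show ?thesis
      using DERIV_inverse_fun[OF DERIV_real_sqrt[OF rho_pos[of y]]] rho_pos[of y] by (simp add: mult_ac)
  qed
  from DERIV_compose_FDERIV[OF this dr]
  have "((\<lambda>y. inverse (sqrt (\<rho> y))) has_derivative (\<lambda>\<xi>. - (inverse (sqrt (\<rho> y)) * (y \<bullet> \<xi>) * inverse (\<rho> y)))) (at y)"
    by (simp add: mult_ac)
  from has_derivative_scaleR[OF this dl] show ?thesis
    unfolding sphere_section_def[abs_def] norm_affine_lift
    by (simp add: algebra_simps inner_commute divide_inverse)
qed

text \<open>
  The derivative of the section removes the component along \<open>x\<close>, and the horizontal part removes those along
  \<open>x i, x j, x k\<close>. What remains is the component of the derivative of the lift orthogonal to the quaternionic
  line through \<open>x\<close>.
\<close>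
lemma fs_metric_formula:
  "fs_metric a y $ i $ j = (1 / \<rho> y) * ((if i = j then 1 else 0) - (1 / \<rho> y) * (\<Sum>k\<in>UNIV. rmul k y $ i * rmul k y $ j))"
proof -
  define N where "N = sqrt (\<rho> y)"
  have N: "N > 0" "N * N = \<rho> y" using rho_pos[of y] by (auto simp: N_def)
  define l where "l = affine_lift a y"
  define x where "x = (1 / N) *\<^sub>R l"
  have xs: "sphere_section a y = x"
    by (simp add: sphere_section_def x_def N_def l_def norm_affine_lift divide_inverse)
  have xx: "x \<bullet> x = 1"
    using N(1) by (simp add: x_def l_def inner_affine_lift \<rho>_def[symmetric] N(2)[symmetric])
  define b where "b k = qscale x (qunit k)" for k
  have b: "b k \<bullet> b l = (if k = l then 1 else 0)" for k l by (simp add: b_def inner_qscale xx)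
  have b1: "b 1 = x" by (simp add: b_def qscale_1)
  have qs: "qscale x e = (1 / N) *\<^sub>R qscale l e" for e
    by (simp add: qscale_def x_def vec_eq_iff qmult_scaleR_left)
  have lb: "affine_lin a \<xi> \<bullet> b k = (1 / N) * (\<xi> \<bullet> rmul k y)" for \<xi> k
    by (simp add: b_def qs l_def inner_affine_lin_scale)
  have hor: "horizontal_part (sphere_section a y) (frechet_derivative (sphere_section a) (at y) \<xi>)
      = (1 / N) *\<^sub>R (affine_lin a \<xi> - (\<Sum>k\<in>UNIV. (affine_lin a \<xi> \<bullet> b k) *\<^sub>R b k))" for \<xi>
  proof -
    have "frechet_derivative (sphere_section a) (at y) =
      (\<lambda>\<xi>. (1 / N) *\<^sub>R (affine_lin a \<xi> - ((\<xi> \<bullet> y) / \<rho> y) *\<^sub>R l))"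
      unfolding N_def l_def by (rule frechet_derivative_at[OF sphere_section_deriv, symmetric])
    moreover have "((\<xi> \<bullet> y) / \<rho> y) *\<^sub>R l = (affine_lin a \<xi> \<bullet> b 1) *\<^sub>R b 1"
      unfolding lb unfolding b1 x_def by (simp add: rmul_1 N(2)[symmetric])
    ultimately have D: "frechet_derivative (sphere_section a) (at y) \<xi> =
      (1 / N) *\<^sub>R (affine_lin a \<xi> - (affine_lin a \<xi> \<bullet> b 1) *\<^sub>R b 1)" by simp
    show ?thesis
      unfolding D horizontal_part_def xs sum_qimag_units b_def[symmetric]
      by (simp add: sum_4 inner_diff_left b algebra_simps)
  qed
  have "fs_metric a y $ i $ j = (1 / N) * ((1 / N) *
     (axis i (1::real) \<bullet> axis j (1::real) - (\<Sum>k\<in>UNIV. (affine_lin a (axis i 1) \<bullet> b k) * (affine_lin a (axis j 1) \<bullet> b k))))"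
    unfolding fs_metric_def Let_def hor
    by (simp only: vec_lambda_beta inner_scaleR_left inner_scaleR_right orthonormal_complement_inner[OF b] inner_affine_lin)
  also have "\<dots> = (1 / N) * ((1 / N) *
     (axis i (1::real) \<bullet> axis j (1::real) - (\<Sum>k\<in>UNIV. (1 / N) * (axis i 1 \<bullet> rmul k y) * ((1 / N) * (axis j 1 \<bullet> rmul k y)))))"
    by (simp only: lb)
  also have "\<dots> = (1 / (N * N)) * (axis i (1::real) \<bullet> axis j (1::real) - (1 / (N * N)) * (\<Sum>k\<in>UNIV. rmul k y $ i * rmul k y $ j))"
    by (simp add: inner_axis' sum_distrib_left mult_ac)
  finally show ?thesis by (simp add: N(2) inner_axis_axis)
qed

section \<open>Determinant and inverse of the metric\<close>

text \<open>
  An orthogonal map that moves a multiple of a basis vector to \<open>r\<close> makes the matrix diagonal.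
\<close>
lemma det_rank_one_update:
  fixes r :: "real ^ 'n"
  shows "det (\<chi> i j. (if i = j then 1 else 0) - c * (r $ i * r $ j)) = 1 - c * (r \<bullet> r)"
proof -
  define k :: 'n where "k = undefined"
  have "norm (axis k (norm r)) = norm r" by (simp add: norm_eq_sqrt_inner inner_axis_axis)
  then obtain f where f: "orthogonal_transformation f" "f (axis k (norm r)) = r"
    by (rule orthogonal_transformation_exists)
  define A where "A = matrix f"
  have A: "orthogonal_matrix A" using f(1) by (simp add: A_def orthogonal_transformation_matrix)
  have Ak: "A $ i $ k * norm r = r $ i" for i
  proof -
    have "A *v axis k (norm r) = r" using f orthogonal_transformation_linear[OF f(1)]
      by (simp add: A_def matrix_vector_mul)
    then have "(A *v axis k (norm r)) $ i = r $ i" by simp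
    then show ?thesis by (simp add: matrix_vector_mult_def axis_def if_distrib cong: if_cong)
  qed
  define Dg :: "real^'n^'n" where "Dg = (\<chi> i j. if i = j then (if i = k then 1 - c * (r \<bullet> r) else 1) else 0)"
  have "(A ** Dg ** transpose A) $ i $ j = (if i = j then 1 else 0) - c * (r $ i * r $ j)" for i j
  proof -
    have orth: "(\<Sum>l\<in>UNIV. A $ i $ l * A $ j $ l) = (if i = j then 1 else 0)"
    proof -
      have "(A ** transpose A) $ i $ j = mat 1 $ i $ j" using A by (simp add: orthogonal_matrix_def)
      then show ?thesis by (simp add: matrix_matrix_mult_def transpose_def mat_def)
    qed
    have "(A ** Dg ** transpose A) $ i $ j = (\<Sum>l\<in>UNIV. (A $ i $ l * (if l = k then 1 - c * (r \<bullet> r) else 1)) * A $ j $ l)"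
      by (simp add: matrix_matrix_mult_def transpose_def Dg_def if_distrib[of "\<lambda>x. _ * x"] sum.delta cong: if_cong)
    also have "\<dots> = (\<Sum>l\<in>UNIV. A $ i $ l * A $ j $ l - (if l = k then c * (r \<bullet> r) * (A $ i $ k * A $ j $ k) else 0))"
      by (intro sum.cong) (auto simp: algebra_simps)
    also have "\<dots> = (if i = j then 1 else 0) - c * ((A $ i $ k * norm r) * (A $ j $ k * norm r))"
      by (simp add: sum_subtractf orth power2_norm_eq_inner[symmetric] power2_eq_square mult_ac)
    finally show "(A ** Dg ** transpose A) $ i $ j = (if i = j then 1 else 0) - c * (r $ i * r $ j)"
      by (simp only: Ak)
  qed
  then have "(\<chi> i j. (if i = j then 1 else 0) - c * (r $ i * r $ j)) = A ** Dg ** transpose A"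
    by (simp add: vec_eq_iff)
  then have "det (\<chi> i j. (if i = j then 1 else 0) - c * (r $ i * r $ j)) = det A * det Dg * det A"
    by (simp add: det_mul det_transpose)
  also have "\<dots> = det Dg" using det_orthogonal_matrix[OF A] by auto
  also have "det Dg = (\<Prod>i\<in>UNIV. Dg $ i $ i)" by (rule det_diagonal) (simp add: Dg_def)
  also have "\<dots> = 1 - c * (r \<bullet> r)" by (simp add: Dg_def prod.delta)
  finally show ?thesis .
qed

text \<open>
  For orthogonal vectors the matrix is the product of its rank one updates.
\<close>
lemma det_orthogonal_update:
  fixes r :: "'k \<Rightarrow> real ^ 'n"
  assumes "finite S" "\<And>k l. k \<in> S \<Longrightarrow> l \<in> S \<Longrightarrow> k \<noteq> l \<Longrightarrow> r k \<bullet> r l = 0"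
  shows "det (\<chi> i j. (if i = j then 1 else 0) - c * (\<Sum>k\<in>S. r k $ i * r k $ j)) = (\<Prod>k\<in>S. 1 - c * (r k \<bullet> r k))"
  using assms
proof (induction S)
  case empty
  have "(\<chi> i j. (if i = j then 1 else 0) - c * (\<Sum>k\<in>{}. r k $ i * r k $ j)) = (mat 1 :: real^'n^'n)"
    by (simp add: mat_def)
  then show ?case by simp
next
  case (insert e S)
  define M where "M = (\<chi> i j. (if i = j then 1 else 0) - c * (\<Sum>k\<in>S. r k $ i * r k $ j))"
  define L where "L = (\<chi> i j. (if i = j then 1 else 0) - c * (r e $ i * r e $ j))"
  have "(M ** L) $ i $ j = (if i = j then 1 else 0) - c * (\<Sum>k\<in>insert e S. r k $ i * r k $ j)" for i j
  proof -
    have z: "(\<Sum>l\<in>UNIV. (\<Sum>k\<in>S. r k $ i * r k $ l) * r e $ l) = 0"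
    proof -
      have "(\<Sum>l\<in>UNIV. (\<Sum>k\<in>S. r k $ i * r k $ l) * r e $ l) = (\<Sum>k\<in>S. r k $ i * (r k \<bullet> r e))"
        by (simp add: inner_vec_def sum_distrib_left sum_distrib_right mult_ac) (rule sum.swap)
      also have "\<dots> = 0" using insert by (intro sum.neutral) auto
      finally show ?thesis .
    qed
    have "(M ** L) $ i $ j = (\<Sum>l\<in>UNIV. M $ i $ l * L $ l $ j)" by (simp add: matrix_matrix_mult_def)
    also have "\<dots> = (\<Sum>l\<in>UNIV. (if l = j then (if i = j then 1 else 0) - c * (\<Sum>k\<in>S. r k $ i * r k $ j) else 0)
        - (if l = i then c * (r e $ i * r e $ j) else 0) + c * c * r e $ j * ((\<Sum>k\<in>S. r k $ i * r k $ l) * r e $ l))"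
      by (intro sum.cong refl) (auto simp: M_def L_def algebra_simps)
    also have "\<dots> = (if i = j then 1 else 0) - c * (\<Sum>k\<in>S. r k $ i * r k $ j) - c * (r e $ i * r e $ j)"
      by (simp add: sum.distrib sum_subtractf sum_distrib_left[symmetric] z)
    finally show "(M ** L) $ i $ j = (if i = j then 1 else 0) - c * (\<Sum>k\<in>insert e S. r k $ i * r k $ j)"
      using insert by (simp add: algebra_simps)
  qed
  then have "(\<chi> i j. (if i = j then 1 else 0) - c * (\<Sum>k\<in>insert e S. r k $ i * r k $ j)) = M ** L"
    by (simp add: vec_eq_iff)
  then have "det (\<chi> i j. (if i = j then 1 else 0) - c * (\<Sum>k\<in>insert e S. r k $ i * r k $ j)) = det M * det L"
    by (simp only: det_mul)
  then show ?case
    using insert by (simp add: M_def L_def det_rank_one_update)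
qed

lemma det_cmul: "det (\<chi> i j. c * B $ i $ j) = c ^ CARD('n) * det (B :: real^'n^'n)"
proof -
  have "det (\<chi> i. c *s (B $ i)) = (\<Prod>i\<in>(UNIV::'n set). c) * det (\<chi> i. B $ i)"
    by (rule det_rows_mul)
  moreover have "(\<chi> i. c *s (B $ i)) = (\<chi> i j. c * B $ i $ j)" by (simp add: vec_eq_iff)
  ultimately show ?thesis by simp
qed

lemma sqrt_det_fs_metric:
  "sqrt (det (fs_metric a (y :: real ^ ('n::finite \<times> 4)))) = 1 / \<rho> y ^ (2 * CARD('n) + 2)"
proof -
  define B where "B = (\<chi> i j. (if i = j then 1 else 0) - (1 / \<rho> y) * (\<Sum>k\<in>UNIV. rmul k y $ i * rmul k y $ j))"
  have "fs_metric a y = (\<chi> i j. (1 / \<rho> y) * B $ i $ j)"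
    by (simp add: vec_eq_iff fs_metric_formula B_def)
  then have "det (fs_metric a y) = (1 / \<rho> y) ^ CARD('n \<times> 4) * det B"
    by (simp only: det_cmul)
  also have "det B = (\<Prod>k\<in>(UNIV::4 set). 1 - (1 / \<rho> y) * (rmul k y \<bullet> rmul k y))"
    unfolding B_def by (rule det_orthogonal_update) (auto simp: inner_rmul)
  also have "\<dots> = (1 / \<rho> y) ^ 4"
  proof -
    have "1 - (1 / \<rho> y) * (y \<bullet> y) = 1 / \<rho> y" using rho_pos[of y] by (simp add: \<rho>_def field_simps)
    then show ?thesis by (simp add: inner_rmul)
  qed
  also have "(1 / \<rho> y) ^ CARD('n \<times> 4) * (1 / \<rho> y) ^ 4 = ((1 / \<rho> y) ^ (2 * CARD('n) + 2))\<^sup>2"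
  proof -
    have "CARD('n \<times> 4) + 4 = (2 * CARD('n) + 2) * 2" by simp
    then show ?thesis by (simp only: power_add[symmetric] power_mult[symmetric])
  qed
  finally have d: "det (fs_metric a y) = ((1 / \<rho> y) ^ (2 * CARD('n) + 2))\<^sup>2" .
  show ?thesis unfolding d real_sqrt_abs using rho_pos[of y] by (simp add: power_one_over)
qed

lemma matrix_inv_fs_metric:
  "matrix_inv (fs_metric a y) = (\<chi> i j. \<rho> y * ((if i = j then 1 else 0) + (\<Sum>k\<in>UNIV. rmul k y $ i * rmul k y $ j)))"
proof -
  define G where "G = (\<chi> i j. \<rho> y * ((if i = j then 1 else 0) + (\<Sum>k\<in>UNIV. rmul k y $ i * rmul k y $ j)))"
  define S where "S i j = (\<Sum>k\<in>UNIV. rmul k y $ i * rmul k y $ j)" for i j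
  have SS: "(\<Sum>l\<in>UNIV. S i l * S l j) = (y \<bullet> y) * S i j" for i j
  proof -
    have "(\<Sum>l\<in>UNIV. S i l * S l j) = (\<Sum>k\<in>UNIV. \<Sum>m\<in>UNIV. rmul k y $ i * (rmul k y \<bullet> rmul m y) * rmul m y $ j)"
      unfolding S_def sum_product
      by (subst sum.swap, rule sum.cong[OF refl], subst sum.swap)
         (simp add: inner_vec_def sum_distrib_left sum_distrib_right mult_ac)
    then show ?thesis
      by (simp add: inner_rmul S_def if_distrib if_distribR sum_distrib_left mult_ac cong: if_cong)
  qed
  have "(fs_metric a y ** G) $ i $ j = mat 1 $ i $ j" for i j
  proof -
    have "(fs_metric a y ** G) $ i $ j = (\<Sum>l\<in>UNIV. ((if i = l then 1 else 0) - (1 / \<rho> y) * S i l) * ((if l = j then 1 else 0) + S l j))"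
      using rho_pos[of y] by (simp add: matrix_matrix_mult_def fs_metric_formula G_def S_def mult_ac)
    also have "\<dots> = (\<Sum>l\<in>UNIV. (if l = i then (if i = j then 1 else 0) + S i j else 0) - (if l = j then (1 / \<rho> y) * S i j else 0)
        - (1 / \<rho> y) * (S i l * S l j))"
      by (intro sum.cong) (auto simp: algebra_simps)
    also have "\<dots> = (if i = j then 1 else 0) + S i j - (1 / \<rho> y) * S i j - (1 / \<rho> y) * ((y \<bullet> y) * S i j)"
    proof -
      have "(\<Sum>l\<in>UNIV. (1 / \<rho> y) * (S i l * S l j)) = (1 / \<rho> y) * ((y \<bullet> y) * S i j)"
        by (simp only: sum_distrib_left[symmetric] SS)
      then show ?thesis by (simp add: sum_subtractf)
    qed
    also have "\<dots> = (if i = j then 1 else 0) + S i j * (1 - (1 / \<rho> y) * (1 + y \<bullet> y))"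
      by (simp add: algebra_simps)
    also have "\<dots> = (if i = j then 1 else 0)" using rho_pos[of y] by (simp add: \<rho>_def)
    finally show "(fs_metric a y ** G) $ i $ j = mat 1 $ i $ j" by (simp add: mat_def)
  qed
  then have right: "fs_metric a y ** G = mat 1" by (simp add: vec_eq_iff)
  have left: "G ** fs_metric a y = mat 1" by (rule iffD1[OF matrix_left_right_inverse right])
  have "fs_metric a y ** matrix_inv (fs_metric a y) = mat 1 \<and> matrix_inv (fs_metric a y) ** fs_metric a y = mat 1"
    unfolding matrix_inv_def
    by (rule someI[where P = "\<lambda>B. fs_metric a y ** B = mat 1 \<and> B ** fs_metric a y = mat 1" and x = G])
       (use left right in simp)
  then have "matrix_inv (fs_metric a y) ** fs_metric a y ** G = G" by (simp add: matrix_mul_lid)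
  then have "matrix_inv (fs_metric a y) ** (fs_metric a y ** G) = G" by (simp only: matrix_mul_assoc)
  then have "matrix_inv (fs_metric a y) = G" by (simp only: right matrix_mul_rid)
  then show ?thesis by (simp only: G_def)
qed

section \<open>Differentiability in coordinates\<close>

lemma partial_eq: "(f has_derivative f') (at x) \<Longrightarrow> partial i f x = f' (axis i 1)"
  unfolding partial_def by (simp add: frechet_derivative_at[symmetric])

lemma C1_deriv: "C1 f \<Longrightarrow> (f has_derivative frechet_derivative f (at x)) (at x)"
  unfolding C1_def by (simp add: frechet_derivative_works[symmetric])

lemma C1_continuous: "C1 f \<Longrightarrow> continuous_on UNIV f"
  by (meson C1_def continuous_on_eq_continuous_within differentiable_imp_continuous_within)

lemma C1_partial_continuous: "C1 f \<Longrightarrow> continuous_on UNIV (partial i f)"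
  by (simp add: C1_def)

lemma C1I:
  assumes "\<And>x. (f has_derivative f' x) (at x)" "\<And>i. continuous_on UNIV (\<lambda>x. f' x (axis i 1))"
  shows "C1 f" "partial i f = (\<lambda>x. f' x (axis i 1))"
proof -
  show p: "partial i f = (\<lambda>x. f' x (axis i 1))" for i
    using partial_eq[OF assms(1)] by blast
  show "C1 f" unfolding C1_def p using assms differentiableI by blast
qed

lemma frechet_axis: "frechet_derivative f (at x) (axis i 1) = partial i f x"
  by (simp add: partial_def)

lemma C1_const: "C1 (\<lambda>x. c)" and partial_const: "partial i (\<lambda>x. c) = (\<lambda>x. 0)"
  by (rule C1I[where f' = "\<lambda>x h. 0"]; simp)+

lemma C1_inner: "C1 (\<lambda>x. v \<bullet> x)" and partial_inner: "partial i (\<lambda>x. v \<bullet> x) = (\<lambda>x. v $ i)"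
  using C1I[OF bounded_linear_imp_has_derivative[OF bounded_linear_inner_right[of v]]]
  by (simp_all add: inner_axis)

lemma C1_add: "C1 f \<Longrightarrow> C1 g \<Longrightarrow> C1 (\<lambda>x. f x + g x)"
  and partial_add: "C1 f \<Longrightarrow> C1 g \<Longrightarrow> partial i (\<lambda>x. f x + g x) = (\<lambda>x. partial i f x + partial i g x)"
proof -
  assume fg: "C1 f" "C1 g"
  note I = C1I[OF has_derivative_add[OF C1_deriv[OF fg(1)] C1_deriv[OF fg(2)]]]
  have "continuous_on UNIV (\<lambda>x. partial i f x + partial i g x)" for i
    by (intro continuous_on_add C1_partial_continuous fg)
  then show "C1 (\<lambda>x. f x + g x)" "partial i (\<lambda>x. f x + g x) = (\<lambda>x. partial i f x + partial i g x)"
    using I by (simp_all add: frechet_axis)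
qed

lemma C1_mult: "C1 f \<Longrightarrow> C1 g \<Longrightarrow> C1 (\<lambda>x. f x * g x)"
  and partial_mult: "C1 f \<Longrightarrow> C1 g \<Longrightarrow> partial i (\<lambda>x. f x * g x) = (\<lambda>x. f x * partial i g x + partial i f x * g x)"
proof -
  assume fg: "C1 f" "C1 g"
  note I = C1I[OF has_derivative_mult[OF C1_deriv[OF fg(1)] C1_deriv[OF fg(2)]]]
  have "continuous_on UNIV (\<lambda>x. f x * partial i g x + partial i f x * g x)" for i
    by (intro continuous_on_add continuous_on_mult C1_partial_continuous C1_continuous fg)
  then show "C1 (\<lambda>x. f x * g x)" "partial i (\<lambda>x. f x * g x) = (\<lambda>x. f x * partial i g x + partial i f x * g x)"
    using I by (simp_all add: frechet_axis)
qed

lemma C1_comp: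
  assumes U: "\<And>t. t \<in> S \<Longrightarrow> (U has_real_derivative U' t) (at t within S)" "continuous_on S U'"
    and s: "C1 s" "\<And>x. s x \<in> S"
  shows "C1 (\<lambda>x. U (s x))" "partial i (\<lambda>x. U (s x)) = (\<lambda>x. U' (s x) * partial i s x)"
proof -
  have d: "((\<lambda>x. U (s x)) has_derivative (\<lambda>h. U' (s x) * frechet_derivative s (at x) h)) (at x)" for x
  proof -
    have "(U has_derivative (*) (U' (s x))) (at (s x) within s ` UNIV)"
      using has_derivative_subset[OF U(1)[OF s(2), unfolded has_field_derivative_def]] s(2) by blast
    from diff_chain_within[OF C1_deriv[OF s(1)] this] show ?thesis by (simp add: o_def)
  qed
  have "continuous_on UNIV (\<lambda>x. U' (s x) * partial i s x)" for i
    using continuous_on_compose2[OF U(2) C1_continuous[OF s(1)]] s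
    by (intro continuous_on_mult C1_partial_continuous) auto
  then show "C1 (\<lambda>x. U (s x))" "partial i (\<lambda>x. U (s x)) = (\<lambda>x. U' (s x) * partial i s x)"
    using C1I[OF d] by (simp_all add: frechet_axis)
qed

lemma C2_C1: "C2 f \<Longrightarrow> C1 f" and C2_partial: "C2 f \<Longrightarrow> C1 (partial i f)"
  by (simp_all add: C2_def)

lemma C2_const: "C2 (\<lambda>x. c)"
  by (simp add: C2_def partial_const C1_const)

lemma C2_inner: "C2 (\<lambda>x. v \<bullet> x)"
  by (simp add: C2_def partial_inner C1_const C1_inner)

lemma C2_add: "C2 f \<Longrightarrow> C2 g \<Longrightarrow> C2 (\<lambda>x. f x + g x)"
  by (simp add: C2_def partial_add C1_add)

lemma C2_mult: "C2 f \<Longrightarrow> C2 g \<Longrightarrow> C2 (\<lambda>x. f x * g x)"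
  by (simp add: C2_def partial_mult C1_add C1_mult)

lemma C2_sum: "(\<And>i. i \<in> A \<Longrightarrow> C2 (f i)) \<Longrightarrow> C2 (\<lambda>x. \<Sum>i\<in>A. f i x)"
  by (induction A rule: infinite_finite_induct) (simp_all add: C2_const C2_add)

lemma C2_comp:
  assumes U: "\<And>t. t \<in> S \<Longrightarrow> (U has_real_derivative U' t) (at t within S)"
    "\<And>t. t \<in> S \<Longrightarrow> (U' has_real_derivative U'' t) (at t within S)" "continuous_on S U''"
    and s: "C2 s" "\<And>x. s x \<in> S"
  shows "C2 (\<lambda>x. U (s x))"
proof -
  have c1: "continuous_on S U'" using U(2) DERIV_continuous_on by blast
  have A: "C1 (\<lambda>x. U (s x))" and A': "partial i (\<lambda>x. U (s x)) = (\<lambda>x. U' (s x) * partial i s x)" for i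
    by (rule C1_comp[OF _ c1 C2_C1[OF s(1)] s(2)], erule U(1))+
  have "C1 (\<lambda>x. U' (s x))"
    by (rule C1_comp[OF _ U(3) C2_C1[OF s(1)] s(2)], erule U(2))
  then show ?thesis
    using A C1_mult C2_partial[OF s(1)] unfolding C2_def A' by blast
qed

lemma C2_rho: "C2 (\<rho> :: real ^ 'k::finite \<Rightarrow> real)"
proof -
  have "C2 (\<lambda>y :: real ^ 'k. 1 + (\<Sum>i\<in>UNIV. (axis i 1 \<bullet> y) * (axis i 1 \<bullet> y)))"
    by (intro C2_add C2_const C2_sum C2_mult C2_inner)
  moreover have "(\<lambda>y :: real ^ 'k. 1 + (\<Sum>i\<in>UNIV. (axis i 1 \<bullet> y) * (axis i 1 \<bullet> y))) = \<rho>"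
    by (simp add: fun_eq_iff \<rho>_def inner_axis') (simp add: inner_vec_def)
  ultimately show ?thesis by simp
qed

lemma C2_divide:
  assumes f: "C2 f" and g: "C2 g" "\<And>x. g x > 0"
  shows "C2 (\<lambda>x. f x / g x)"
proof -
  have "C2 (\<lambda>x. inverse (g x))"
  proof (rule C2_comp[where U = inverse and s = g and S = "{0<..}" and U' = "\<lambda>t. - inverse (t\<^sup>2)" and U'' = "\<lambda>t. 2 * inverse (t^3)"])
    fix t :: real assume t: "t \<in> {0<..}"
    show "(inverse has_real_derivative - inverse (t\<^sup>2)) (at t within {0<..})"
      using t by (auto intro!: derivative_eq_intros simp: power2_eq_square)
    show "((\<lambda>t. - inverse (t\<^sup>2)) has_real_derivative 2 * inverse (t^3)) (at t within {0<..})"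
      using t by (auto intro!: derivative_eq_intros simp: field_simps power2_eq_square power3_eq_cube)
  qed (use g in \<open>auto intro!: continuous_intros\<close>)
  from C2_mult[OF f this] show ?thesis by (simp add: divide_inverse)
qed

section \<open>The Laplacian of a function of one coordinate of a line\<close>

text \<open>
  The product rule separates the scalar factor \<open>U'(\<sigma>) / \<rho>\<^sup>N\<close> of the flux below from a polynomial vector field
  whose divergence is explicit.
\<close>
lemma divergence_mult:
  fixes W :: "real ^ 'k::finite \<Rightarrow> real" and X :: "real ^ 'k \<Rightarrow> real ^ 'k"
  assumes W: "(W has_derivative W') (at y)" and X: "(X has_derivative X') (at y)"
  shows "(\<Sum>i\<in>UNIV. partial i (\<lambda>y. W y * X y $ i) y) = W' (X y) + W y * (\<Sum>i\<in>UNIV. X' (axis i 1) $ i)"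
proof -
  have "partial i (\<lambda>y. W y * X y $ i) y = W y * X' (axis i 1) $ i + X y $ i * W' (axis i 1)" for i
  proof -
    have "((\<lambda>y. X y $ i) has_derivative (\<lambda>h. X' h $ i)) (at y)"
      by (rule bounded_linear.has_derivative[OF bounded_linear_vec_nth X])
    from partial_eq[OF has_derivative_mult[OF W this]] show ?thesis by simp
  qed
  moreover have "W' (X y) = (\<Sum>i\<in>UNIV. X y $ i * W' (axis i 1))"
  proof -
    have l: "linear W'" using W has_derivative_linear by blast
    have "W' (X y) = W' (\<Sum>i\<in>UNIV. X y $ i *\<^sub>R axis i 1)"
      using basis_expansion[of "X y"] by (simp add: scalar_mult_eq_scaleR)
    then show ?thesis by (simp add: linear_sum[OF l] linear_scale[OF l])
  qed
  ultimately show ?thesis by (simp add: sum.distrib sum_distrib_left)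
qed

text \<open>
  A real unit vector, split into the entry \<open>c0\<close> at the coordinate that the chart sets to 1 and the remaining
  entries \<open>c\<close>.
\<close>
locale chart_coordinate =
  fixes c0 :: real and c :: "'n::finite \<Rightarrow> real"
  assumes unit: "c0\<^sup>2 + (\<Sum>j\<in>UNIV. (c j)\<^sup>2) = 1"
begin

definition cvec :: "4 \<Rightarrow> real ^ ('n \<times> 4)" where
  "cvec k = of_quats (\<lambda>j. c j *\<^sub>R qunit k)"

text \<open>
  The coordinate \<open>\<Sum>i. v i x i\<close> of the affine lift; \<open>mc k\<close> are its four real components, \<open>quad\<close> is its squared
  norm, and \<open>\<sigma>\<close> is the function \<open>s\<close> in the chart.
\<close>
definition mq :: "real ^ ('n \<times> 4) \<Rightarrow> quat" where
  "mq y = c0 *\<^sub>R qunit 1 + (\<Sum>j\<in>UNIV. c j *\<^sub>R qcoord y j)"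

definition mc :: "4 \<Rightarrow> real ^ ('n \<times> 4) \<Rightarrow> real" where
  "mc k y = (if k = 1 then c0 else 0) + cvec k \<bullet> y"

definition quad :: "real ^ ('n \<times> 4) \<Rightarrow> real" where "quad y = (\<Sum>k\<in>UNIV. (mc k y)\<^sup>2)"

definition \<sigma> :: "real ^ ('n \<times> 4) \<Rightarrow> real" where "\<sigma> y = quad y / \<rho> y"

text \<open>
  The gradient of \<open>\<sigma>\<close> with respect to the metric of the chart, a quadratic polynomial in \<open>y\<close>; see
  \<open>raise_index\<close>.
\<close>
definition gradv :: "real ^ ('n \<times> 4) \<Rightarrow> real ^ ('n \<times> 4)" where
  "gradv y = 2 *\<^sub>R (\<Sum>k\<in>UNIV. mc k y *\<^sub>R (cvec k - c0 *\<^sub>R rmul k y))"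

lemma inner_cvec: "cvec k \<bullet> y = (\<Sum>j\<in>UNIV. c j *\<^sub>R qcoord y j) \<bullet> qunit k"
  by (simp add: inner_qcoord cvec_def qcoord_of_quats inner_sum_left inner_commute[of "qunit k"])

lemma mc_mq: "mc k y = mq y \<bullet> qunit k"
  by (simp add: mc_def mq_def inner_cvec inner_add_left inner_qunit)

lemma quad_mq: "quad y = mq y \<bullet> mq y"
  using quat_inner_expand[of "mq y" "mq y"] by (simp add: quad_def mc_mq power2_eq_square)

lemma inner_cvec_rmul: "cvec k \<bullet> rmul l y = qmult (mq y - c0 *\<^sub>R qunit 1) (qunit l) \<bullet> qunit k"
  by (simp add: inner_cvec qcoord_rmul mq_def qmult_sum_left qmult_scaleR_left)

lemma inner_cvec_cvec: "cvec k \<bullet> cvec l = (if k = l then 1 - c0\<^sup>2 else 0)"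
proof -
  have "cvec k \<bullet> cvec l = (\<Sum>j\<in>UNIV. (c j)\<^sup>2 * (qunit k \<bullet> qunit l))"
    by (simp add: inner_qcoord cvec_def qcoord_of_quats power2_eq_square mult.assoc)
  also have "\<dots> = (\<Sum>j\<in>UNIV. (c j)\<^sup>2) * (qunit k \<bullet> qunit l)"
    by (rule sum_distrib_right[symmetric])
  finally have "cvec k \<bullet> cvec l = (\<Sum>j\<in>UNIV. (c j)\<^sup>2) * (qunit k \<bullet> qunit l)" .
  then show ?thesis using unit by (simp add: inner_qunit)
qed

text \<open>
  The sum is the inner product of \<open>m\<close> and \<open>(m - c0) e\<close> for the coordinate \<open>m = mq y\<close> and the basis quaternion
  \<open>e = qunit l\<close>, and left multiplication by \<open>m\<close> scales inner products by the squared norm of \<open>m\<close>.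
\<close>
lemma sum_mc_rmul: "(\<Sum>k\<in>UNIV. mc k y * (cvec k \<bullet> rmul l y)) = (if l = 1 then quad y else 0) - c0 * mc l y"
proof -
  have "(\<Sum>k\<in>UNIV. mc k y * (cvec k \<bullet> rmul l y)) = mq y \<bullet> qmult (mq y - c0 *\<^sub>R qunit 1) (qunit l)"
    unfolding mc_mq inner_cvec_rmul by (rule quat_inner_expand)
  also have "\<dots> = qmult (mq y) (qunit 1) \<bullet> qmult (mq y) (qunit l) - c0 * (mq y \<bullet> qunit l)"
    by (simp add: qmult_diff_left qmult_scaleR_left qmult_qunit_1 inner_diff_right)
  also have "\<dots> = quad y * (qunit 1 \<bullet> qunit l) - c0 * mc l y"
    by (simp only: qmult_inner_left quad_mq mc_mq)
  finally show ?thesis by (auto simp: inner_qunit)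
qed

lemma inner_cvec_rmul_same: "cvec k \<bullet> rmul k y = mc 1 y - c0"
proof -
  have "cvec k \<bullet> rmul k y = qmult (mq y - c0 *\<^sub>R qunit 1) (qunit k) \<bullet> qmult (qunit 1) (qunit k)"
    by (simp add: inner_cvec_rmul qmult_qunit_1)
  also have "\<dots> = (mq y - c0 *\<^sub>R qunit 1) \<bullet> qunit 1"
    by (simp only: qmult_inner_right) (simp add: inner_qunit)
  finally show ?thesis by (simp add: inner_diff_left inner_qunit mc_mq)
qed

text \<open>
  Right multiplication by an imaginary unit is skew, so its diagonal entries vanish.
\<close>
lemma trace_rmul: "(\<Sum>i\<in>(UNIV :: ('n \<times> 4) set). rmul k (axis i 1) $ i) = (if k = 1 then 4 * real CARD('n) else 0)"
  for k :: 4
proof -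
  have "rmul k (axis i 1) $ i = (if k = 1 then 1 else 0)" for i :: "'n \<times> 4"
    using inner_rmul_self[of k "axis i 1"] by (auto simp: rmul_1 inner_axis)
  then have "(\<Sum>i\<in>(UNIV :: ('n \<times> 4) set). rmul k (axis i 1) $ i) = (\<Sum>i\<in>(UNIV :: ('n \<times> 4) set). if k = 1 then 1 else 0)"
    by (intro sum.cong refl)
  then show ?thesis by simp
qed

lemma mc_deriv: "(mc k has_derivative (\<lambda>h. cvec k \<bullet> h)) (at y)"
  unfolding mc_def[abs_def] by (auto intro!: derivative_eq_intros)

lemma C2_quad: "C2 quad"
  unfolding quad_def[abs_def] mc_def power2_eq_square by (intro C2_sum C2_mult C2_add C2_const C2_inner)

lemma C2_sigma: "C2 \<sigma>"
  unfolding \<sigma>_def[abs_def] by (rule C2_divide[OF C2_quad C2_rho rho_pos])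

definition dsigma :: "real ^ ('n \<times> 4) \<Rightarrow> real ^ ('n \<times> 4) \<Rightarrow> real" where
  "dsigma y h = 2 * (\<Sum>k\<in>UNIV. mc k y * (cvec k \<bullet> h)) / \<rho> y - 2 * quad y * (y \<bullet> h) / (\<rho> y)\<^sup>2"

lemma rho_deriv: "(\<rho> has_derivative (\<lambda>h. 2 * (y \<bullet> h))) (at y)"
  unfolding \<rho>_def[abs_def] by (auto intro!: derivative_eq_intros simp: inner_commute)

lemma sigma_deriv: "(\<sigma> has_derivative dsigma y) (at y)"
proof -
  have dq: "(quad has_derivative (\<lambda>h. \<Sum>k\<in>UNIV. 2 * (mc k y * (cvec k \<bullet> h)))) (at y)"
    unfolding quad_def[abs_def]
    by (rule has_derivative_sum) (rule has_derivative_eq_rhs[OF has_derivative_power[OF mc_deriv]], simp add: mult_ac)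
  have "((\<lambda>y. quad y / \<rho> y) has_derivative
      (\<lambda>h. ((\<Sum>k\<in>UNIV. 2 * (mc k y * (cvec k \<bullet> h))) * \<rho> y - quad y * (2 * (y \<bullet> h))) / (\<rho> y * \<rho> y))) (at y)"
    using rho_pos[of y] by (intro has_derivative_divide' dq rho_deriv) auto
  moreover have "(\<lambda>h. ((\<Sum>k\<in>UNIV. 2 * (mc k y * (cvec k \<bullet> h))) * \<rho> y - quad y * (2 * (y \<bullet> h))) / (\<rho> y * \<rho> y)) = dsigma y"
    using rho_pos[of y] by (simp add: fun_eq_iff dsigma_def sum_distrib_left[symmetric] diff_divide_distrib power2_eq_square)
  ultimately show ?thesis by (simp add: \<sigma>_def[abs_def])
qed

text \<open>
  The left hand side applies the inverse metric of \<open>matrix_inv_fs_metric\<close> to the differential of \<open>\<sigma>\<close>.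
\<close>
lemma raise_index:
  "\<rho> y * (dsigma y (axis i 1) + (\<Sum>l\<in>UNIV. rmul l y $ i * dsigma y (rmul l y))) = gradv y $ i"
proof -
  define r where "r = \<rho> y"
  have r: "r > 0" "y \<bullet> y = r - 1" using rho_pos[of y] by (auto simp: r_def \<rho>_def)
  have yr: "y \<bullet> rmul l y = (if l = 1 then r - 1 else 0)" for l
    using inner_rmul_self[of l y] r by (auto simp: rmul_1 inner_commute)
  have ds: "dsigma y (rmul l y) = (if l = 1 then 2 * quad y / r - 2 * quad y * (r - 1) / r\<^sup>2 else 0) - (2 * c0 / r) * mc l y" for l
    by (simp add: dsigma_def sum_mc_rmul yr r_def[symmetric] diff_divide_distrib algebra_simps)
  have "(\<Sum>l\<in>UNIV. rmul l y $ i * dsigma y (rmul l y))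
    = y $ i * (2 * quad y / r - 2 * quad y * (r - 1) / r\<^sup>2) - (2 * c0 / r) * (\<Sum>l\<in>UNIV. mc l y * rmul l y $ i)"
    by (simp add: ds sum_4 rmul_1 algebra_simps)
  moreover have "dsigma y (axis i 1) = (2 / r) * (\<Sum>k\<in>UNIV. mc k y * cvec k $ i) - 2 * quad y * y $ i / r\<^sup>2"
    by (simp add: dsigma_def inner_axis r_def[symmetric])
  moreover have "2 * quad y / r - 2 * quad y * (r - 1) / r\<^sup>2 = 2 * quad y / r\<^sup>2"
    using r(1) by (simp add: field_simps power2_eq_square)
  ultimately have "\<rho> y * (dsigma y (axis i 1) + (\<Sum>l\<in>UNIV. rmul l y $ i * dsigma y (rmul l y)))
     = r * ((2 / r) * (\<Sum>k\<in>UNIV. mc k y * cvec k $ i) - 2 * quad y * y $ i / r\<^sup>2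
        + (y $ i * (2 * quad y / r\<^sup>2) - (2 * c0 / r) * (\<Sum>l\<in>UNIV. mc l y * rmul l y $ i)))"
    by (simp only: r_def[symmetric])
  also have "\<dots> = 2 * (\<Sum>k\<in>UNIV. mc k y * cvec k $ i) - 2 * c0 * (\<Sum>l\<in>UNIV. mc l y * rmul l y $ i)"
    using r(1) by (simp add: distrib_left right_diff_distrib)
  also have "\<dots> = gradv y $ i"
    by (simp add: gradv_def sum_component sum_4 algebra_simps)
  finally show ?thesis .
qed

definition dgradv :: "real ^ ('n \<times> 4) \<Rightarrow> real ^ ('n \<times> 4) \<Rightarrow> real ^ ('n \<times> 4)" where
  "dgradv y h = 2 *\<^sub>R (\<Sum>k\<in>UNIV. mc k y *\<^sub>R (- (c0 *\<^sub>R rmul k h)) + (cvec k \<bullet> h) *\<^sub>R (cvec k - c0 *\<^sub>R rmul k y))"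

lemma gradv_deriv: "(gradv has_derivative dgradv y) (at y)"
proof -
  have "((\<lambda>y. cvec k - c0 *\<^sub>R rmul k y) has_derivative (\<lambda>h. - (c0 *\<^sub>R rmul k h))) (at y)" for k
  proof -
    have "(rmul k has_derivative rmul k) (at y)"
      using linear_rmul linear_imp_has_derivative by blast
    then show ?thesis by (auto intro!: derivative_eq_intros)
  qed
  then show ?thesis
    unfolding gradv_def[abs_def] dgradv_def[abs_def]
    by (intro has_derivative_scaleR_right has_derivative_sum has_derivative_scaleR mc_deriv)
qed

lemma div_gradv:
  "(\<Sum>i\<in>UNIV. dgradv y (axis i 1) $ i) = 8 - 8 * (real CARD('n) + 1) * (c0 * mc 1 y)"
proof -
  define z where "z k = cvec k - c0 *\<^sub>R rmul k y" for k
  have "(\<Sum>i\<in>UNIV. dgradv y (axis i 1) $ i) = (\<Sum>i\<in>UNIV. \<Sum>k\<in>UNIV. (- 2 * c0 * mc k y) * rmul k (axis i 1) $ i + 2 * (cvec k $ i * z k $ i))"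
    unfolding dgradv_def z_def[symmetric] by (simp add: inner_axis sum_component sum_distrib_left algebra_simps)
  also have "\<dots> = (\<Sum>k\<in>UNIV. \<Sum>i\<in>UNIV. (- 2 * c0 * mc k y) * rmul k (axis i 1) $ i + 2 * (cvec k $ i * z k $ i))"
    by (rule sum.swap)
  also have "\<dots> = (\<Sum>k\<in>UNIV. (- 2 * c0 * mc k y) * (if k = 1 then 4 * real CARD('n) else 0) + 2 * (cvec k \<bullet> z k))"
    by (simp only: sum.distrib sum_distrib_left[symmetric] trace_rmul inner_vec_def inner_real_def)
  also have "\<dots> = 8 - 8 * (real CARD('n) + 1) * (c0 * mc 1 y)"
    by (simp add: z_def sum_4 inner_diff_right inner_cvec_cvec inner_cvec_rmul_same power2_eq_square algebra_simps)
  finally show ?thesis .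
qed

lemma inner_gradv: "y \<bullet> gradv y = 2 * (quad y - c0 * mc 1 y * \<rho> y)"
proof -
  have "y \<bullet> gradv y = 2 * (\<Sum>k\<in>UNIV. mc k y * (cvec k \<bullet> y - c0 * (rmul k y \<bullet> y)))"
    by (simp add: gradv_def inner_sum_right inner_diff_right inner_commute)
  also have "\<dots> = 2 * (\<Sum>k\<in>UNIV. mc k y * mc k y - (if k = 1 then mc 1 y * c0 * (1 + y \<bullet> y) else 0))"
    using inner_rmul_self[of _ y]
    by (intro arg_cong[of _ _ "\<lambda>x. 2 * x"] sum.cong) (auto simp: mc_def rmul_1 algebra_simps)
  also have "\<dots> = 2 * (quad y - c0 * mc 1 y * \<rho> y)"
    by (simp add: sum_subtractf quad_def power2_eq_square \<rho>_def mult_ac)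
  finally show ?thesis .
qed

text \<open>
  The squared length of the gradient of \<open>\<sigma>\<close>.
\<close>
lemma dsigma_gradv: "dsigma y (gradv y) = 4 * (\<sigma> y * (1 - \<sigma> y))"
proof -
  have "(\<Sum>k\<in>UNIV. mc k y * (cvec k \<bullet> gradv y))
    = 2 * (\<Sum>k\<in>UNIV. \<Sum>l\<in>UNIV. mc k y * (mc l y * (cvec k \<bullet> cvec l)) - c0 * (mc l y * (mc k y * (cvec k \<bullet> rmul l y))))"
    by (simp add: gradv_def inner_sum_right inner_diff_right sum_distrib_left algebra_simps)
  also have "\<dots> = 2 * ((\<Sum>k\<in>UNIV. \<Sum>l\<in>UNIV. mc k y * (mc l y * (cvec k \<bullet> cvec l)))
      - c0 * (\<Sum>l\<in>UNIV. mc l y * (\<Sum>k\<in>UNIV. mc k y * (cvec k \<bullet> rmul l y))))"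
  proof -
    have "(\<Sum>k\<in>UNIV. \<Sum>l\<in>UNIV. c0 * (mc l y * (mc k y * (cvec k \<bullet> rmul l y))))
      = c0 * (\<Sum>l\<in>UNIV. mc l y * (\<Sum>k\<in>UNIV. mc k y * (cvec k \<bullet> rmul l y)))"
      by (subst sum.swap) (simp only: sum_distrib_left)
    then show ?thesis by (simp only: sum_subtractf)
  qed
  also have "(\<Sum>k\<in>UNIV. \<Sum>l\<in>UNIV. mc k y * (mc l y * (cvec k \<bullet> cvec l))) = (1 - c0\<^sup>2) * quad y"
    by (simp add: inner_cvec_cvec quad_def sum_4 power2_eq_square algebra_simps)
  also have "(\<Sum>l\<in>UNIV. mc l y * (\<Sum>k\<in>UNIV. mc k y * (cvec k \<bullet> rmul l y))) = mc 1 y * quad y - c0 * quad y"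
    unfolding sum_mc_rmul by (simp add: quad_def sum_4 power2_eq_square algebra_simps)
  finally have "(\<Sum>k\<in>UNIV. mc k y * (cvec k \<bullet> gradv y)) = 2 * (quad y * (1 - c0 * mc 1 y))"
    by (simp add: power2_eq_square algebra_simps)
  then show ?thesis
    unfolding dsigma_def inner_gradv \<sigma>_def using rho_pos[of y]
    by (simp only:) (simp add: field_simps power2_eq_square)
qed

text \<open>
  The flux in the definition of the Laplacian is \<open>U'(\<sigma>) / \<rho>\<^sup>N\<close> times the polynomial vector field \<open>gradv\<close>, with
  \<open>N = 2 n + 2\<close>, and its divergence is assembled from \<open>dsigma_gradv\<close>, \<open>inner_gradv\<close> and \<open>div_gradv\<close>.
\<close>
theorem laplace_beltrami_sigma:
  assumes U: "\<And>t. t \<in> {0..1} \<Longrightarrow> (U has_real_derivative U1 t) (at t within {0..1})"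
    "\<And>t. t \<in> {0..1} \<Longrightarrow> (U1 has_real_derivative U2 t) (at t within {0..1})"
    and s: "\<And>y. \<sigma> y \<in> {0..1}"
  shows "laplace_beltrami (fs_metric a) (\<lambda>y. U (\<sigma> y)) y =
     4 * (\<sigma> y * (1 - \<sigma> y) * U2 (\<sigma> y) + (2 - 2 * (real CARD('n) + 1) * \<sigma> y) * U1 (\<sigma> y))"
proof -
  define N where "N = 2 * CARD('n) + 2"
  have c1: "continuous_on {0..1} U1" using U(2) DERIV_continuous_on by blast
  have pU: "partial j (\<lambda>y. U (\<sigma> y)) y = U1 (\<sigma> y) * dsigma y (axis j 1)" for j y
  proof -
    have "partial j (\<lambda>y. U (\<sigma> y)) = (\<lambda>y. U1 (\<sigma> y) * partial j \<sigma> y)"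
      by (rule C1_comp(2)[OF _ c1 C2_C1[OF C2_sigma] s], erule U(1))
    then show ?thesis by (simp add: partial_eq[OF sigma_deriv])
  qed
  define W where "W y = U1 (\<sigma> y) / \<rho> y ^ N" for y
  have flux: "sqrt (det (fs_metric a y)) * (\<Sum>j\<in>UNIV. matrix_inv (fs_metric a y) $ i $ j * partial j (\<lambda>y. U (\<sigma> y)) y)
      = W y * gradv y $ i" for i y
  proof -
    have lin: "linear (dsigma y)" using sigma_deriv has_derivative_linear by blast
    have ex: "dsigma y v = (\<Sum>j\<in>UNIV. v $ j * dsigma y (axis j 1))" for v
    proof -
      have "dsigma y v = dsigma y (\<Sum>j\<in>UNIV. v $ j *\<^sub>R axis j 1)"
        using basis_expansion[of v] by (simp add: scalar_mult_eq_scaleR)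
      then show ?thesis by (simp add: linear_sum[OF lin] linear_scale[OF lin])
    qed
    have "(\<Sum>j\<in>UNIV. matrix_inv (fs_metric a y) $ i $ j * partial j (\<lambda>y. U (\<sigma> y)) y)
      = U1 (\<sigma> y) * (\<rho> y * (\<Sum>j\<in>UNIV. (if j = i then dsigma y (axis i 1) else 0)
          + (\<Sum>l\<in>UNIV. rmul l y $ i * (rmul l y $ j * dsigma y (axis j 1)))))"
      unfolding matrix_inv_fs_metric pU sum_distrib_left
      by (rule sum.cong[OF refl]) (simp add: sum_distrib_left sum_distrib_right algebra_simps)
    also have "(\<Sum>j\<in>UNIV. (if j = i then dsigma y (axis i 1) else 0)
          + (\<Sum>l\<in>UNIV. rmul l y $ i * (rmul l y $ j * dsigma y (axis j 1))))
      = dsigma y (axis i 1) + (\<Sum>l\<in>UNIV. rmul l y $ i * dsigma y (rmul l y))"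
    proof -
      have "(\<Sum>j\<in>UNIV. \<Sum>l\<in>UNIV. rmul l y $ i * (rmul l y $ j * dsigma y (axis j 1)))
        = (\<Sum>l\<in>UNIV. \<Sum>j\<in>UNIV. rmul l y $ i * (rmul l y $ j * dsigma y (axis j 1)))"
        by (rule sum.swap)
      also have "\<dots> = (\<Sum>l\<in>UNIV. rmul l y $ i * dsigma y (rmul l y))"
        unfolding ex[of "rmul _ y"] by (simp only: sum_distrib_left)
      finally show ?thesis by (simp add: sum.distrib)
    qed
    finally show ?thesis
      by (simp add: raise_index sqrt_det_fs_metric W_def N_def)
  qed
  have W': "(W has_derivative (\<lambda>h. U2 (\<sigma> y) * dsigma y h / \<rho> y ^ N - U1 (\<sigma> y) * (real N * (2 * (y \<bullet> h))) / \<rho> y ^ (N + 1))) (at y)"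
  proof -
    have d1: "((\<lambda>y. U1 (\<sigma> y)) has_derivative (\<lambda>h. U2 (\<sigma> y) * dsigma y h)) (at y)"
    proof -
      have "(U1 has_derivative (*) (U2 (\<sigma> y))) (at (\<sigma> y) within \<sigma> ` UNIV)"
        using has_derivative_subset[OF U(2)[OF s, unfolded has_field_derivative_def]] s by blast
      from diff_chain_within[OF sigma_deriv this] show ?thesis by (simp add: o_def)
    qed
    have d2: "((\<lambda>y. \<rho> y ^ N) has_derivative (\<lambda>h. real N * (2 * (y \<bullet> h)) * \<rho> y ^ (N - 1))) (at y)"
      by (rule has_derivative_eq_rhs[OF has_derivative_power[OF rho_deriv]]) (simp add: mult_ac)
    have "(W has_derivative (\<lambda>h. (U2 (\<sigma> y) * dsigma y h * \<rho> y ^ N - U1 (\<sigma> y) * (real N * (2 * (y \<bullet> h)) * \<rho> y ^ (N - 1))) / (\<rho> y ^ N * \<rho> y ^ N))) (at y)"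
      unfolding W_def[abs_def] using rho_pos[of y] by (intro has_derivative_divide' d1 d2) auto
    moreover have "(U2 (\<sigma> y) * dsigma y h * \<rho> y ^ N - U1 (\<sigma> y) * (real N * (2 * (y \<bullet> h)) * \<rho> y ^ (N - 1))) / (\<rho> y ^ N * \<rho> y ^ N)
        = U2 (\<sigma> y) * dsigma y h / \<rho> y ^ N - U1 (\<sigma> y) * (real N * (2 * (y \<bullet> h))) / \<rho> y ^ (N + 1)" for h
    proof -
      have "\<rho> y ^ N = \<rho> y ^ (N - 1) * \<rho> y" by (simp add: N_def)
      then show ?thesis using rho_pos[of y] by (simp add: diff_divide_distrib)
    qed
    ultimately show ?thesis by simp
  qed
  have "laplace_beltrami (fs_metric a) (\<lambda>y. U (\<sigma> y)) y = (\<Sum>i\<in>UNIV. partial i (\<lambda>y. W y * gradv y $ i) y) * \<rho> y ^ N"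
    unfolding laplace_beltrami_def flux by (simp add: sqrt_det_fs_metric N_def)
  also have "\<dots> = (U2 (\<sigma> y) * (4 * (\<sigma> y * (1 - \<sigma> y))) / \<rho> y ^ N - U1 (\<sigma> y) * (real N * (2 * (2 * (quad y - c0 * mc 1 y * \<rho> y)))) / \<rho> y ^ (N + 1)
      + W y * (8 - 8 * (real CARD('n) + 1) * (c0 * mc 1 y))) * \<rho> y ^ N"
    unfolding divergence_mult[OF W' gradv_deriv] dsigma_gradv inner_gradv div_gradv ..
  also have "\<dots> = U2 (\<sigma> y) * (4 * (\<sigma> y * (1 - \<sigma> y))) - U1 (\<sigma> y) * (4 * real N * (quad y - c0 * mc 1 y * \<rho> y) / \<rho> y)
      + U1 (\<sigma> y) * (8 - 8 * (real CARD('n) + 1) * (c0 * mc 1 y))"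
    using rho_pos[of y] by (simp add: W_def distrib_right left_diff_distrib)
  also have "(quad y - c0 * mc 1 y * \<rho> y) / \<rho> y = \<sigma> y - c0 * mc 1 y"
    using rho_pos[of y] by (simp add: \<sigma>_def diff_divide_distrib)
  then have "4 * real N * (quad y - c0 * mc 1 y * \<rho> y) / \<rho> y = 4 * real N * (\<sigma> y - c0 * mc 1 y)"
    by (metis times_divide_eq_right)
  finally show ?thesis by (simp add: N_def algebra_simps)
qed

end

section \<open>Functions of one coordinate on the projective space\<close>

lemma qscale_assoc: "qscale (qscale x p) q = qscale x (qmult p q)"
  by (simp add: qscale_def qmult_assoc)

definition qinv :: "quat \<Rightarrow> quat" where
  "qinv p = (1 / (p \<bullet> p)) *\<^sub>R (cnj (fst p), - snd p)"

lemma qmult_qinv: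
  assumes "p \<noteq> 0"
  shows "qmult p (qinv p) = qunit 1" "qmult (qinv p) p = qunit 1"
proof -
  have pp: "p \<bullet> p \<noteq> 0" using assms by simp
  define r where "r = (cnj (fst p), - snd p)"
  have "qmult p r = (p \<bullet> p) *\<^sub>R qunit 1" "qmult r p = (p \<bullet> p) *\<^sub>R qunit 1"
    by (simp_all add: r_def qmult_def inner_quat qunit_simps complex_eq_iff algebra_simps)
  moreover have "qmult p (c *\<^sub>R r) = c *\<^sub>R qmult p r" for c
    by (simp add: qmult_def complex_eq_iff algebra_simps)
  ultimately show "qmult p (qinv p) = qunit 1" "qmult (qinv p) p = qunit 1"
    unfolding qinv_def r_def[symmetric] using pp by (simp_all add: qmult_scaleR_left)
qed

lemma range_qscale_unit:
  assumes "qmult q r = qunit 1"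
  shows "range (qscale (qscale x q)) = range (qscale x)"
proof -
  have "qscale x t = qscale (qscale x q) (qmult r t)" for t
    by (metis assms qmult_assoc qmult_qunit_1(2) qscale_assoc)
  then show ?thesis by (auto simp: qscale_assoc)
qed

lemma hline_eq_iff:
  assumes "x \<noteq> 0" "z \<noteq> 0"
  shows "hline x = hline z \<longleftrightarrow> range (qscale x) = range (qscale z)"
  unfolding hline_def using assms by (subst Abs_hproj_inject) auto

lemma hline_cases:
  obtains x where "x \<noteq> 0" "p = hline x"
  using Rep_hproj[of p] Rep_hproj_inverse[of p] unfolding hline_def by auto

lemma affine_lift_nonzero: "affine_lift a y \<noteq> 0"
  using inner_affine_lift[of a y] by (metis inner_zero_left add_pos_nonneg inner_ge_zero less_irrefl zero_less_one)

text \<open>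
  Every line has a nonzero coordinate, which right multiplication by its inverse turns into 1.
\<close>
lemma hchart_cover: "\<exists>a y. hchart a y = p"
proof -
  obtain x where x: "x \<noteq> 0" "p = hline x" by (rule hline_cases)
  then obtain a where a: "x $ a \<noteq> 0" by (auto simp: vec_eq_iff)
  define q where "q = qinv (x $ a)"
  define y where "y = of_quats (\<lambda>j. qmult (x $ chart_index a j) q)"
  have "affine_lift a y = qscale x q"
    by (rule vec_eq_chart[of _ a])
       (simp_all add: affine_lift_at affine_lift_chart_index y_def qcoord_of_quats qscale_def q_def qmult_qinv[OF a],
        simp add: qone_def qunit_simps)
  then have "range (qscale (affine_lift a y)) = range (qscale x)"
    using range_qscale_unit[of q "x $ a" x] qmult_qinv[OF a] by (simp add: q_def)
  then have "hchart a y = p"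
    using x by (simp add: hchart_def hline_eq_iff affine_lift_nonzero)
  then show ?thesis by blast
qed

definition coordinate_ratio :: "('m::finite \<Rightarrow> real) \<Rightarrow> quat ^ 'm \<Rightarrow> real" where
  "coordinate_ratio v x = (norm (\<Sum>i\<in>UNIV. v i *\<^sub>R x $ i))\<^sup>2 / (norm x)\<^sup>2"

lemma norm_qmult: "(norm (qmult p q))\<^sup>2 = (norm p)\<^sup>2 * (norm q)\<^sup>2"
  by (simp add: power2_norm_eq_inner qmult_inner_right mult.commute)

lemma coordinate_ratio_qscale:
  assumes "q \<noteq> 0"
  shows "coordinate_ratio v (qscale x q) = coordinate_ratio v x"
proof -
  have "(\<Sum>i\<in>UNIV. v i *\<^sub>R qscale x q $ i) = qmult (\<Sum>i\<in>UNIV. v i *\<^sub>R x $ i) q"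
    by (simp add: qscale_def qmult_sum_left qmult_scaleR_left)
  moreover have "(norm (qscale x q))\<^sup>2 = (norm x)\<^sup>2 * (norm q)\<^sup>2"
    by (simp add: power2_norm_eq_inner inner_vec_def qscale_def qmult_inner_right sum_distrib_left mult.commute)
  ultimately show ?thesis using assms by (simp add: coordinate_ratio_def norm_qmult)
qed

text \<open>
  The choice of the spanning vector is immaterial by \<open>coordinate_ratio_qscale\<close>: the entries of \<open>v\<close> are real, so
  they commute with right multiplication.
\<close>
definition height :: "('n::finite option \<Rightarrow> real) \<Rightarrow> 'n hproj \<Rightarrow> real" where
  "height v p = coordinate_ratio v (SOME x. x \<noteq> 0 \<and> p = hline x)"

lemma height_hline:
  assumes "x \<noteq> 0"
  shows "height v (hline x) = coordinate_ratio v x"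
proof -
  define z where "z = (SOME z. z \<noteq> 0 \<and> hline x = hline z)"
  have "z \<noteq> 0 \<and> hline x = hline z" unfolding z_def by (rule someI[of _ x]) (use assms in simp)
  then have z: "z \<noteq> 0" "range (qscale x) = range (qscale z)"
    using hline_eq_iff[OF assms, of z] by blast+
  have "z = qscale z (qunit 1)" by (simp add: qscale_1)
  then have "z \<in> range (qscale z)" by (rule range_eqI)
  then have "z \<in> range (qscale x)" by (simp only: z(2))
  then obtain q where q: "z = qscale x q" by (rule rangeE)
  then have "q \<noteq> 0" using z by (auto simp: qscale_def vec_eq_iff qmult_def zero_prod_def)
  then show ?thesis unfolding height_def z_def[symmetric] by (simp add: q coordinate_ratio_qscale)
qed

lemma coordinate_ratio_le_1:
  assumes "(\<Sum>i\<in>UNIV. (v i)\<^sup>2) = 1" and "x \<noteq> 0"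
  shows "coordinate_ratio v x \<in> {0..1}"
proof -
  have "norm (\<Sum>i\<in>UNIV. v i *\<^sub>R x $ i) \<le> (\<Sum>i\<in>UNIV. \<bar>v i\<bar> * norm (x $ i))"
    by (rule order_trans[OF norm_sum]) simp
  then have "(norm (\<Sum>i\<in>UNIV. v i *\<^sub>R x $ i))\<^sup>2 \<le> (\<Sum>i\<in>UNIV. \<bar>v i\<bar> * norm (x $ i))\<^sup>2"
    by (intro power_mono) auto
  also have "\<dots> \<le> (\<Sum>i\<in>UNIV. \<bar>v i\<bar>\<^sup>2) * (\<Sum>i\<in>UNIV. (norm (x $ i))\<^sup>2)"
    by (rule Cauchy_Schwarz_ineq_sum)
  also have "\<dots> = (norm x)\<^sup>2"
    using assms(1) by (simp add: power2_norm_eq_inner inner_vec_def)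
  finally show ?thesis using assms(2) by (simp add: coordinate_ratio_def)
qed

lemma height_range: "(\<Sum>i\<in>UNIV. (v i)\<^sup>2) = 1 \<Longrightarrow> height v p \<in> {0..1}"
  by (metis hline_cases height_hline coordinate_ratio_le_1)

lemma chart_coordinate_of_unit:
  assumes "(\<Sum>i\<in>UNIV. (v i)\<^sup>2) = 1"
  shows "chart_coordinate (v a) (\<lambda>j. v (chart_index a j))"
  using assms by unfold_locales (simp add: sum_chart_index[of _ a])

lemma height_hchart:
  assumes "(\<Sum>i\<in>UNIV. (v i)\<^sup>2) = 1"
  shows "height v (hchart a y) = chart_coordinate.\<sigma> (v a) (\<lambda>j. v (chart_index a j)) y"
proof -
  interpret chart_coordinate "v a" "\<lambda>j. v (chart_index a j)" by (rule chart_coordinate_of_unit[OF assms])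
  have "(\<Sum>i\<in>UNIV. v i *\<^sub>R affine_lift a y $ i) = mq y"
    by (simp add: sum_chart_index[of _ a] affine_lift_at affine_lift_chart_index mq_def)
       (simp add: qone_def qunit_simps)
  then show ?thesis
    by (simp add: hchart_def height_hline affine_lift_nonzero coordinate_ratio_def power2_norm_eq_inner
        inner_affine_lift \<sigma>_def quad_mq \<rho>_def)
qed

lemma height_solution:
  fixes v :: "'n::finite option \<Rightarrow> real"
  assumes v: "(\<Sum>i\<in>UNIV. (v i)\<^sup>2) = 1"
    and U: "\<And>t. t \<in> {0..1} \<Longrightarrow> (U has_real_derivative U' t) (at t within {0..1})"
    "\<And>t. t \<in> {0..1} \<Longrightarrow> (U' has_real_derivative U'' t) (at t within {0..1})"
    "continuous_on {0..1} U''"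
    and ode: "\<And>t. t \<in> {0..1} \<Longrightarrow>
       t * (1 - t) * U'' t + (2 - 2 * (real CARD('n) + 1) * t) * U' t = lam / 4 * (U t - U t powr q)"
    and pos: "\<And>t. t \<in> {0..1} \<Longrightarrow> 0 < U t"
  shows "U \<circ> height v \<in> positive_solutions q lam"
proof -
  have comp: "(U \<circ> height v) \<circ> hchart a = (\<lambda>y. U (chart_coordinate.\<sigma> (v a) (\<lambda>j. v (chart_index a j)) y))" for a
    by (simp add: fun_eq_iff height_hchart[OF v])
  have range: "chart_coordinate.\<sigma> (v a) (\<lambda>j. v (chart_index a j)) y \<in> {0..1}" for a y
    using height_range[OF v, of "hchart a y"] by (simp add: height_hchart[OF v])
  have "C2_hproj (U \<circ> height v)"
    unfolding C2_hproj_def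
  proof
    fix a
    interpret chart_coordinate "v a" "\<lambda>j. v (chart_index a j)" by (rule chart_coordinate_of_unit[OF v])
    show "C2 ((U \<circ> height v) \<circ> hchart a)"
      unfolding comp by (rule C2_comp[OF U(1) U(2) U(3) C2_sigma range])
  qed
  moreover have "- hproj_laplacian (U \<circ> height v) p + lam * (U \<circ> height v) p = lam * (U \<circ> height v) p powr q" for p
  proof -
    define ay where "ay = (SOME (a, y). hchart a y = p)"
    obtain a y where ay: "ay = (a, y)" by (cases ay)
    have "\<exists>ay. (case ay of (a, y) \<Rightarrow> hchart a y = p)" using hchart_cover[of p] by auto
    from someI_ex[OF this] have p: "hchart a y = p" unfolding ay_def[symmetric] ay by simp
    interpret chart_coordinate "v a" "\<lambda>j. v (chart_index a j)" by (rule chart_coordinate_of_unit[OF v])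
    have s: "\<sigma> y = height v p" by (simp add: height_hchart[OF v] flip: p)
    have "hproj_laplacian (U \<circ> height v) p = laplace_beltrami (fs_metric a) (\<lambda>y. U (\<sigma> y)) y"
      unfolding hproj_laplacian_def ay_def[symmetric] ay by (simp add: comp)
    also have "\<dots> = 4 * (\<sigma> y * (1 - \<sigma> y) * U'' (\<sigma> y) + (2 - 2 * (real CARD('n) + 1) * \<sigma> y) * U' (\<sigma> y))"
      by (rule laplace_beltrami_sigma[OF U(1) U(2) range])
    also have "\<dots> = lam * (U (\<sigma> y) - U (\<sigma> y) powr q)"
      unfolding ode[OF range[of a y]] by simp
    finally show ?thesis by (simp add: s algebra_simps)
  qed
  ultimately show ?thesis
    using pos height_range[OF v] by (auto simp: positive_solutions_def)
qed

section \<open>Infinitely many solutions from one profile\<close>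

text \<open>
  A monotone function is constant on one period, and periodicity extends this in steps of length \<open>d\<close>.
\<close>
lemma periodic_monotone_const:
  fixes W :: "real \<Rightarrow> real"
  assumes per: "\<And>t. W (t + d) = W t" and d: "0 < d"
    and mono: "\<And>s t. 0 \<le> s \<Longrightarrow> s \<le> t \<Longrightarrow> t \<le> b \<Longrightarrow> W s \<le> W t" and db: "d \<le> b"
  shows "W b = W 0"
proof -
  have "\<forall>t. 0 \<le> t \<longrightarrow> t \<le> b \<longrightarrow> t \<le> real k * d \<longrightarrow> W t = W 0" for k
  proof (induction k)
    case (Suc k)
    show ?case
    proof (intro allI impI)
      fix t assume t: "0 \<le> t" "t \<le> b" "t \<le> real (Suc k) * d"
      show "W t = W 0"
      proof (cases "t \<le> d")
        case True
        have "W t \<le> W (0 + d)" using mono[of t d] t True db by simp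
        then have "W t \<le> W 0" by (simp only: per)
        then show ?thesis using mono[of 0 t] t by simp
      next
        case False
        have "real (Suc k) * d = real k * d + d" by (simp add: distrib_right)
        then have "0 \<le> t - d" "t - d \<le> b" "t - d \<le> real k * d" using t False d by linarith+
        with Suc.IH have "W (t - d) = W 0" by blast
        then show ?thesis using per[of "t - d"] by simp
      qed
    qed
  qed auto
  note steps = this
  obtain k :: nat where "b < real k * d"
    using reals_Archimedean3[OF d] by blast
  then have "0 \<le> b" "b \<le> b" "b \<le> real k * d" using d db by linarith+
  with steps[of k] show ?thesis by blast
qed

definition circle_vec :: "'n \<Rightarrow> real \<Rightarrow> 'n option \<Rightarrow> real" where
  "circle_vec b \<theta> i = (if i = None then cos \<theta> else if i = Some b then sin \<theta> else 0)"

lemma sum_circle_vec: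
  fixes b :: "'n::finite"
  shows "(\<Sum>i\<in>UNIV. circle_vec b \<theta> i * circle_vec b \<phi> i) = cos (\<theta> - \<phi>)"
proof -
  have "(\<Sum>i\<in>UNIV. circle_vec b \<theta> i * circle_vec b \<phi> i) = (\<Sum>i\<in>{None, Some b}. circle_vec b \<theta> i * circle_vec b \<phi> i)"
    by (rule sum.mono_neutral_right) (auto simp: circle_vec_def)
  then show ?thesis by (simp add: circle_vec_def cos_diff)
qed

lemma circle_vec_unit:
  fixes b :: "'n::finite"
  shows "(\<Sum>i\<in>UNIV. (circle_vec b \<theta> i)\<^sup>2) = 1"
  using sum_circle_vec[of b \<theta> \<theta>] by (simp add: power2_eq_square)

text \<open>
  The point spanned by the unit vector with angle \<open>t\<close>.
\<close>
lemma height_circle: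
  fixes b :: "'n::finite"
  obtains p :: "'n hproj" where "\<And>\<theta>. height (circle_vec b \<theta>) p = (cos (\<theta> - t))\<^sup>2"
proof -
  define x :: "quat ^ 'n option" where "x = (\<chi> i. circle_vec b t i *\<^sub>R qone)"
  have q1: "qone \<bullet> qone = 1" by (simp add: qone_def inner_quat)
  have n1: "(norm x)\<^sup>2 = 1"
    using sum_circle_vec[of b t t] by (simp add: x_def power2_norm_eq_inner inner_vec_def q1)
  then have x0: "x \<noteq> 0" by auto
  have "(\<Sum>i\<in>UNIV. circle_vec b \<theta> i *\<^sub>R x $ i) = cos (\<theta> - t) *\<^sub>R qone" for \<theta>
    by (simp add: x_def scaleR_sum_left[symmetric] sum_circle_vec)
  moreover have "(norm qone)\<^sup>2 = 1" by (simp add: power2_norm_eq_inner q1)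
  ultimately have "coordinate_ratio (circle_vec b \<theta>) x = (cos (\<theta> - t))\<^sup>2" for \<theta>
    by (simp add: coordinate_ratio_def n1 power_mult_distrib)
  with x0 show ?thesis by (intro that[of "hline x"]) (simp add: height_hline)
qed

lemma height_family_inj:
  fixes b :: "'n::finite" and U :: "real \<Rightarrow> real"
  assumes mono: "\<And>s t. 0 \<le> s \<Longrightarrow> s \<le> t \<Longrightarrow> t \<le> 1 \<Longrightarrow> U t \<le> U s" and nonconst: "U 0 \<noteq> U 1"
  shows "inj_on (\<lambda>\<theta>. U \<circ> height (circle_vec b \<theta>) :: 'n hproj \<Rightarrow> real) {0..1}"
proof (rule linorder_inj_onI')
  fix \<theta> \<phi> :: real assume r: "\<theta> \<in> {0..1}" "\<phi> \<in> {0..1}" and lt: "\<theta> < \<phi>"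
  show "(U \<circ> height (circle_vec b \<theta>) :: 'n hproj \<Rightarrow> real) \<noteq> U \<circ> height (circle_vec b \<phi>)"
  proof
    assume eq: "(U \<circ> height (circle_vec b \<theta>) :: 'n hproj \<Rightarrow> real) = U \<circ> height (circle_vec b \<phi>)"
    define W where "W t = U ((cos t)\<^sup>2)" for t
    have per: "W (t + (\<phi> - \<theta>)) = W t" for t
    proof -
      obtain p :: "'n hproj" where p: "\<And>\<theta>'. height (circle_vec b \<theta>') p = (cos (\<theta>' - (\<theta> - t)))\<^sup>2"
        using height_circle[of b "\<theta> - t"] by blast
      have "U (height (circle_vec b \<theta>) p) = U (height (circle_vec b \<phi>) p)" using fun_cong[OF eq, of p] by simp
      then show ?thesis by (simp add: p W_def algebra_simps)
    qed
    have "W (pi/2) = W 0"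
    proof (rule periodic_monotone_const[where W = W and d = "\<phi> - \<theta>" and b = "pi/2"])
      show "W (t + (\<phi> - \<theta>)) = W t" for t by (rule per)
      show "0 < \<phi> - \<theta>" using lt by simp
      show "\<phi> - \<theta> \<le> pi/2" using r pi_ge_two by auto
      fix s t :: real assume st: "0 \<le> s" "s \<le> t" "t \<le> pi/2"
      have "cos t \<le> cos s" "0 \<le> cos t" using st by (auto intro: cos_monotone_0_pi_le cos_ge_zero)
      then have "(cos t)\<^sup>2 \<le> (cos s)\<^sup>2" by (intro power_mono) auto
      moreover have "(cos s)\<^sup>2 \<le> 1" by (simp add: abs_square_le_1)
      ultimately show "W s \<le> W t" unfolding W_def by (intro mono) auto
    qed
    then show False using nonconst by (simp add: W_def)
  qed
qed

theorem corollary1p8: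
  fixes n k :: nat and q lam :: real
  assumes "n = CARD('n::finite)"
    and "n \<ge> 2"
    and "1 < q" and "q < (4 * real n + 2) / (4 * real n - 2)"
    and "k \<ge> 1"
    and "alpha n q k < lam" and "lam \<le> alpha n q (k + 1)"
  shows "\<exists>S :: ('n hproj \<Rightarrow> real) set.
           S \<subseteq> positive_solutions q lam \<and> finite S \<and>
           card S \<ge> (2 * ((n + 1) div 2) + 1) * k"
proof -
  define \<kappa> where "\<kappa> = 2 * n - 1"
  have \<kappa>: "real \<kappa> + 3 = 2 * (real n + 1)" "\<kappa> \<ge> 1" using assms(2) by (auto simp: \<kappa>_def of_nat_diff)
  have "alpha n q 1 \<le> alpha n q k"
    unfolding alpha_def using assms(3,5) by (intro divide_right_mono mult_mono) auto
  then have lam1: "alpha n q 1 < lam" using assms(6) by linarith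
  then have "4 * (4 + 4 * real n + 2) < lam * (q - 1)"
    using assms(3) by (simp add: alpha_def pos_divide_less_eq)
  then have unstable: "real \<kappa> + 3 < lam / 4 * (q - 1)" unfolding \<kappa>(1) by simp
  have "0 \<le> alpha n q 1" using assms(3) by (simp add: alpha_def)
  then have lam0: "lam > 0" using lam1 by linarith
  have "(4 * real n + 2) / (4 * real n - 2) \<le> 2" using assms(2) by (simp add: pos_divide_le_eq)
  then have q2: "q < 2" using assms(4) by linarith
  interpret lane_emden \<kappa> "lam / 4" q
    using \<kappa>(2) lam0 assms(3) q2 unstable by unfold_locales auto
  obtain U U' U'' where U:
    "\<And>s. s \<in> {0..1} \<Longrightarrow> (U has_real_derivative U' s) (at s within {0..1})"
    "\<And>s. s \<in> {0..1} \<Longrightarrow> (U' has_real_derivative U'' s) (at s within {0..1})"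
    "continuous_on {0..1} U''"
    "\<And>s. s \<in> {0..1} \<Longrightarrow> s * (1-s) * U'' s + (2 - (real \<kappa> + 3) * s) * U' s = lam / 4 * (U s - U s powr q)"
    "\<And>s. s \<in> {0..1} \<Longrightarrow> 0 < U s"
    "\<And>s t. 0 \<le> s \<Longrightarrow> s \<le> t \<Longrightarrow> t \<le> 1 \<Longrightarrow> U t \<le> U s"
    "U 0 \<noteq> U 1"
    using exists_nonconstant_radial_solution by blast
  \<comment> \<open>an arbitrary coordinate serves as the second axis of the plane\<close>
  define u where "u \<theta> = (U \<circ> height (circle_vec undefined \<theta>) :: 'n hproj \<Rightarrow> real)" for \<theta>
  have sol: "u \<theta> \<in> positive_solutions q lam" for \<theta>
    unfolding u_def
    by (rule height_solution[OF circle_vec_unit U(1) U(2) U(3) _ U(5)])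
       (use U(4) \<kappa>(1) assms(1) in auto)
  have "inj_on u {0..1}"
    unfolding u_def by (rule height_family_inj[OF U(6) U(7)])
  then have "infinite (u ` {0..1})"
    by (simp add: finite_image_iff infinite_Icc)
  then obtain S where "finite S" "card S = (2 * ((n + 1) div 2) + 1) * k" "S \<subseteq> u ` {0..1}"
    using infinite_arbitrarily_large by blast
  with sol show ?thesis by (intro exI[of _ S]) auto
qed

end
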